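(* Fix an integer $m\geq 2$, and suppose that: (i) the random variable $F$ is an element of $L^{4m-4}(\Omega)\cap \mathbb{D}^{1,4}$; (ii) for every $0\leq j\leq m-1$, the random variable $\Gamma_{j}(F)$ is in $L^2(\Omega)$. Then, for every integer $0\leq s\leq m$, $$\kappa_{s+1}(F) = s!\,E[\Gamma_s(F)].$$
   Context: Gaussian setting. Let $\mathfrak{H}$ be a real separable Hilbert space, and let $X=\{X(h),h\in \mathfrak{H}\}$ be an isonormal Gaussian process over $\mathfrak{H}$ on a probability space $(\Omega ,\mathcal{F},P)$: a centered Gaussian family with $E[X(h)X(g)]=\langle h,g\rangle_{\mathfrak{H}}$. Assume $\mathcal{F}=\sigma(X)$, and write $L^p(\Omega)=L^p(\Omega,\mathcal{F},P)$. For $q\geq 1$, the $q$th Wiener chaos $\mathcal{H}_q$ is the closed linear subspace of $L^2(\Omega)$ generated by $\{H_q(X(h)) : h\in\mathfrak{H},\ \|h\|_{\mathfrak{H}}=1\}$, with $H_q(x)=(-1)^q e^{x^2/2}\frac{d^q}{dx^q}e^{-x^2/2}$; $\mathcal{H}_0=\mathbb{R}$. One has the orthogonal decomposition $L^2(\Omega)=\bigoplus_{q\geq 0}\mathcal{H}_q$, and $J_q$ denotes the orthogonal projection onto $\mathcal{H}_q$. Malliavin derivative. $\mathcal{S}$ is the set of random variables $F=g(X(\phi_1),\ldots,X(\phi_n))$ with $n\geq 1$, $\phi_i\in\mathfrak{H}$ and $g:\mathbb{R}^n\to\mathbb{R}$ infinitely differentiable with partial derivatives of polynomial growth. For such $F$,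 $DF=\sum_{i=1}^n\frac{\partial g}{\partial x_i}(X(\phi_1),\ldots,X(\phi_n))\phi_i\in L^2(\Omega,\mathfrak{H})$, and $D^iF$ denotes the $i$th iterate, with values in the symmetric tensor power $\mathfrak{H}^{\odot i}$. For $k,p\geq 1$, $\mathbb{D}^{k,p}$ is the closure of $\mathcal{S}$ with respect to the norm $\|F\|_{k,p}^p=E[|F|^p]+\sum_{i=1}^k E(\|D^iF\|_{\mathfrak{H}^{\otimes i}}^p)$, and $D^i$ is extended accordingly. Pseudo-inverse of the Ornstein-Uhlenbeck generator. For $G\in L^2(\Omega)$, $L^{-1}G=-\sum_{q=1}^\infty \frac1q J_qG$, which belongs to $\mathbb{D}^{2,2}$ (so $DL^{-1}G$ is well defined). Recursive definition of $\Gamma_j$. For $F\in\mathbb{D}^{1,2}$, set $\Gamma_0(F)=F$ and $\Gamma_1(F)=\langle DF,-DL^{-1}F\rangle_{\mathfrak{H}}$. If, for $j\geq 1$, $\Gamma_j(F)$ is a well-defined element of $L^2(\Omega)$, set $\Gamma_{j+1}(F)=\langle DF,-DL^{-1}\Gamma_j(F)\rangle_{\mathfrak{H}}$. Cumulants. If $E|Y|^n<\infty$ and $\phi_Y(t)=E(e^{itY})$, the $j$th cumulant of $Y$, $1\leq j\leq n$, is $\kappa_j(Y)=(-i)^j\frac{d^j}{dt^j}\log\phi_Y(t)|_{t=0}$. *)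

theory Defs
  imports "HOL-Probability.Probability"
begin

section \<open>Isonormal Gaussian processes\<close>

text \<open>A real separable Hilbert space is a type of sort
  \<open>{real_inner, banach, second_countable_topology}\<close>.\<close>

definition Lp_fun :: "'a measure \<Rightarrow> real \<Rightarrow> ('a \<Rightarrow> 'b::{real_normed_vector, second_countable_topology}) set"
  where "Lp_fun M p = {f \<in> borel_measurable M. integrable M (\<lambda>\<omega>. norm (f \<omega>) powr p)}"

text \<open>A degenerate (a.s. zero) variable counts as centered Gaussian.\<close>

definition centered_gaussian :: "'a measure \<Rightarrow> ('a \<Rightarrow> real) \<Rightarrow> bool"
  where "centered_gaussian M Y \<longleftrightarrow> Y \<in> borel_measurable M \<and>
    ((AE \<omega> in M. Y \<omega> = 0) \<or> (\<exists>\<sigma>>0. distributed M lborel Y (normal_density 0 \<sigma>)))"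

definition centered_gaussian_family :: "'a measure \<Rightarrow> ('i \<Rightarrow> 'a \<Rightarrow> real) \<Rightarrow> bool"
  where "centered_gaussian_family M X \<longleftrightarrow>
    (\<forall>I c. finite I \<longrightarrow> centered_gaussian M (\<lambda>\<omega>. \<Sum>i\<in>I. c i * X i \<omega>))"

text \<open>The last conjunct is the standing assumption that the \<open>\<sigma>\<close>-algebra of the
  underlying probability space is the one generated by \<open>X\<close>.\<close>

definition isonormal :: "'a measure \<Rightarrow>
    ('h::{real_inner, banach, second_countable_topology} \<Rightarrow> 'a \<Rightarrow> real) \<Rightarrow> bool"
  where "isonormal M X \<longleftrightarrow> prob_space M \<and>
    centered_gaussian_family M X \<and>
    (\<forall>h g. (LINT \<omega>|M. X h \<omega> * X g \<omega>) = h \<bullet> g) \<and>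
    sets M = sigma_sets (space M) {X h -` B \<inter> space M | h B. B \<in> sets borel}"

section \<open>Wiener chaos and the pseudo-inverse of the Ornstein-Uhlenbeck generator\<close>

definition hermite :: "nat \<Rightarrow> real \<Rightarrow> real"
  where "hermite q x = (-1) ^ q * exp (x\<^sup>2 / 2) * (deriv ^^ q) (\<lambda>t. exp (- t\<^sup>2 / 2)) x"

definition wiener_chaos :: "'a measure \<Rightarrow>
    ('h::{real_inner, banach, second_countable_topology} \<Rightarrow> 'a \<Rightarrow> real) \<Rightarrow> nat \<Rightarrow> ('a \<Rightarrow> real) set"
  where "wiener_chaos M X q =
    (if q = 0 then {G \<in> Lp_fun M 2. \<exists>c. AE \<omega> in M. G \<omega> = c}
     else {G \<in> Lp_fun M 2. \<forall>\<epsilon>>0. \<exists>I c. finite I \<and> (\<forall>h\<in>I. norm h = 1) \<and>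
             (LINT \<omega>|M. (G \<omega> - (\<Sum>h\<in>I. c h * hermite q (X h \<omega>)))\<^sup>2) < \<epsilon>})"

text \<open>Elements of \<open>L\<^sup>2\<close> are functions here, not classes modulo null sets. The operators
  below therefore select one representative of a class that is determined almost surely.\<close>

definition chaos_proj :: "'a measure \<Rightarrow>
    ('h::{real_inner, banach, second_countable_topology} \<Rightarrow> 'a \<Rightarrow> real) \<Rightarrow> nat \<Rightarrow> ('a \<Rightarrow> real) \<Rightarrow> 'a \<Rightarrow> real"
  where "chaos_proj M X q G = (SOME Z. Z \<in> wiener_chaos M X q \<and>
    (\<forall>W \<in> wiener_chaos M X q. (LINT \<omega>|M. (G \<omega> - Z \<omega>) * W \<omega>) = 0))"

definition OU_pinv :: "'a measure \<Rightarrow>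
    ('h::{real_inner, banach, second_countable_topology} \<Rightarrow> 'a \<Rightarrow> real) \<Rightarrow> ('a \<Rightarrow> real) \<Rightarrow> 'a \<Rightarrow> real"
  where "OU_pinv M X G = (SOME Z. Z \<in> Lp_fun M 2 \<and>
    (\<lambda>N. LINT \<omega>|M. (Z \<omega> - (- (\<Sum>q=1..N. 1 / real q * chaos_proj M X q G \<omega>)))\<^sup>2)
      \<longlonglongrightarrow> 0)"

section \<open>Malliavin derivative\<close>

text \<open>Functions on \<open>\<real>\<^sup>n\<close> are functions on \<^term>\<open>topspace (Euclidean_space n)\<close>, that is, on
  the real sequences vanishing from index \<open>n\<close> on; values elsewhere are irrelevant.\<close>

definition partial_deriv :: "nat \<Rightarrow> ((nat \<Rightarrow> real) \<Rightarrow> real) \<Rightarrow> (nat \<Rightarrow> real) \<Rightarrow> real"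
  where "partial_deriv i g x = deriv (\<lambda>t. g (x(i := t))) (x i)"

definition partial_derivs :: "nat list \<Rightarrow> ((nat \<Rightarrow> real) \<Rightarrow> real) \<Rightarrow> (nat \<Rightarrow> real) \<Rightarrow> real"
  where "partial_derivs is g = foldr partial_deriv is g"

text \<open>\<open>C\<^sup>\<infinity>\<close>: all iterated partial derivatives exist and are continuous. The empty
  list in the growth condition covers \<open>g\<close> itself.\<close>

definition smooth_poly_growth :: "nat \<Rightarrow> ((nat \<Rightarrow> real) \<Rightarrow> real) \<Rightarrow> bool"
  where "smooth_poly_growth n g \<longleftrightarrow> (\<forall>is. set is \<subseteq> {..<n} \<longrightarrow>
    continuous_map (Euclidean_space n) euclideanreal (partial_derivs is g) \<and>
    (\<forall>i<n. \<forall>x \<in> topspace (Euclidean_space n).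
       (\<lambda>t. partial_derivs is g (x(i := t))) differentiable (at (x i))) \<and>
    (\<exists>C N. \<forall>x \<in> topspace (Euclidean_space n).
       \<bar>partial_derivs is g x\<bar> \<le> C * (1 + L2_set x {..<n}) ^ N))"

definition coord_vec :: "('h \<Rightarrow> 'a \<Rightarrow> real) \<Rightarrow> nat \<Rightarrow> (nat \<Rightarrow> 'h) \<Rightarrow> 'a \<Rightarrow> nat \<Rightarrow> real"
  where "coord_vec X n \<phi> \<omega> = (\<lambda>i. if i < n then X (\<phi> i) \<omega> else 0)"

text \<open>\<open>F \<in> \<S>\<close> with derivative \<open>U\<close>.\<close>

definition smooth_rv_deriv :: "('h::real_inner \<Rightarrow> 'a \<Rightarrow> real) \<Rightarrow> ('a \<Rightarrow> real) \<Rightarrow> ('a \<Rightarrow> 'h) \<Rightarrow> bool"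
  where "smooth_rv_deriv X F U \<longleftrightarrow> (\<exists>n\<ge>1. \<exists>g \<phi>. smooth_poly_growth n g \<and>
    F = (\<lambda>\<omega>. g (coord_vec X n \<phi> \<omega>)) \<and>
    U = (\<lambda>\<omega>. \<Sum>i<n. partial_deriv i g (coord_vec X n \<phi> \<omega>) *\<^sub>R \<phi> i))"

text \<open>Closure of the derivative on \<open>\<S>\<close> with respect to \<open>\<parallel>\<cdot>\<parallel>\<^bsub>1,p\<^esub>\<close>.
  All differences below are in \<open>L\<^sup>p\<close>, since elements of \<open>\<S>\<close> and their derivatives have all moments.\<close>

definition has_malliavin_deriv :: "'a measure \<Rightarrow>
    ('h::{real_inner, banach, second_countable_topology} \<Rightarrow> 'a \<Rightarrow> real) \<Rightarrow> real \<Rightarrow>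
    ('a \<Rightarrow> real) \<Rightarrow> ('a \<Rightarrow> 'h) \<Rightarrow> bool"
  where "has_malliavin_deriv M X p F U \<longleftrightarrow> F \<in> Lp_fun M p \<and> U \<in> Lp_fun M p \<and>
    (\<exists>Fs Us. (\<forall>n. smooth_rv_deriv X (Fs n) (Us n)) \<and>
      (\<lambda>n. (LINT \<omega>|M. \<bar>Fs n \<omega> - F \<omega>\<bar> powr p) + (LINT \<omega>|M. norm (Us n \<omega> - U \<omega>) powr p))
        \<longlonglongrightarrow> 0)"

text \<open>\<open>\<D>\<^bsup>1,p\<^esup>\<close>\<close>

definition malliavin_space :: "'a measure \<Rightarrow>
    ('h::{real_inner, banach, second_countable_topology} \<Rightarrow> 'a \<Rightarrow> real) \<Rightarrow> real \<Rightarrow> ('a \<Rightarrow> real) set"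
  where "malliavin_space M X p = {F. \<exists>U. has_malliavin_deriv M X p F U}"

text \<open>The derivative on \<open>\<D>\<^bsup>1,2\<^esup>\<close>.\<close>

definition malliavin_deriv :: "'a measure \<Rightarrow>
    ('h::{real_inner, banach, second_countable_topology} \<Rightarrow> 'a \<Rightarrow> real) \<Rightarrow> ('a \<Rightarrow> real) \<Rightarrow> 'a \<Rightarrow> 'h"
  where "malliavin_deriv M X F = (SOME U. has_malliavin_deriv M X 2 F U)"

section \<open>The variables \<open>\<Gamma>\<^sub>j(F)\<close> and cumulants\<close>

text \<open>\<open>Gamma_rv M X F (Suc j)\<close> is meaningful when \<open>F \<in> \<D>\<^bsup>1,2\<^esup>\<close> and \<open>Gamma_rv M X F j\<close>
  is in \<open>L\<^sup>2\<close>.\<close>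

primrec Gamma_rv :: "'a measure \<Rightarrow>
    ('h::{real_inner, banach, second_countable_topology} \<Rightarrow> 'a \<Rightarrow> real) \<Rightarrow> ('a \<Rightarrow> real) \<Rightarrow> nat \<Rightarrow> 'a \<Rightarrow> real"
  where
    "Gamma_rv M X F 0 = F"
  | "Gamma_rv M X F (Suc j) =
      (\<lambda>\<omega>. malliavin_deriv M X F \<omega> \<bullet> (- malliavin_deriv M X (OU_pinv M X (Gamma_rv M X F j)) \<omega>))"

text \<open>Complex-valued, since the defining expression is. The principal branch \<^term>\<open>Ln\<close> is
  smooth near \<open>\<phi>\<^sub>Y(0) = 1\<close>, which is all that matters for derivatives at \<open>0\<close>.\<close>

definition cumulant :: "'a measure \<Rightarrow> nat \<Rightarrow> ('a \<Rightarrow> real) \<Rightarrow> complex"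
  where "cumulant M j Y = (- \<i>) ^ j *
    ((\<lambda>f t. vector_derivative f (at t)) ^^ j) (\<lambda>t. Ln (char (distr M borel Y) t)) 0"

end

theory Submission
  imports Defs "HOL-Real_Asymp.Real_Asymp"
begin

text \<open>
  The cumulants of \<open>F\<close> are, up to powers of \<open>\<i>\<close>, the derivatives at zero of \<open>log \<phi>\<close>, where
  \<open>\<phi>(t) = E[exp(itF)]\<close>, and \<open>(log \<phi>)' = \<phi>' / \<phi>\<close> with \<open>\<phi>'(t) = i E[F exp(itF)]\<close>. The key is the
  integration by parts formula \<open>E[f(F) (G - E G)] = E[f'(F) \<langle>DF, -D L\<^sup>-\<^sup>1 G\<rangle>]\<close> (\<open>malliavin_ibp\<close>).
  With \<open>f(x) = exp(itx)\<close> and \<open>G = \<Gamma>\<^sub>j(F)\<close> it reads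
  \<open>E[\<Gamma>\<^sub>j(F) exp(itF)] = E[\<Gamma>\<^sub>j(F)] \<phi>(t) + it E[\<Gamma>\<^sub>j\<^sub>+\<^sub>1(F) exp(itF)]\<close>. Starting from \<open>\<Gamma>\<^sub>0(F) = F\<close> and
  applying it \<open>m\<close> times (\<open>Gamma_expansion\<close>) yields
  \<open>\<phi>'(t) / \<phi>(t) = i (\<Sum>\<^sub>j\<^sub><\<^sub>m E[\<Gamma>\<^sub>j(F)] (it)\<^sup>j + (it)\<^sup>m E[\<Gamma>\<^sub>m(F) exp(itF)] / \<phi>(t))\<close>, and the last quotient
  tends to \<open>E[\<Gamma>\<^sub>m(F)]\<close> as \<open>t \<rightarrow> 0\<close>. As \<open>F\<close> has a moment of order \<open>m + 1\<close>, the function \<open>\<phi>' / \<phi>\<close> is \<open>m\<close> times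
  continuously differentiable near zero, and its derivatives at zero can be read off from this
  expansion (\<open>cumulant_from_expansion\<close>).

  The integration by parts formula comes from Gaussian integration by parts in one direction:
  if \<open>\<Phi>\<close> is a regular function of finitely many \<open>X \<phi>\<^sub>i\<close> and \<open>\<parallel>h\<parallel> = 1\<close>, then
  \<open>E[\<Phi> H\<^sub>q\<^sub>+\<^sub>1(X h)] = E[\<langle>D\<Phi>, h\<rangle> H\<^sub>q(X h)]\<close> (\<open>cyl_ibp\<close>). Since \<open>D H\<^sub>q(X h) = q H\<^sub>q\<^sub>-\<^sub>1(X h) h\<close>, this means
  \<open>E\<langle>D\<Phi>, DZ\<rangle> = q E[\<Phi> Z]\<close> for \<open>Z\<close> in the \<open>q\<close>th chaos. This identity makes different chaoses
  orthogonal, it shows that \<open>L\<^sup>-\<^sup>1 G\<close> has a derivative, and summed over the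
  components of \<open>L\<^sup>-\<^sup>1 G\<close>, whose weights \<open>-1/q\<close> cancel the factor \<open>q\<close>, it gives
  \<open>E\<langle>D\<Phi>, -D L\<^sup>-\<^sup>1 G\<rangle> = E[\<Phi> (G - E G)]\<close> (\<open>OU_pinv_malliavin\<close>). The formula for \<open>F\<close> is the limit of
  that for \<open>\<Phi> = f(F\<^sub>n)\<close> with smooth \<open>F\<^sub>n\<close>.

  That the chaos components of \<open>G\<close> add up to \<open>G\<close> rests on Fourier uniqueness: a variable
  orthogonal to all \<open>H\<^sub>q(X h)\<close> is orthogonal to all \<open>exp(i X k)\<close> and then vanishes, because the
  \<open>\<sigma>\<close>-algebra is generated by \<open>X\<close> (\<open>orthogonal_exponentials_zero\<close>). The same principle gives the
  independence of \<open>X h\<close> from the \<open>X k\<close> with \<open>k\<close> orthogonal to \<open>h\<close>, on which \<open>cyl_ibp\<close> relies, and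
  shows that inner products of a Malliavin derivative with fixed vectors are almost surely
  unique, so that it is immaterial which representative of \<open>D\<close> is chosen.
\<close>

section \<open>Square-integrable functions\<close>

lemma L2_iff:
  "f \<in> Lp_fun M 2 \<longleftrightarrow> f \<in> borel_measurable M \<and> integrable M (\<lambda>\<omega>. (norm (f \<omega>))\<^sup>2)"
  by (simp add: Lp_fun_def)

lemma L2_measurable: "f \<in> Lp_fun M 2 \<Longrightarrow> f \<in> borel_measurable M"
  by (simp add: L2_iff)

definition l2norm :: "'a measure \<Rightarrow> ('a \<Rightarrow> 'b::{real_normed_vector, second_countable_topology}) \<Rightarrow> real"
  where "l2norm M f = sqrt (LINT \<omega>|M. (norm (f \<omega>))\<^sup>2)"

lemma l2norm_nonneg [simp]: "0 \<le> l2norm M f"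
  by (simp add: l2norm_def)

lemma l2norm_sq: "(l2norm M f)\<^sup>2 = (LINT \<omega>|M. (norm (f \<omega>))\<^sup>2)"
  by (simp add: l2norm_def)

lemma L2_norm_mult_integrable:
  assumes "f \<in> Lp_fun M 2" "g \<in> Lp_fun M 2"
  shows "integrable M (\<lambda>\<omega>. norm (f \<omega>) * norm (g \<omega>))"
proof (rule Bochner_Integration.integrable_bound)
  show "integrable M (\<lambda>\<omega>. (norm (f \<omega>))\<^sup>2 + (norm (g \<omega>))\<^sup>2)"
    using assms by (simp add: L2_iff)
  have [measurable]: "f \<in> borel_measurable M" "g \<in> borel_measurable M"
    using assms by (simp_all add: L2_iff)
  show "(\<lambda>\<omega>. norm (f \<omega>) * norm (g \<omega>)) \<in> borel_measurable M" by measurable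
  have "a * b \<le> a\<^sup>2 + b\<^sup>2" if "0 \<le> a" "0 \<le> b" for a b :: real
    using sum_squares_bound[of a b] mult_nonneg_nonneg[OF that] by linarith
  then show "AE \<omega> in M. norm (norm (f \<omega>) * norm (g \<omega>)) \<le> norm ((norm (f \<omega>))\<^sup>2 + (norm (g \<omega>))\<^sup>2)"
    by simp
qed

lemma L2_inner_integrable:
  fixes f g :: "'a \<Rightarrow> 'b::{real_inner, banach, second_countable_topology}"
  assumes "f \<in> Lp_fun M 2" "g \<in> Lp_fun M 2"
  shows "integrable M (\<lambda>\<omega>. f \<omega> \<bullet> g \<omega>)"
proof (rule Bochner_Integration.integrable_bound[OF L2_norm_mult_integrable[OF assms]])
  have [measurable]: "f \<in> borel_measurable M" "g \<in> borel_measurable M"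
    using assms by (simp_all add: L2_iff)
  show "(\<lambda>\<omega>. f \<omega> \<bullet> g \<omega>) \<in> borel_measurable M" by measurable
qed (simp add: Cauchy_Schwarz_ineq2)

lemma L2_mult_integrable:
  fixes f g :: "'a \<Rightarrow> real"
  assumes "f \<in> Lp_fun M 2" "g \<in> Lp_fun M 2"
  shows "integrable M (\<lambda>\<omega>. f \<omega> * g \<omega>)"
  using L2_inner_integrable[OF assms] by simp

lemma L2_scaleR:
  fixes f :: "'a \<Rightarrow> 'b::{real_normed_vector, second_countable_topology}"
  assumes "f \<in> Lp_fun M 2"
  shows "(\<lambda>\<omega>. c *\<^sub>R f \<omega>) \<in> Lp_fun M 2"
proof -
  have [measurable]: "f \<in> borel_measurable M" using assms by (simp add: L2_iff)
  have "(\<lambda>\<omega>. c *\<^sub>R f \<omega>) \<in> borel_measurable M" by measurable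
  then show ?thesis using assms by (simp add: L2_iff power_mult_distrib)
qed

lemma L2_mult_const: "f \<in> Lp_fun M 2 \<Longrightarrow> (\<lambda>\<omega>. c * f \<omega>) \<in> Lp_fun M 2" for c :: real
  using L2_scaleR[of f M c] by simp

lemma L2_uminus:
  fixes f :: "'a \<Rightarrow> 'b::{real_normed_vector, second_countable_topology}"
  shows "f \<in> Lp_fun M 2 \<Longrightarrow> (\<lambda>\<omega>. - f \<omega>) \<in> Lp_fun M 2"
  using L2_scaleR[of f M "-1"] by simp

lemma norm_add_sq_le: "(norm (x + y))\<^sup>2 \<le> 2 * (norm x)\<^sup>2 + 2 * (norm y)\<^sup>2"
  for x y :: "'b::real_normed_vector"
proof -
  have "(norm (x + y))\<^sup>2 \<le> (norm x + norm y)\<^sup>2"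
    by (intro power_mono norm_triangle_ineq) simp
  also have "\<dots> \<le> 2 * (norm x)\<^sup>2 + 2 * (norm y)\<^sup>2"
    using sum_squares_bound[of "norm x" "norm y"] by (simp add: power2_sum)
  finally show ?thesis .
qed

lemma L2_add:
  fixes f g :: "'a \<Rightarrow> 'b::{real_normed_vector, second_countable_topology}"
  assumes "f \<in> Lp_fun M 2" "g \<in> Lp_fun M 2"
  shows "(\<lambda>\<omega>. f \<omega> + g \<omega>) \<in> Lp_fun M 2"
proof -
  have [measurable]: "f \<in> borel_measurable M" "g \<in> borel_measurable M"
    using assms by (simp_all add: L2_iff)
  have "integrable M (\<lambda>\<omega>. (norm (f \<omega> + g \<omega>))\<^sup>2)"
  proof (rule Bochner_Integration.integrable_bound)
    show "integrable M (\<lambda>\<omega>. 2 * (norm (f \<omega>))\<^sup>2 + 2 * (norm (g \<omega>))\<^sup>2)"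
      using assms by (simp add: L2_iff)
    show "AE \<omega> in M. norm ((norm (f \<omega> + g \<omega>))\<^sup>2) \<le> norm (2 * (norm (f \<omega>))\<^sup>2 + 2 * (norm (g \<omega>))\<^sup>2)"
      by (simp add: norm_add_sq_le)
  qed measurable
  then show ?thesis by (simp add: L2_iff)
qed

lemma L2_diff:
  fixes f g :: "'a \<Rightarrow> 'b::{real_normed_vector, second_countable_topology}"
  assumes "f \<in> Lp_fun M 2" "g \<in> Lp_fun M 2"
  shows "(\<lambda>\<omega>. f \<omega> - g \<omega>) \<in> Lp_fun M 2"
  using L2_add[OF assms(1) L2_uminus[OF assms(2)]] by simp

lemma L2_bound:
  assumes "f \<in> Lp_fun M 2" "g \<in> borel_measurable M" "\<And>\<omega>. norm (g \<omega>) \<le> norm (f \<omega>)"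
  shows "g \<in> Lp_fun M 2"
proof -
  have "integrable M (\<lambda>\<omega>. (norm (g \<omega>))\<^sup>2)"
    by (rule Bochner_Integration.integrable_bound[of _ "\<lambda>\<omega>. (norm (f \<omega>))\<^sup>2"])
      (use assms in \<open>auto simp: L2_iff intro: power_mono\<close>)
  then show ?thesis using assms by (simp add: L2_iff)
qed

lemma L2_bounded_mult:
  assumes "f \<in> Lp_fun M 2" and [measurable]: "b \<in> borel_measurable M" and "\<And>\<omega>. \<bar>b \<omega>\<bar> \<le> B"
  shows "(\<lambda>\<omega>. b \<omega> *\<^sub>R f \<omega>) \<in> Lp_fun M 2"
proof (rule L2_bound[OF L2_scaleR[OF assms(1), of B]])
  have [measurable]: "f \<in> borel_measurable M" using assms(1) by (rule L2_measurable)
  show "(\<lambda>\<omega>. b \<omega> *\<^sub>R f \<omega>) \<in> borel_measurable M" by measurable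
  show "norm (b \<omega> *\<^sub>R f \<omega>) \<le> norm (B *\<^sub>R f \<omega>)" for \<omega>
    using assms(3)[of \<omega>] by (auto intro: mult_right_mono)
qed

lemma L2_zero: "(\<lambda>\<omega>. 0) \<in> Lp_fun M 2"
  by (simp add: L2_iff)

lemma L2_sum:
  fixes f :: "'i \<Rightarrow> 'a \<Rightarrow> 'b::{real_normed_vector, second_countable_topology}"
  assumes "\<And>i. i \<in> I \<Longrightarrow> f i \<in> Lp_fun M 2"
  shows "(\<lambda>\<omega>. \<Sum>i\<in>I. f i \<omega>) \<in> Lp_fun M 2"
  using assms by (induction I rule: infinite_finite_induct) (auto intro: L2_add L2_zero)

lemma L2_norm_mult_CS:
  assumes "f \<in> Lp_fun M 2" "g \<in> Lp_fun M 2"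
  shows "(LINT \<omega>|M. norm (f \<omega>) * norm (g \<omega>)) \<le> l2norm M f * l2norm M g"
proof -
  have [measurable]: "f \<in> borel_measurable M" "g \<in> borel_measurable M"
    using assms by (simp_all add: L2_iff)
  define p where "p = (LINT \<omega>|M. norm (f \<omega>) * norm (g \<omega>))"
  have p: "0 \<le> p" unfolding p_def by simp
  have "(\<integral>\<^sup>+\<omega>. ennreal (norm (f \<omega>)) * ennreal (norm (g \<omega>)) \<partial>M)\<^sup>2
     \<le> (\<integral>\<^sup>+\<omega>. (ennreal (norm (f \<omega>)))\<^sup>2 \<partial>M) * (\<integral>\<^sup>+\<omega>. (ennreal (norm (g \<omega>)))\<^sup>2 \<partial>M)"
    by (rule Cauchy_Schwarz_nn_integral) measurable
  also have "(\<integral>\<^sup>+\<omega>. ennreal (norm (f \<omega>)) * ennreal (norm (g \<omega>)) \<partial>M) = ennreal p"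
    unfolding p_def using nn_integral_eq_integral[OF L2_norm_mult_integrable[OF assms]]
    by (simp add: ennreal_mult')
  also have "(\<integral>\<^sup>+\<omega>. (ennreal (norm (f \<omega>)))\<^sup>2 \<partial>M) = ennreal ((l2norm M f)\<^sup>2)"
    using assms by (simp add: l2norm_sq nn_integral_eq_integral ennreal_power L2_iff)
  also have "(\<integral>\<^sup>+\<omega>. (ennreal (norm (g \<omega>)))\<^sup>2 \<partial>M) = ennreal ((l2norm M g)\<^sup>2)"
    using assms by (simp add: l2norm_sq nn_integral_eq_integral ennreal_power L2_iff)
  finally have "ennreal (p\<^sup>2) \<le> ennreal ((l2norm M f)\<^sup>2 * (l2norm M g)\<^sup>2)"
    using p by (simp add: ennreal_power ennreal_mult)
  then have "p\<^sup>2 \<le> (l2norm M f * l2norm M g)\<^sup>2"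
    by (simp add: power_mult_distrib)
  then show ?thesis unfolding p_def[symmetric]
    by (rule power2_le_imp_le) simp
qed

lemma L2_CS:
  fixes f g :: "'a \<Rightarrow> 'b::{real_inner, banach, second_countable_topology}"
  assumes "f \<in> Lp_fun M 2" "g \<in> Lp_fun M 2"
  shows "\<bar>LINT \<omega>|M. f \<omega> \<bullet> g \<omega>\<bar> \<le> l2norm M f * l2norm M g"
proof -
  have "\<bar>LINT \<omega>|M. f \<omega> \<bullet> g \<omega>\<bar> \<le> (LINT \<omega>|M. \<bar>f \<omega> \<bullet> g \<omega>\<bar>)"
    using integral_norm_bound[of M "\<lambda>\<omega>. f \<omega> \<bullet> g \<omega>"] by simp
  also have "\<dots> \<le> (LINT \<omega>|M. norm (f \<omega>) * norm (g \<omega>))"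
    by (intro integral_mono integrable_abs L2_inner_integrable L2_norm_mult_integrable assms
        Cauchy_Schwarz_ineq2)
  also have "\<dots> \<le> l2norm M f * l2norm M g" by (rule L2_norm_mult_CS[OF assms])
  finally show ?thesis .
qed

lemma l2norm_triangle:
  fixes f g :: "'a \<Rightarrow> 'b::{real_inner, banach, second_countable_topology}"
  assumes "f \<in> Lp_fun M 2" "g \<in> Lp_fun M 2"
  shows "l2norm M (\<lambda>\<omega>. f \<omega> + g \<omega>) \<le> l2norm M f + l2norm M g"
proof (rule power2_le_imp_le)
  have "(l2norm M (\<lambda>\<omega>. f \<omega> + g \<omega>))\<^sup>2
      = (LINT \<omega>|M. (norm (f \<omega>))\<^sup>2 + (norm (g \<omega>))\<^sup>2 + 2 * (f \<omega> \<bullet> g \<omega>))"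
    unfolding l2norm_sq by (simp add: power2_norm_eq_inner inner_add inner_commute algebra_simps)
  also have "\<dots> = (l2norm M f)\<^sup>2 + (l2norm M g)\<^sup>2 + 2 * (LINT \<omega>|M. f \<omega> \<bullet> g \<omega>)"
    using assms L2_inner_integrable[OF assms] by (simp add: l2norm_sq L2_iff)
  also have "\<dots> \<le> (l2norm M f + l2norm M g)\<^sup>2"
    using L2_CS[OF assms] by (simp add: power2_sum)
  finally show "(l2norm M (\<lambda>\<omega>. f \<omega> + g \<omega>))\<^sup>2 \<le> (l2norm M f + l2norm M g)\<^sup>2" .
qed simp

lemma l2norm_scaleR: "l2norm M (\<lambda>\<omega>. c *\<^sub>R f \<omega>) = \<bar>c\<bar> * l2norm M f"
  by (simp add: l2norm_def power_mult_distrib real_sqrt_mult)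

lemma l2norm_commute: "l2norm M (\<lambda>\<omega>. f \<omega> - g \<omega>) = l2norm M (\<lambda>\<omega>. g \<omega> - f \<omega>)"
  by (simp add: l2norm_def norm_minus_commute)

lemma l2norm_diff_triangle:
  fixes f g h :: "'a \<Rightarrow> 'b::{real_inner, banach, second_countable_topology}"
  assumes "f \<in> Lp_fun M 2" "g \<in> Lp_fun M 2" "h \<in> Lp_fun M 2"
  shows "l2norm M (\<lambda>\<omega>. f \<omega> - h \<omega>) \<le> l2norm M (\<lambda>\<omega>. f \<omega> - g \<omega>) + l2norm M (\<lambda>\<omega>. g \<omega> - h \<omega>)"
  using l2norm_triangle[OF L2_diff[OF assms(1,2)] L2_diff[OF assms(2,3)]] by simp

lemma l2norm_eq_0_AE:
  assumes "f \<in> Lp_fun M 2" "l2norm M f = 0"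
  shows "AE \<omega> in M. f \<omega> = 0"
proof -
  have "(LINT \<omega>|M. (norm (f \<omega>))\<^sup>2) = 0" using assms(2) by (simp add: l2norm_def)
  then have "AE \<omega> in M. (norm (f \<omega>))\<^sup>2 = 0"
    using assms(1) by (subst (asm) integral_nonneg_eq_0_iff_AE) (auto simp: L2_iff)
  then show ?thesis by simp
qed

lemma l2norm_cong_AE:
  assumes "f \<in> borel_measurable M" "g \<in> borel_measurable M" "AE \<omega> in M. f \<omega> = g \<omega>"
  shows "l2norm M f = l2norm M g"
proof -
  have "(LINT \<omega>|M. (norm (f \<omega>))\<^sup>2) = (LINT \<omega>|M. (norm (g \<omega>))\<^sup>2)"
    using assms by (intro integral_cong_AE) auto
  then show ?thesis by (simp add: l2norm_def)
qed

lemma L2_inner_tendsto: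
  fixes f :: "nat \<Rightarrow> 'a \<Rightarrow> 'b::{real_inner, banach, second_countable_topology}"
  assumes "\<And>n. f n \<in> Lp_fun M 2" "f' \<in> Lp_fun M 2" "g \<in> Lp_fun M 2"
    and "(\<lambda>n. l2norm M (\<lambda>\<omega>. f n \<omega> - f' \<omega>)) \<longlonglongrightarrow> 0"
  shows "(\<lambda>n. LINT \<omega>|M. f n \<omega> \<bullet> g \<omega>) \<longlonglongrightarrow> (LINT \<omega>|M. f' \<omega> \<bullet> g \<omega>)"
proof (rule LIM_zero_cancel, rule Lim_null_comparison)
  have "norm ((LINT \<omega>|M. f n \<omega> \<bullet> g \<omega>) - (LINT \<omega>|M. f' \<omega> \<bullet> g \<omega>))
     \<le> l2norm M (\<lambda>\<omega>. f n \<omega> - f' \<omega>) * l2norm M g" for n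
  proof -
    have "(LINT \<omega>|M. f n \<omega> \<bullet> g \<omega>) - (LINT \<omega>|M. f' \<omega> \<bullet> g \<omega>) = (LINT \<omega>|M. (f n \<omega> - f' \<omega>) \<bullet> g \<omega>)"
      by (simp add: inner_diff_left L2_inner_integrable assms)
    then show ?thesis using L2_CS[OF L2_diff[OF assms(1)[of n] assms(2)] assms(3)] by simp
  qed
  then show "\<forall>\<^sub>F n in sequentially. norm ((LINT \<omega>|M. f n \<omega> \<bullet> g \<omega>) - (LINT \<omega>|M. f' \<omega> \<bullet> g \<omega>))
     \<le> l2norm M (\<lambda>\<omega>. f n \<omega> - f' \<omega>) * l2norm M g" by simp
  show "(\<lambda>n. l2norm M (\<lambda>\<omega>. f n \<omega> - f' \<omega>) * l2norm M g) \<longlonglongrightarrow> 0"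
    using assms(4) by (rule tendsto_mult_left_zero)
qed

lemma L4_iff: "f \<in> Lp_fun M 4 \<longleftrightarrow> f \<in> borel_measurable M \<and> (\<lambda>\<omega>. (norm (f \<omega>))\<^sup>2) \<in> Lp_fun M 2"
proof -
  have "(norm x) powr 4 = ((norm x)\<^sup>2)\<^sup>2" for x :: 'b by simp
  then show ?thesis by (auto simp: Lp_fun_def)
qed

lemma L4_add:
  fixes f g :: "'a \<Rightarrow> 'b::{real_inner, banach, second_countable_topology}"
  assumes "f \<in> Lp_fun M 4" "g \<in> Lp_fun M 4"
  shows "(\<lambda>\<omega>. f \<omega> + g \<omega>) \<in> Lp_fun M 4"
proof -
  have [measurable]: "f \<in> borel_measurable M" "g \<in> borel_measurable M" using assms by (auto simp: L4_iff)
  have "(\<lambda>\<omega>. (norm (f \<omega> + g \<omega>))\<^sup>2) \<in> Lp_fun M 2"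
  proof (rule L2_bound)
    show "(\<lambda>\<omega>. 2 * (norm (f \<omega>))\<^sup>2 + 2 * (norm (g \<omega>))\<^sup>2) \<in> Lp_fun M 2"
      using assms by (intro L2_add L2_mult_const) (auto simp: L4_iff)
    show "norm ((norm (f \<omega> + g \<omega>))\<^sup>2) \<le> norm (2 * (norm (f \<omega>))\<^sup>2 + 2 * (norm (g \<omega>))\<^sup>2)" for \<omega>
      using norm_add_sq_le[of "f \<omega>" "g \<omega>"] by simp
  qed measurable
  then show ?thesis by (simp add: L4_iff)
qed

lemma L4_uminus:
  fixes f :: "'a \<Rightarrow> 'b::{real_inner, banach, second_countable_topology}"
  shows "f \<in> Lp_fun M 4 \<Longrightarrow> (\<lambda>\<omega>. - f \<omega>) \<in> Lp_fun M 4"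
  by (simp add: L4_iff)

context prob_space
begin

lemma L2_const: "(\<lambda>\<omega>. c) \<in> Lp_fun M 2"
  for c :: "'b::{real_normed_vector, second_countable_topology}"
  by (simp add: L2_iff)

lemma L2_integrable:
  fixes f :: "'a \<Rightarrow> 'b::{banach, second_countable_topology}"
  assumes "f \<in> Lp_fun M 2" shows "integrable M f"
proof -
  have "integrable M (\<lambda>\<omega>. norm (f \<omega>) * norm (1::real))"
    by (rule L2_norm_mult_integrable[OF assms L2_const])
  then show ?thesis using assms by (simp add: L2_iff integrable_norm_iff)
qed

lemma L1_le_l2norm:
  assumes "f \<in> Lp_fun M 2"
  shows "(LINT \<omega>|M. norm (f \<omega>)) \<le> l2norm M f"
proof -
  have "(LINT \<omega>|M. norm (f \<omega>) * norm (1::real)) \<le> l2norm M f * l2norm M (\<lambda>_. 1::real)"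
    by (rule L2_norm_mult_CS[OF assms L2_const])
  then show ?thesis by (simp add: l2norm_def prob_space)
qed

lemma L4_imp_L2:
  fixes f :: "'a \<Rightarrow> 'b::{real_inner, banach, second_countable_topology}"
  assumes "f \<in> Lp_fun M 4"
  shows "f \<in> Lp_fun M 2"
proof -
  have f: "f \<in> borel_measurable M" "(\<lambda>\<omega>. (norm (f \<omega>))\<^sup>2) \<in> Lp_fun M 2"
    using assms unfolding L4_iff by blast+
  then show ?thesis unfolding L2_iff[of f] using L2_integrable[OF f(2)] by blast
qed

lemma l2norm_le_L4:
  fixes f :: "'a \<Rightarrow> 'b::{real_inner, banach, second_countable_topology}"
  assumes "f \<in> Lp_fun M 4"
  shows "l2norm M f \<le> root 4 (LINT \<omega>|M. norm (f \<omega>) powr 4)"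
proof -
  have L: "(\<lambda>\<omega>. (norm (f \<omega>))\<^sup>2) \<in> Lp_fun M 2" using assms by (simp add: L4_iff)
  have "(l2norm M f)\<^sup>2 \<le> l2norm M (\<lambda>\<omega>. (norm (f \<omega>))\<^sup>2)"
    using L1_le_l2norm[OF L] by (simp add: l2norm_sq)
  also have "\<dots> = sqrt (LINT \<omega>|M. norm (f \<omega>) powr 4)" by (simp add: l2norm_def)
  finally have "((l2norm M f)\<^sup>2)\<^sup>2 \<le> (sqrt (LINT \<omega>|M. norm (f \<omega>) powr 4))\<^sup>2"
    by (intro power_mono) auto
  then have "(l2norm M f) ^ 4 \<le> (LINT \<omega>|M. norm (f \<omega>) powr 4)" by simp
  then have "root 4 ((l2norm M f) ^ 4) \<le> root 4 (LINT \<omega>|M. norm (f \<omega>) powr 4)"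
    by (intro real_root_le_mono) auto
  then show ?thesis by (simp add: real_root_power_cancel)
qed

text \<open>Riesz--Fischer. The \<open>L\<^sup>1\<close> bound gives an almost surely convergent subsequence; Fatou's
  lemma along it turns the Cauchy property into convergence to its pointwise limit.\<close>

lemma L2_complete:
  fixes f :: "nat \<Rightarrow> 'a \<Rightarrow> 'b::{real_inner, banach, second_countable_topology}"
  assumes f: "\<And>n. f n \<in> Lp_fun M 2"
    and Cauchy: "\<And>e. e > 0 \<Longrightarrow> \<exists>N. \<forall>m\<ge>N. \<forall>n\<ge>N. l2norm M (\<lambda>\<omega>. f m \<omega> - f n \<omega>) < e"
  shows "\<exists>g \<in> Lp_fun M 2. (\<lambda>n. l2norm M (\<lambda>\<omega>. f n \<omega> - g \<omega>)) \<longlonglongrightarrow> 0"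
proof -
  have [measurable]: "f n \<in> borel_measurable M" for n using f by (simp add: L2_iff)
  obtain r where r: "strict_mono r" and ae: "AE \<omega> in M. Cauchy (\<lambda>i. f (r i) \<omega>)"
  proof (rule cauchy_L1_AE_cauchy_subseq[of M f])
    show "integrable M (f n)" for n by (rule L2_integrable[OF f])
    fix e :: real assume "e > 0"
    then show "\<exists>N. \<forall>i\<ge>N. \<forall>j\<ge>N. (LINT x|M. norm (f i x - f j x)) < e"
      using Cauchy[of e] L1_le_l2norm[OF L2_diff[OF f f]] by (meson le_less_trans)
  qed blast
  define g where "g = (\<lambda>\<omega>. lim (\<lambda>i. f (r i) \<omega>))"
  have [measurable]: "g \<in> borel_measurable M" unfolding g_def by measurable
  have lim: "AE \<omega> in M. (\<lambda>i. f (r i) \<omega>) \<longlonglongrightarrow> g \<omega>"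
    using ae by eventually_elim (simp add: g_def Cauchy_convergent_iff convergent_LIMSEQ_iff)
  have fatou: "(\<integral>\<^sup>+\<omega>. ennreal ((norm (f n \<omega> - g \<omega>))\<^sup>2) \<partial>M) \<le> ennreal (e\<^sup>2)"
    if e: "e > 0" and N: "\<forall>m\<ge>N. \<forall>n\<ge>N. l2norm M (\<lambda>\<omega>. f m \<omega> - f n \<omega>) < e" and n: "n \<ge> N" for e N n
  proof -
    have "(\<integral>\<^sup>+\<omega>. ennreal ((norm (f n \<omega> - g \<omega>))\<^sup>2) \<partial>M)
       = (\<integral>\<^sup>+\<omega>. liminf (\<lambda>k. ennreal ((norm (f n \<omega> - f (r k) \<omega>))\<^sup>2)) \<partial>M)"
    proof (rule nn_integral_cong_AE)
      show "AE \<omega> in M. ennreal ((norm (f n \<omega> - g \<omega>))\<^sup>2)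
          = liminf (\<lambda>k. ennreal ((norm (f n \<omega> - f (r k) \<omega>))\<^sup>2))"
        using lim
      proof eventually_elim
        case (elim \<omega>)
        have "(\<lambda>k. ennreal ((norm (f n \<omega> - f (r k) \<omega>))\<^sup>2)) \<longlonglongrightarrow> ennreal ((norm (f n \<omega> - g \<omega>))\<^sup>2)"
          using elim by (intro tendsto_intros) auto
        from lim_imp_Liminf[OF trivial_limit_sequentially this] show ?case by (rule sym)
      qed
    qed
    also have "\<dots> \<le> liminf (\<lambda>k. \<integral>\<^sup>+\<omega>. ennreal ((norm (f n \<omega> - f (r k) \<omega>))\<^sup>2) \<partial>M)"
      by (rule nn_integral_liminf) measurable
    also have "\<dots> \<le> ennreal (e\<^sup>2)"
    proof (rule Liminf_le)
      have "(\<integral>\<^sup>+\<omega>. ennreal ((norm (f n \<omega> - f (r k) \<omega>))\<^sup>2) \<partial>M) \<le> ennreal (e\<^sup>2)" if "k \<ge> N" for k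
      proof -
        have "r k \<ge> N" using r that by (meson le_trans seq_suble)
        then have "(l2norm M (\<lambda>\<omega>. f n \<omega> - f (r k) \<omega>))\<^sup>2 \<le> e\<^sup>2"
          using N n by (intro power_mono) (auto intro: less_imp_le)
        then show ?thesis
          using L2_diff[OF f[of n] f[of "r k"]]
          by (simp add: nn_integral_eq_integral L2_iff l2norm_sq ennreal_leI)
      qed
      then show "\<forall>\<^sub>F k in sequentially. (\<integral>\<^sup>+\<omega>. ennreal ((norm (f n \<omega> - f (r k) \<omega>))\<^sup>2) \<partial>M) \<le> ennreal (e\<^sup>2)"
        by (auto simp: eventually_sequentially)
    qed simp
    finally show ?thesis .
  qed
  have d: "(\<lambda>\<omega>. f n \<omega> - g \<omega>) \<in> Lp_fun M 2 \<and> l2norm M (\<lambda>\<omega>. f n \<omega> - g \<omega>) \<le> e"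
    if e: "e > 0" and N: "\<forall>m\<ge>N. \<forall>n\<ge>N. l2norm M (\<lambda>\<omega>. f m \<omega> - f n \<omega>) < e" and n: "n \<ge> N" for e N n
  proof -
    have i: "integrable M (\<lambda>\<omega>. (norm (f n \<omega> - g \<omega>))\<^sup>2)"
      using fatou[OF that] le_less_trans by (intro integrableI_bounded) fastforce+
    then have "ennreal ((l2norm M (\<lambda>\<omega>. f n \<omega> - g \<omega>))\<^sup>2) \<le> ennreal (e\<^sup>2)"
      using fatou[OF that] by (simp add: nn_integral_eq_integral l2norm_sq)
    then have "(l2norm M (\<lambda>\<omega>. f n \<omega> - g \<omega>))\<^sup>2 \<le> e\<^sup>2" by simp
    then show ?thesis using i e by (auto simp: L2_iff intro: power2_le_imp_le)
  qed
  obtain N where "\<forall>m\<ge>N. \<forall>n\<ge>N. l2norm M (\<lambda>\<omega>. f m \<omega> - f n \<omega>) < 1" using Cauchy[of 1] by auto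
  then have "g \<in> Lp_fun M 2"
    using d[of 1 N N] L2_diff[OF f[of N], of "\<lambda>\<omega>. f N \<omega> - g \<omega>"] by simp
  moreover have "(\<lambda>n. l2norm M (\<lambda>\<omega>. f n \<omega> - g \<omega>)) \<longlonglongrightarrow> 0"
  proof (rule LIMSEQ_I)
    fix e :: real assume "e > 0"
    then obtain N where "\<forall>m\<ge>N. \<forall>n\<ge>N. l2norm M (\<lambda>\<omega>. f m \<omega> - f n \<omega>) < e / 2" using Cauchy[of "e/2"] by auto
    then show "\<exists>N. \<forall>n\<ge>N. norm (l2norm M (\<lambda>\<omega>. f n \<omega> - g \<omega>) - 0) < e"
      using d[of "e/2" N] \<open>e > 0\<close> by fastforce
  qed
  ultimately show ?thesis by blast
qed

text \<open>A minimizing sequence for the distance to \<open>K\<close> is Cauchy by the parallelogram identity, and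
  the variation of the distance at the minimizer in a direction \<open>W\<close> vanishes.\<close>

lemma L2_projection_exists:
  fixes K :: "('a \<Rightarrow> real) set"
  assumes sub: "K \<subseteq> Lp_fun M 2" and zero: "(\<lambda>_. 0) \<in> K"
    and lin: "\<And>f g a b. f \<in> K \<Longrightarrow> g \<in> K \<Longrightarrow> (\<lambda>\<omega>. a * f \<omega> + b * g \<omega>) \<in> K"
    and closed: "\<And>f. f \<in> Lp_fun M 2 \<Longrightarrow> (\<And>e. e > 0 \<Longrightarrow> \<exists>g\<in>K. l2norm M (\<lambda>\<omega>. f \<omega> - g \<omega>) < e) \<Longrightarrow> f \<in> K"
    and G: "G \<in> Lp_fun M 2"
  shows "\<exists>Z\<in>K. \<forall>W\<in>K. (LINT \<omega>|M. (G \<omega> - Z \<omega>) * W \<omega>) = 0"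
proof -
  define N where "N = (\<lambda>f::'a \<Rightarrow> real. (l2norm M f)\<^sup>2)"
  define D where "D = (\<lambda>W. N (\<lambda>\<omega>. G \<omega> - W \<omega>)) ` K"
  define d where "d = Inf D"
  have "D \<noteq> {}" using zero by (auto simp: D_def)
  have bdd: "bdd_below D" by (intro bdd_belowI[of _ 0]) (auto simp: D_def N_def)
  have d_le: "d \<le> N (\<lambda>\<omega>. G \<omega> - W \<omega>)" if "W \<in> K" for W
    unfolding d_def using that by (intro cInf_lower bdd) (auto simp: D_def)
  have "\<exists>W\<in>K. N (\<lambda>\<omega>. G \<omega> - W \<omega>) < d + 1 / real (Suc n)" for n
    using cInf_lessD[OF \<open>D \<noteq> {}\<close>, of "d + 1 / real (Suc n)"] by (auto simp: d_def D_def)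
  then obtain W where W: "\<And>n. W n \<in> K" and Wd: "\<And>n. N (\<lambda>\<omega>. G \<omega> - W n \<omega>) < d + 1 / real (Suc n)"
    by metis
  have WL: "W n \<in> Lp_fun M 2" for n using W sub by blast
  have par: "N (\<lambda>\<omega>. W m \<omega> - W n \<omega>) \<le> 2 / real (Suc m) + 2 / real (Suc n)" for m n
  proof -
    have mid: "(\<lambda>\<omega>. 1/2 * W m \<omega> + 1/2 * W n \<omega>) \<in> K" by (intro lin W)
    have eq: "(norm (W m \<omega> - W n \<omega>))\<^sup>2 = 2 * (norm (G \<omega> - W m \<omega>))\<^sup>2 + 2 * (norm (G \<omega> - W n \<omega>))\<^sup>2
        - 4 * (norm (G \<omega> - (1/2 * W m \<omega> + 1/2 * W n \<omega>)))\<^sup>2" for \<omega>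
      by (simp add: power2_eq_square field_simps)
    have i: "integrable M (\<lambda>\<omega>. (norm (G \<omega> - V \<omega>))\<^sup>2)" if "V \<in> K" for V
      using L2_diff[OF G, of V] that sub by (auto simp: L2_iff)
    have "N (\<lambda>\<omega>. W m \<omega> - W n \<omega>) = 2 * N (\<lambda>\<omega>. G \<omega> - W m \<omega>) + 2 * N (\<lambda>\<omega>. G \<omega> - W n \<omega>)
        - 4 * N (\<lambda>\<omega>. G \<omega> - (1/2 * W m \<omega> + 1/2 * W n \<omega>))"
      unfolding N_def l2norm_sq eq using i[OF W[of m]] i[OF W[of n]] i[OF mid] by simp
    then show ?thesis using Wd[of m] Wd[of n] d_le[OF mid] by simp
  qed
  have "\<exists>Z\<in>Lp_fun M 2. (\<lambda>n. l2norm M (\<lambda>\<omega>. W n \<omega> - Z \<omega>)) \<longlonglongrightarrow> 0"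
  proof (rule L2_complete[OF WL])
    fix e :: real assume e: "e > 0"
    then obtain N0 where N0: "1 / real (Suc N0) < e\<^sup>2 / 4"
      using reals_Archimedean[of "e\<^sup>2/4"] by (auto simp: inverse_eq_divide)
    have "l2norm M (\<lambda>\<omega>. W m \<omega> - W n \<omega>) < e" if "m \<ge> N0" "n \<ge> N0" for m n
    proof (rule power2_less_imp_less)
      have "1 / real (Suc m) \<le> 1 / real (Suc N0)" "1 / real (Suc n) \<le> 1 / real (Suc N0)"
        using that by (simp_all add: frac_le)
      then show "(l2norm M (\<lambda>\<omega>. W m \<omega> - W n \<omega>))\<^sup>2 < e\<^sup>2"
        using par[of m n] N0 unfolding N_def by linarith
    qed (use e in simp)
    then show "\<exists>N. \<forall>m\<ge>N. \<forall>n\<ge>N. l2norm M (\<lambda>\<omega>. W m \<omega> - W n \<omega>) < e" by blast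
  qed
  then obtain Z where ZL: "Z \<in> Lp_fun M 2" and lim: "(\<lambda>n. l2norm M (\<lambda>\<omega>. W n \<omega> - Z \<omega>)) \<longlonglongrightarrow> 0" by blast
  have ZK: "Z \<in> K"
  proof (rule closed[OF ZL])
    fix e :: real assume "e > 0"
    then obtain n where "l2norm M (\<lambda>\<omega>. W n \<omega> - Z \<omega>) < e"
      using order_tendstoD(2)[OF lim, of e] by (auto simp: eventually_sequentially)
    then show "\<exists>g\<in>K. l2norm M (\<lambda>\<omega>. Z \<omega> - g \<omega>) < e" using W l2norm_commute[of M Z] by metis
  qed
  have "sqrt d \<ge> l2norm M (\<lambda>\<omega>. G \<omega> - Z \<omega>)"
  proof (rule LIMSEQ_le_const)
    have "(\<lambda>n. sqrt (d + 1 / real (Suc n)) + l2norm M (\<lambda>\<omega>. W n \<omega> - Z \<omega>)) \<longlonglongrightarrow> sqrt (d + 0) + 0"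
      by (intro tendsto_intros lim LIMSEQ_Suc[OF lim_1_over_n])
    then show "(\<lambda>n. sqrt (d + 1 / real (Suc n)) + l2norm M (\<lambda>\<omega>. W n \<omega> - Z \<omega>)) \<longlonglongrightarrow> sqrt d" by simp
    have "l2norm M (\<lambda>\<omega>. G \<omega> - Z \<omega>) \<le> sqrt (d + 1 / real (Suc n)) + l2norm M (\<lambda>\<omega>. W n \<omega> - Z \<omega>)" for n
    proof -
      have "l2norm M (\<lambda>\<omega>. G \<omega> - W n \<omega>) \<le> sqrt (d + 1 / real (Suc n))"
        using Wd[of n] by (intro real_le_rsqrt) (simp add: N_def)
      then show ?thesis using l2norm_diff_triangle[OF G WL ZL, of n] by linarith
    qed
    then show "\<exists>N. \<forall>n\<ge>N. l2norm M (\<lambda>\<omega>. G \<omega> - Z \<omega>) \<le> sqrt (d + 1 / real (Suc n)) + l2norm M (\<lambda>\<omega>. W n \<omega> - Z \<omega>)"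
      by blast
  qed
  moreover have "0 \<le> d" unfolding d_def using \<open>D \<noteq> {}\<close> by (intro cInf_greatest) (auto simp: D_def N_def)
  ultimately have min: "N (\<lambda>\<omega>. G \<omega> - Z \<omega>) \<le> d"
    unfolding N_def using power_mono[of "l2norm M (\<lambda>\<omega>. G \<omega> - Z \<omega>)" "sqrt d" 2] by simp
  have "(LINT \<omega>|M. (G \<omega> - Z \<omega>) * V \<omega>) = 0" if V: "V \<in> K" for V
  proof -
    define p where "p = (LINT \<omega>|M. (G \<omega> - Z \<omega>) * V \<omega>)"
    define v where "v = N V"
    have VL: "V \<in> Lp_fun M 2" using V sub by blast
    have GZ: "(\<lambda>\<omega>. G \<omega> - Z \<omega>) \<in> Lp_fun M 2" by (rule L2_diff[OF G ZL])
    have ineq: "2 * t * p \<le> t\<^sup>2 * v" for t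
    proof -
      have K: "(\<lambda>\<omega>. 1 * Z \<omega> + t * V \<omega>) \<in> K" by (intro lin ZK V)
      have eq: "(norm (G \<omega> - (1 * Z \<omega> + t * V \<omega>)))\<^sup>2
          = (norm (G \<omega> - Z \<omega>))\<^sup>2 - 2 * t * ((G \<omega> - Z \<omega>) * V \<omega>) + t\<^sup>2 * (norm (V \<omega>))\<^sup>2" for \<omega>
        by (simp add: power2_eq_square algebra_simps)
      have "N (\<lambda>\<omega>. G \<omega> - (1 * Z \<omega> + t * V \<omega>)) = N (\<lambda>\<omega>. G \<omega> - Z \<omega>) - 2 * t * p + t\<^sup>2 * v"
        unfolding N_def l2norm_sq eq v_def p_def
        using GZ VL L2_mult_integrable[OF GZ VL] by (simp add: L2_iff)
      then show ?thesis using d_le[OF K] min by simp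
    qed
    have "p * p \<le> 0"
    proof -
      have "v \<ge> 0" by (simp add: v_def N_def)
      show ?thesis
      proof (cases "v = 0")
        case True then show ?thesis using ineq[of p] by simp
      next
        case False
        then show ?thesis using ineq[of "p / v"] \<open>v \<ge> 0\<close>
          by (simp add: power2_eq_square field_simps)
      qed
    qed
    then show "p = 0" by (metis mult_eq_0_iff not_le zero_less_mult_iff linorder_neqE)
  qed
  then show ?thesis using ZK by blast
qed

end

section \<open>Fourier uniqueness for weighted laws\<close>

lemma iexp_add: "iexp (a + b) = iexp a * iexp b"
  by (simp add: distrib_left exp_add)

lemma integrable_mult_iexp:
  fixes R :: "'a \<Rightarrow> complex"
  assumes "integrable M R" and [measurable]: "Y \<in> borel_measurable M"
  shows "integrable M (\<lambda>\<omega>. R \<omega> * iexp (Y \<omega>))"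
proof (rule Bochner_Integration.integrable_bound[OF assms(1)])
  have [measurable]: "R \<in> borel_measurable M" using assms(1) by simp
  show "(\<lambda>\<omega>. R \<omega> * iexp (Y \<omega>)) \<in> borel_measurable M" by measurable
qed (simp add: norm_mult)

context prob_space
begin

text \<open>The positive and the negative part of the weight have the same mass, and once normalized
  they turn the law of \<open>Y\<close> into two probability laws with equal characteristic functions, which
  coincide by Levy's theorem.\<close>

lemma fourier_weight_real:
  fixes R :: "'a \<Rightarrow> real"
  assumes R: "integrable M R" and [measurable]: "Y \<in> borel_measurable M"
    and zero: "\<And>t. (CLINT \<omega>|M. of_real (R \<omega>) * iexp (t * Y \<omega>)) = 0"
    and [measurable]: "A \<in> sets borel"
  shows "(LINT \<omega>|M. R \<omega> * indicator A (Y \<omega>)) = 0"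
proof -
  have [measurable]: "R \<in> borel_measurable M" using R by simp
  define P where "P = (\<lambda>\<omega>. max 0 (R \<omega>))"
  define N where "N = (\<lambda>\<omega>. max 0 (- R \<omega>))"
  have [measurable]: "P \<in> borel_measurable M" "N \<in> borel_measurable M"
    by (simp_all add: P_def N_def)
  have int: "integrable M P" "integrable M N" using R by (simp_all add: P_def N_def)
  have RPN: "R \<omega> = P \<omega> - N \<omega>" and nonneg: "0 \<le> P \<omega>" "0 \<le> N \<omega>" for \<omega>
    by (auto simp: P_def N_def max_def)
  have cint: "complex_integrable M (\<lambda>\<omega>. of_real (Q \<omega>) * iexp (t * Y \<omega>))" if "integrable M Q" for Q t
    by (rule integrable_mult_iexp) (use that in auto)
  have eqF: "(CLINT \<omega>|M. of_real (P \<omega>) * iexp (t * Y \<omega>)) = (CLINT \<omega>|M. of_real (N \<omega>) * iexp (t * Y \<omega>))" for t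
    using zero[of t] Bochner_Integration.integral_diff[OF cint[OF int(1)] cint[OF int(2)], of t t]
    by (simp add: RPN left_diff_distrib)
  define c where "c = (LINT \<omega>|M. P \<omega>)"
  have cN: "(LINT \<omega>|M. N \<omega>) = c" using eqF[of 0] by (simp add: c_def)
  show ?thesis
  proof (cases "c = 0")
    case True
    have "AE \<omega> in M. P \<omega> = 0" "AE \<omega> in M. N \<omega> = 0"
      using True cN integral_nonneg_eq_0_iff_AE[OF int(1)] integral_nonneg_eq_0_iff_AE[OF int(2)] nonneg
      by (auto simp: c_def)
    then have "AE \<omega> in M. R \<omega> * indicator A (Y \<omega>) = 0" by eventually_elim (simp add: RPN)
    then show ?thesis by (rule integral_eq_zero_AE)
  next
    case False
    have c: "c > 0" using False by (simp add: c_def nonneg less_le)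
    define D where "D = (\<lambda>Q. distr (density M (\<lambda>\<omega>. ennreal (Q \<omega> / c))) borel Y)"
    have D: "real_distribution (D Q)" "char (D Q) t = (CLINT \<omega>|M. of_real (Q \<omega>) * iexp (t * Y \<omega>)) / c"
      "(LINT x|D Q. indicator A x) = (LINT \<omega>|M. Q \<omega> * indicator A (Y \<omega>)) / c"
      if [measurable]: "Q \<in> borel_measurable M" and Q: "integrable M Q" "\<And>\<omega>. 0 \<le> Q \<omega>" "(LINT \<omega>|M. Q \<omega>) = c" for Q t
    proof -
      have "prob_space (density M (\<lambda>\<omega>. ennreal (Q \<omega> / c)))"
      proof
        have "(\<integral>\<^sup>+\<omega>. ennreal (Q \<omega> / c) \<partial>M) = ennreal (LINT \<omega>|M. Q \<omega> / c)"
          using c Q by (intro nn_integral_eq_integral) auto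
        also have "\<dots> = 1" using c Q by simp
        finally show "emeasure (density M (\<lambda>\<omega>. ennreal (Q \<omega> / c))) (space (density M (\<lambda>\<omega>. ennreal (Q \<omega> / c)))) = 1"
          by (simp add: emeasure_density cong: nn_integral_cong)
      qed
      then interpret Q: prob_space "density M (\<lambda>\<omega>. ennreal (Q \<omega> / c))" .
      show "real_distribution (D Q)" unfolding D_def by (rule Q.real_distribution_distr) simp
      show "char (D Q) t = (CLINT \<omega>|M. of_real (Q \<omega>) * iexp (t * Y \<omega>)) / c"
        unfolding D_def char_def using c Q
        by (simp add: integral_distr integral_density scaleR_conv_of_real)
      show "(LINT x|D Q. indicator A x) = (LINT \<omega>|M. Q \<omega> * indicator A (Y \<omega>)) / c"
        unfolding D_def using c Q
        by (subst integral_distr) (simp_all add: integral_density)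
    qed
    have "char (D P) = char (D N)"
      using D(2)[of P] D(2)[of N] int nonneg cN eqF by (auto simp: c_def)
    then have "D P = D N"
      using D(1)[of P] D(1)[of N] int nonneg cN by (intro Levy_uniqueness) (auto simp: c_def)
    then have "(LINT \<omega>|M. P \<omega> * indicator A (Y \<omega>)) = (LINT \<omega>|M. N \<omega> * indicator A (Y \<omega>))"
      using D(3)[of P] D(3)[of N] int nonneg cN c by (auto simp: c_def)
    moreover have "integrable M (\<lambda>\<omega>. Q \<omega> * indicator A (Y \<omega>))" if "integrable M Q" for Q :: "'a \<Rightarrow> real"
      using that by (intro Bochner_Integration.integrable_bound[OF that]) (auto simp: indicator_def)
    ultimately show ?thesis using int by (simp add: RPN left_diff_distrib)
  qed
qed

text \<open>The step from real weights is not immediate, as the exponential is complex itself: real and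
  imaginary part of the weight are separated by conjugation.\<close>

lemma fourier_weight_complex:
  fixes R :: "'a \<Rightarrow> complex"
  assumes R: "integrable M R" and [measurable]: "Y \<in> borel_measurable M"
    and zero: "\<And>t. (CLINT \<omega>|M. R \<omega> * iexp (t * Y \<omega>)) = 0"
    and [measurable]: "A \<in> sets borel"
  shows "(CLINT \<omega>|M. R \<omega> * indicator A (Y \<omega>)) = 0"
proof -
  have [measurable]: "R \<in> borel_measurable M" using R by simp
  have i: "complex_integrable M (\<lambda>\<omega>. R \<omega> * iexp (t * Y \<omega>))" for t
    by (rule integrable_mult_iexp[OF R]) measurable
  \<comment> \<open>conjugation reverses the frequency, so the conjugate weight satisfies the same hypothesis\<close>
  have cnj: "(CLINT \<omega>|M. cnj (R \<omega>) * iexp (t * Y \<omega>)) = 0" for t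
  proof -
    have "(CLINT \<omega>|M. cnj (R \<omega>) * iexp (t * Y \<omega>)) = (CLINT \<omega>|M. cnj (R \<omega> * iexp ((- t) * Y \<omega>)))"
      by (intro Bochner_Integration.integral_cong) (simp_all add: exp_cnj)
    also have "\<dots> = 0" by (rule trans[OF Bochner_Integration.integral_cnj]) (simp only: zero complex_cnj_zero)
    finally show ?thesis .
  qed
  have ic: "complex_integrable M (\<lambda>\<omega>. cnj (R \<omega>) * iexp (t * Y \<omega>))" for t
    by (rule integrable_mult_iexp) (use R in auto)
  have "(CLINT \<omega>|M. of_real (Re (R \<omega>)) * iexp (t * Y \<omega>)) = 0" for t
  proof -
    have "(CLINT \<omega>|M. of_real (Re (R \<omega>)) * iexp (t * Y \<omega>))
        = (CLINT \<omega>|M. (1/2) * (R \<omega> * iexp (t * Y \<omega>) + cnj (R \<omega>) * iexp (t * Y \<omega>)))"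
      by (intro Bochner_Integration.integral_cong) (simp_all add: complex_eq_iff field_simps)
    then show ?thesis using zero[of t] cnj[of t] i[of t] ic[of t] by simp
  qed
  then have re: "(LINT \<omega>|M. Re (R \<omega>) * indicator A (Y \<omega>)) = 0"
    by (intro fourier_weight_real) (use R in auto)
  have "(CLINT \<omega>|M. of_real (Im (R \<omega>)) * iexp (t * Y \<omega>)) = 0" for t
  proof -
    have "(CLINT \<omega>|M. of_real (Im (R \<omega>)) * iexp (t * Y \<omega>))
        = (CLINT \<omega>|M. (-\<i>/2) * (R \<omega> * iexp (t * Y \<omega>) - cnj (R \<omega>) * iexp (t * Y \<omega>)))"
      by (intro Bochner_Integration.integral_cong) (simp_all add: complex_eq_iff field_simps)
    then show ?thesis using zero[of t] cnj[of t] i[of t] ic[of t] by simp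
  qed
  then have im: "(LINT \<omega>|M. Im (R \<omega>) * indicator A (Y \<omega>)) = 0"
    by (intro fourier_weight_real) (use R in auto)
  have "complex_integrable M (\<lambda>\<omega>. R \<omega> * indicator A (Y \<omega>))"
    using R by (intro Bochner_Integration.integrable_bound[OF R]) (auto simp: indicator_def)
  note int = this
  have "Re (R \<omega> * indicator A (Y \<omega>)) = Re (R \<omega>) * indicator A (Y \<omega>)"
    "Im (R \<omega> * indicator A (Y \<omega>)) = Im (R \<omega>) * indicator A (Y \<omega>)" for \<omega>
    by (simp_all add: indicator_def)
  then show ?thesis using re im Bochner_Integration.integral_Re[OF int] Bochner_Integration.integral_Im[OF int]
    by (simp add: complex_eq_iff)
qed

text \<open>Peeling off one variable at a time: for fixed frequencies of the other variables, the
  exponential in them is part of the weight to which the one-dimensional case applies.\<close>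

lemma fourier_weight_finite:
  fixes R :: "'a \<Rightarrow> complex"
  assumes "finite J" and "integrable M R" and "\<And>j. Y j \<in> borel_measurable M"
    and "\<And>c. (CLINT \<omega>|M. R \<omega> * iexp (\<Sum>j\<in>J. c j * Y j \<omega>)) = 0"
    and "\<And>j. A j \<in> sets borel"
  shows "(CLINT \<omega>|M. R \<omega> * (\<Prod>j\<in>J. indicator (A j) (Y j \<omega>))) = 0"
  using assms(1,2,4)
proof (induction J arbitrary: R rule: finite_induct)
  case empty then show ?case by simp
next
  case (insert k J)
  have [measurable]: "Y j \<in> borel_measurable M" "A j \<in> sets borel" for j by (rule assms)+
  have [measurable]: "R \<in> borel_measurable M" using insert by simp
  have int: "integrable M (\<lambda>\<omega>. R \<omega> * indicator (A k) (Y k \<omega>))"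
    using insert(4) by (rule Bochner_Integration.integrable_bound) (auto simp: indicator_def)
  have "(CLINT \<omega>|M. (R \<omega> * indicator (A k) (Y k \<omega>)) * iexp (\<Sum>j\<in>J. c j * Y j \<omega>)) = 0" for c
  proof -
    have "(CLINT \<omega>|M. (R \<omega> * iexp (\<Sum>j\<in>J. c j * Y j \<omega>)) * indicator (A k) (Y k \<omega>)) = 0"
    proof (rule fourier_weight_complex)
      show "integrable M (\<lambda>\<omega>. R \<omega> * iexp (\<Sum>j\<in>J. c j * Y j \<omega>))"
        by (rule integrable_mult_iexp[OF insert(4)]) measurable
      fix t
      have "(\<Sum>j\<in>insert k J. (c(k := t)) j * Y j \<omega>) = (\<Sum>j\<in>J. c j * Y j \<omega>) + t * Y k \<omega>" for \<omega>
      proof -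
        have "(\<Sum>j\<in>J. (c(k := t)) j * Y j \<omega>) = (\<Sum>j\<in>J. c j * Y j \<omega>)"
          using insert.hyps by (intro sum.cong) auto
        then show ?thesis using insert.hyps by (simp add: add.commute)
      qed
      then show "(CLINT \<omega>|M. R \<omega> * iexp (\<Sum>j\<in>J. c j * Y j \<omega>) * iexp (t * Y k \<omega>)) = 0"
        using insert(5)[of "c(k := t)"] by (simp only: iexp_add mult.assoc)
    qed measurable
    then show ?thesis by (simp only: mult_ac)
  qed
  from insert.IH[OF int this] show ?case
    using insert.hyps by (simp add: mult.assoc)
qed

end

section \<open>Isonormal Gaussian processes\<close>

text \<open>Completing the square: the product is a multiple of a normal density with shifted mean.\<close>

lemma integrable_normal_density_exp:
  assumes "\<sigma> > 0"
  shows "integrable lborel (\<lambda>x. normal_density 0 \<sigma> x * exp (c * x))"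
proof -
  have "integrable lborel (\<lambda>x. exp (c\<^sup>2 * \<sigma>\<^sup>2 / 2) * normal_density (c * \<sigma>\<^sup>2) \<sigma> x)"
    using assms by simp
  also have "(\<lambda>x. exp (c\<^sup>2 * \<sigma>\<^sup>2 / 2) * normal_density (c * \<sigma>\<^sup>2) \<sigma> x)
      = (\<lambda>x. normal_density 0 \<sigma> x * exp (c * x))"
  proof
    fix x
    have "c\<^sup>2 * \<sigma>\<^sup>2 / 2 + - (x - c * \<sigma>\<^sup>2)\<^sup>2 / (2 * \<sigma>\<^sup>2) = - (x - 0)\<^sup>2 / (2 * \<sigma>\<^sup>2) + c * x"
      using assms by (simp add: power2_eq_square field_simps)
    then have "exp (c\<^sup>2 * \<sigma>\<^sup>2 / 2) * exp (- (x - c * \<sigma>\<^sup>2)\<^sup>2 / (2 * \<sigma>\<^sup>2)) = exp (- (x - 0)\<^sup>2 / (2 * \<sigma>\<^sup>2)) * exp (c * x)"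
      by (simp only: exp_add[symmetric])
    then show "exp (c\<^sup>2 * \<sigma>\<^sup>2 / 2) * normal_density (c * \<sigma>\<^sup>2) \<sigma> x = normal_density 0 \<sigma> x * exp (c * x)"
      by (simp add: normal_density_def)
  qed
  finally show ?thesis .
qed

lemma (in prob_space) integrable_exp_centered_gaussian:
  assumes "centered_gaussian M Y"
  shows "integrable M (\<lambda>\<omega>. exp (c * Y \<omega>))"
proof -
  have [measurable]: "Y \<in> borel_measurable M" using assms by (simp add: centered_gaussian_def)
  consider "AE \<omega> in M. Y \<omega> = 0" | \<sigma> where "\<sigma> > 0" "distributed M lborel Y (normal_density 0 \<sigma>)"
    using assms by (auto simp: centered_gaussian_def)
  then show ?thesis
  proof cases
    case 1
    have "integrable M (\<lambda>\<omega>. exp (c * Y \<omega>)) = integrable M (\<lambda>\<omega>. 1 :: real)"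
      by (rule integrable_cong_AE) (use 1 in \<open>auto elim: eventually_mono\<close>)
    then show ?thesis by simp
  next
    case 2
    show ?thesis
      using distributed_integrable[OF 2(2), of "\<lambda>x. exp (c * x)"] integrable_normal_density_exp[OF 2(1)] by simp
  qed
qed

locale isonormal_process = prob_space M for M :: "'a measure" +
  fixes X :: "'h::{real_inner, banach, second_countable_topology} \<Rightarrow> 'a \<Rightarrow> real"
  assumes iso: "isonormal M X"
begin

lemma gaussian_sum: "finite I \<Longrightarrow> centered_gaussian M (\<lambda>\<omega>. \<Sum>i\<in>I. c i * X i \<omega>)"
  using iso by (simp add: isonormal_def centered_gaussian_family_def)

lemma gaussian_X: "centered_gaussian M (X h)"
  using gaussian_sum[of "{h}" "\<lambda>_. 1"] by simp

lemma X_measurable [measurable]: "X h \<in> borel_measurable M"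
  using gaussian_X by (simp add: centered_gaussian_def)

lemma covariance: "(LINT \<omega>|M. X h \<omega> * X g \<omega>) = h \<bullet> g"
  using iso by (simp add: isonormal_def)

lemma sets_generated: "sets M = sigma_sets (space M) {X h -` B \<inter> space M | h B. B \<in> sets borel}"
  using iso unfolding isonormal_def by blast

lemma integrable_exp_abs_X: "integrable M (\<lambda>\<omega>. exp (c * \<bar>X h \<omega>\<bar>))"
proof (rule Bochner_Integration.integrable_bound)
  show "integrable M (\<lambda>\<omega>. exp (c * X h \<omega>) + exp ((- c) * X h \<omega>))"
    by (intro Bochner_Integration.integrable_add integrable_exp_centered_gaussian gaussian_X)
  have "exp (c * \<bar>x\<bar>) \<le> exp (c * x) + exp (- c * x)" for x :: real
    by (cases "x \<ge> 0") auto
  then show "AE \<omega> in M. norm (exp (c * \<bar>X h \<omega>\<bar>)) \<le> norm (exp (c * X h \<omega>) + exp ((- c) * X h \<omega>))"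
    by (simp add: add_nonneg_nonneg)
qed measurable

text \<open>The integrability of functionals of finitely many \<open>X h\<close> reduces to this, because
  polynomials and smooth functions of polynomial growth are dominated by such exponentials.\<close>

lemma integrable_exp_sum_abs_X: "integrable M (\<lambda>\<omega>. exp (c * (\<Sum>i<n. \<bar>X (\<phi> i) \<omega>\<bar>)))"
  for n :: nat
proof (induction n arbitrary: c)
  case 0 show ?case by simp
next
  case (Suc n)
  show ?case
  proof (rule Bochner_Integration.integrable_bound)
    show "integrable M (\<lambda>\<omega>. exp (2 * c * (\<Sum>i<n. \<bar>X (\<phi> i) \<omega>\<bar>)) + exp (2 * c * \<bar>X (\<phi> n) \<omega>\<bar>))"
      by (intro Bochner_Integration.integrable_add Suc.IH integrable_exp_abs_X)
    have "exp (c * (a + b)) \<le> exp (2 * c * a) + exp (2 * c * b)" for a b :: real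
    proof -
      have "2 * (exp (c * a) * exp (c * b)) \<le> (exp (c * a))\<^sup>2 + (exp (c * b))\<^sup>2"
        using sum_squares_bound[of "exp (c*a)" "exp (c*b)"] by (simp add: mult.assoc)
      also have "\<dots> = exp (2 * c * a) + exp (2 * c * b)" by (simp add: power2_eq_square algebra_simps flip: exp_add)
      finally have "2 * exp (c * (a + b)) \<le> exp (2 * c * a) + exp (2 * c * b)"
        by (simp add: distrib_left exp_add)
      moreover have "0 < exp (c * (a + b))" by simp
      ultimately show ?thesis by linarith
    qed
    then show "AE \<omega> in M. norm (exp (c * (\<Sum>i<Suc n. \<bar>X (\<phi> i) \<omega>\<bar>)))
        \<le> norm (exp (2 * c * (\<Sum>i<n. \<bar>X (\<phi> i) \<omega>\<bar>)) + exp (2 * c * \<bar>X (\<phi> n) \<omega>\<bar>))"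
      by (simp add: add_nonneg_nonneg)
  qed measurable
qed

lemma X_L2: "X h \<in> Lp_fun M 2"
proof -
  have "integrable M (\<lambda>\<omega>. (norm (X h \<omega>))\<^sup>2)"
  proof (rule Bochner_Integration.integrable_bound[OF integrable_exp_abs_X[of 2 h]])
    have "(norm x)\<^sup>2 \<le> exp (2 * \<bar>x\<bar>)" for x :: real
    proof -
      have "\<bar>x\<bar> \<le> exp \<bar>x\<bar>" using exp_ge_add_one_self[of "\<bar>x\<bar>"] by linarith
      then have "\<bar>x\<bar>\<^sup>2 \<le> (exp \<bar>x\<bar>)\<^sup>2" by (intro power_mono) auto
      then show ?thesis by (simp add: power2_eq_square flip: exp_add)
    qed
    then show "AE \<omega> in M. norm ((norm (X h \<omega>))\<^sup>2) \<le> norm (exp (2 * \<bar>X h \<omega>\<bar>))" by simp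
  qed measurable
  then show ?thesis by (simp add: L2_iff)
qed

text \<open>The covariance determines the variance of the difference of the two sides, which is zero.\<close>

lemma X_linear: "AE \<omega> in M. X (a *\<^sub>R h + b *\<^sub>R g) \<omega> = a * X h \<omega> + b * X g \<omega>"
proof -
  let ?k = "a *\<^sub>R h + b *\<^sub>R g"
  have L: "(\<lambda>\<omega>. X ?k \<omega> - (a * X h \<omega> + b * X g \<omega>)) \<in> Lp_fun M 2"
    by (intro L2_diff L2_add L2_mult_const X_L2)
  have i: "integrable M (\<lambda>\<omega>. X u \<omega> * X v \<omega>)" for u v by (rule L2_mult_integrable[OF X_L2 X_L2])
  have "(norm (X ?k \<omega> - (a * X h \<omega> + b * X g \<omega>)))\<^sup>2 = X ?k \<omega> * X ?k \<omega> - 2 * a * (X ?k \<omega> * X h \<omega>)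
     - 2 * b * (X ?k \<omega> * X g \<omega>) + a\<^sup>2 * (X h \<omega> * X h \<omega>) + 2 * a * b * (X h \<omega> * X g \<omega>) + b\<^sup>2 * (X g \<omega> * X g \<omega>)" for \<omega>
    by (simp add: power2_eq_square algebra_simps)
  then have "(l2norm M (\<lambda>\<omega>. X ?k \<omega> - (a * X h \<omega> + b * X g \<omega>)))\<^sup>2
     = ?k \<bullet> ?k - 2 * a * (?k \<bullet> h) - 2 * b * (?k \<bullet> g) + a\<^sup>2 * (h \<bullet> h) + 2 * a * b * (h \<bullet> g) + b\<^sup>2 * (g \<bullet> g)"
    unfolding l2norm_sq by (simp add: i covariance)
  also have "\<dots> = 0" by (simp add: inner_add inner_commute power2_eq_square algebra_simps)
  finally show ?thesis using l2norm_eq_0_AE[OF L] by (simp add: eventually_mono)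
qed

lemma X_linear_sum:
  assumes "finite J"
  shows "AE \<omega> in M. X (\<Sum>j\<in>J. c j *\<^sub>R \<phi> j) \<omega> = (\<Sum>j\<in>J. c j * X (\<phi> j) \<omega>)"
  using assms
proof (induction J rule: finite_induct)
  case empty then show ?case using X_linear[of 0 0 0 0] by simp
next
  case (insert k J)
  have "AE \<omega> in M. X (c k *\<^sub>R \<phi> k + 1 *\<^sub>R (\<Sum>j\<in>J. c j *\<^sub>R \<phi> j)) \<omega>
      = c k * X (\<phi> k) \<omega> + 1 * X (\<Sum>j\<in>J. c j *\<^sub>R \<phi> j) \<omega>" by (rule X_linear)
  with insert.IH show ?case by eventually_elim (use insert.hyps in simp)
qed

lemma X_distributed:
  assumes "h \<noteq> 0"
  shows "distributed M lborel (X h) (normal_density 0 (norm h))"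
proof -
  have sq: "(LINT \<omega>|M. (X h \<omega>)\<^sup>2) = (norm h)\<^sup>2"
    using covariance[of h h] by (simp add: power2_eq_square power2_norm_eq_inner[unfolded power2_eq_square])
  have "\<not> (AE \<omega> in M. X h \<omega> = 0)"
  proof
    assume "AE \<omega> in M. X h \<omega> = 0"
    then have "(LINT \<omega>|M. (X h \<omega>)\<^sup>2) = 0" by (intro integral_eq_zero_AE) (auto elim: eventually_mono)
    with sq assms show False by simp
  qed
  then obtain \<sigma> where \<sigma>: "\<sigma> > 0" "distributed M lborel (X h) (normal_density 0 \<sigma>)"
    using gaussian_X[of h] by (auto simp: centered_gaussian_def)
  have "(LINT x|lborel. normal_density 0 \<sigma> x * x\<^sup>2) = \<sigma>\<^sup>2"
    using integral_normal_moment_even[OF \<sigma>(1), of 0 1] \<sigma>(1) by (simp add: fact_numeral)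
  then have "(norm h)\<^sup>2 = \<sigma>\<^sup>2"
    using distributed_integral[OF \<sigma>(2), of "\<lambda>x. x\<^sup>2"] sq by simp
  then have "norm h = \<sigma>" using \<sigma>(1) by simp
  then show ?thesis using \<sigma>(2) by simp
qed

lemma char_X: "(CLINT \<omega>|M. iexp (X h \<omega>)) = exp (- (norm h)\<^sup>2 / 2)"
proof (cases "h = 0")
  case True
  have "AE \<omega> in M. X h \<omega> = 0" using X_linear[of 0 0 0 0] True by simp
  then have "(CLINT \<omega>|M. iexp (X h \<omega>)) = (CLINT \<omega>|M. 1)"
    by (intro integral_cong_AE) (auto elim: eventually_mono)
  then show ?thesis using True by (simp add: prob_space)
next
  case False
  have n: "norm h > 0" using False by simp
  have "distributed M lborel (\<lambda>\<omega>. (X h \<omega> - 0) / norm h) std_normal_density"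
    using X_distributed[OF False] by (subst (asm) normal_standard_normal_convert) (use n in auto)
  then have "distr M lborel (\<lambda>\<omega>. X h \<omega> / norm h) = std_normal_distribution"
    by (simp add: distributed_def)
  then have "(CLINT \<omega>|distr M lborel (\<lambda>\<omega>. X h \<omega> / norm h). iexp (norm h * \<omega>)) = exp (- (norm h)\<^sup>2 / 2)"
    using fun_cong[OF char_std_normal_distribution, of "norm h"] by (simp add: char_def)
  then show ?thesis using n by (subst (asm) integral_distr) simp_all
qed

text \<open>Linear combinations of the \<open>X h\<close> are again values of \<open>X\<close>, so the exponentials
  \<open>iexp (X k)\<close> decide the integrals over all sets \<open>\<Inter>\<^sub>h {X h \<in> A\<^sub>h}\<close>; these generate the
  \<open>\<sigma>\<close>-algebra.\<close>

lemma orthogonal_exponentials_zero: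
  fixes R :: "'a \<Rightarrow> real"
  assumes R: "integrable M R" and orth: "\<And>k. (CLINT \<omega>|M. of_real (R \<omega>) * iexp (X k \<omega>)) = 0"
  shows "AE \<omega> in M. R \<omega> = 0"
proof -
  have [measurable]: "R \<in> borel_measurable M" using R by simp
  define G where "G = {(\<Inter>h\<in>J. X h -` A h) \<inter> space M | J A. finite J \<and> (\<forall>h. A h \<in> sets borel)}"
  have rect: "(LINT \<omega>|M. R \<omega> * (\<Prod>h\<in>J. indicator (A h) (X h \<omega>))) = 0"
    if J: "finite J" and A: "\<And>h. A h \<in> sets borel" for J A
  proof -
    have "(CLINT \<omega>|M. of_real (R \<omega>) * (\<Prod>h\<in>J. indicator (A h) (X h \<omega>))) = 0"
    proof (rule fourier_weight_finite[OF J _ _ _ A])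
      fix c
      have "(CLINT \<omega>|M. of_real (R \<omega>) * iexp (\<Sum>h\<in>J. c h * X h \<omega>))
          = (CLINT \<omega>|M. of_real (R \<omega>) * iexp (X (\<Sum>h\<in>J. c h *\<^sub>R h) \<omega>))"
        by (rule integral_cong_AE) (use X_linear_sum[OF J, of c "\<lambda>h. h"] in \<open>auto elim: eventually_mono\<close>)
      then show "(CLINT \<omega>|M. of_real (R \<omega>) * iexp (\<Sum>h\<in>J. c h * X h \<omega>)) = 0" using orth by simp
    qed (use R in auto)
    also have "(\<lambda>\<omega>. of_real (R \<omega>) * (\<Prod>h\<in>J. indicator (A h) (X h \<omega>)))
      = (\<lambda>\<omega>. complex_of_real (R \<omega> * (\<Prod>h\<in>J. indicator (A h) (X h \<omega>))))"
      by (simp add: fun_eq_iff of_real_prod indicator_def of_bool_def if_distrib cong: if_cong)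
    finally show ?thesis by (simp only: integral_complex_of_real of_real_eq_0_iff)
  qed
  have Gm: "G \<subseteq> sets M"
  proof
    fix B assume "B \<in> G"
    then obtain J A where J: "finite J" and [measurable]: "\<And>h. A h \<in> sets borel"
      and B: "B = (\<Inter>h\<in>J. X h -` A h) \<inter> space M" by (auto simp: G_def)
    have "B = {\<omega> \<in> space M. \<forall>h\<in>J. X h \<omega> \<in> A h}" using B by auto
    also have "\<dots> \<in> sets M" using J by measurable
    finally show "B \<in> sets M" .
  qed
  have "Int_stable G"
  proof (rule Int_stableI)
    fix a b assume "a \<in> G" "b \<in> G"
    then obtain J A J' A' where *: "finite J" "\<forall>h. A h \<in> sets borel" "a = (\<Inter>h\<in>J. X h -` A h) \<inter> space M"
       "finite J'" "\<forall>h. A' h \<in> sets borel" "b = (\<Inter>h\<in>J'. X h -` A' h) \<inter> space M" by (auto simp: G_def)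
    define C where "C = (\<lambda>h. (if h \<in> J then A h else UNIV) \<inter> (if h \<in> J' then A' h else UNIV))"
    have C: "y \<in> C h \<longleftrightarrow> (h \<in> J \<longrightarrow> y \<in> A h) \<and> (h \<in> J' \<longrightarrow> y \<in> A' h)" for y h by (simp add: C_def)
    have "a \<inter> b = (\<Inter>h\<in>J \<union> J'. X h -` C h) \<inter> space M"
      unfolding set_eq_iff *(3,6) by (simp only: Int_iff INT_iff vimage_eq C Un_iff) blast
    moreover have "\<forall>h. C h \<in> sets borel" using * by (auto simp: C_def)
    moreover have "finite (J \<union> J')" using * by simp
    ultimately show "a \<inter> b \<in> G" unfolding G_def by blast
  qed
  have GP: "G \<subseteq> Pow (space M)" by (auto simp: G_def)
  have "sets M = sigma_sets (space M) G"
  proof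
    have "{X h -` B \<inter> space M | h B. B \<in> sets borel} \<subseteq> G"
    proof safe
      fix h and B :: "real set" assume "B \<in> sets borel"
      then show "X h -` B \<inter> space M \<in> G" unfolding G_def
        by (intro CollectI exI[of _ "{h}"] exI[of _ "\<lambda>_. B"]) auto
    qed
    then show "sets M \<subseteq> sigma_sets (space M) G"
      unfolding sets_generated by (rule sigma_sets_subseteq)
    show "sigma_sets (space M) G \<subseteq> sets M" by (rule sets.sigma_sets_subset[OF Gm])
  qed
  have Rspace: "(LINT \<omega>|M. R \<omega>) = 0" using rect[of "{}" "\<lambda>_. UNIV"] by simp
  have ind: "integrable M (\<lambda>\<omega>. R \<omega> * indicator B \<omega>)" if "B \<in> sets M" for B
    using integrable_mult_indicator[OF that R] by (simp add: mult.commute)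
  have "(LINT \<omega>|M. R \<omega> * indicator B \<omega>) = 0" if "B \<in> sigma_sets (space M) G" for B
    using \<open>Int_stable G\<close> GP that
  proof (induction rule: sigma_sets_induct_disjoint)
    case (basic B)
    then obtain J A where *: "finite J" "\<And>h. A h \<in> sets borel" and B: "B = (\<Inter>h\<in>J. X h -` A h) \<inter> space M"
      by (auto simp: G_def)
    have "(LINT \<omega>|M. R \<omega> * indicator B \<omega>) = (LINT \<omega>|M. R \<omega> * (\<Prod>h\<in>J. indicator (A h) (X h \<omega>)))"
      using *(1) by (intro Bochner_Integration.integral_cong) (auto simp: B indicator_def of_bool_def)
    then show ?case using rect[of J A] * by simp
  next
    case empty show ?case by simp
  next
    case (compl B)
    then have [measurable]: "B \<in> sets M" by (simp add: \<open>sets M = sigma_sets (space M) G\<close>)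
    have "(LINT \<omega>|M. R \<omega> * indicator (space M - B) \<omega>) = (LINT \<omega>|M. R \<omega> - R \<omega> * indicator B \<omega>)"
      by (intro Bochner_Integration.integral_cong) (auto simp: indicator_def)
    then show ?case using compl R ind[of B] Rspace by simp
  next
    case (union F)
    then have [measurable]: "\<And>i. F i \<in> sets M" by (auto simp: \<open>sets M = sigma_sets (space M) G\<close>)
    have "(LINT \<omega>|M. R \<omega> * indicator (\<Union>i. F i) \<omega>) = (LINT \<omega>:(\<Union>i. F i)|M. R \<omega>)"
      by (simp add: set_lebesgue_integral_def mult.commute)
    also have "\<dots> = (\<Sum>i. LINT \<omega>:F i|M. R \<omega>)"
      using union.hyps(1) ind[of "\<Union>i. F i"]
      by (intro lebesgue_integral_countable_add) (auto simp: disjoint_family_on_def set_integrable_def mult.commute)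
    also have "\<dots> = 0" using union(3) by (simp add: set_lebesgue_integral_def mult.commute)
    finally show ?case .
  qed
  then have "set_lebesgue_integral M B R = 0" if "B \<in> sets M" for B
    using that by (simp add: set_lebesgue_integral_def mult.commute \<open>sets M = sigma_sets (space M) G\<close>)
  then show ?thesis by (intro density_zero R)
qed

end

section \<open>Hermite polynomials\<close>

text \<open>Differentiating a polynomial times the Gaussian kernel produces this recursion, so Rodrigues'
  formula, which defines the Hermite functions, reduces to it.\<close>

fun hermite_poly :: "nat \<Rightarrow> real poly" where
  "hermite_poly 0 = 1"
| "hermite_poly (Suc q) = [:0, 1:] * hermite_poly q - pderiv (hermite_poly q)"

lemma hermite_eq_poly: "hermite q x = poly (hermite_poly q) x"
proof -
  have "(deriv ^^ q) (\<lambda>t. exp (- t\<^sup>2 / 2)) = (\<lambda>x. (-1) ^ q * poly (hermite_poly q) x * exp (- x\<^sup>2 / 2))"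
  proof (induction q)
    case (Suc q)
    show ?case unfolding funpow.simps comp_def Suc
    proof (intro ext DERIV_imp_deriv)
      show "((\<lambda>x. (-1) ^ q * poly (hermite_poly q) x * exp (- x\<^sup>2 / 2)) has_real_derivative
          (-1) ^ Suc q * poly (hermite_poly (Suc q)) x * exp (- x\<^sup>2 / 2)) (at x)" for x :: real
        by (auto intro!: derivative_eq_intros simp: algebra_simps)
    qed
  qed simp
  moreover have "exp (x\<^sup>2 / 2) * exp (- x\<^sup>2 / 2) = 1" by (simp flip: exp_add)
  ultimately show ?thesis
    by (simp add: hermite_def mult_ac flip: power_mult_distrib)
qed

lemma pderiv_hermite_poly: "pderiv (hermite_poly (Suc q)) = smult (real (Suc q)) (hermite_poly q)"
proof (induction q)
  case (Suc q)
  have Suc_q: "hermite_poly (Suc q) = [:0, 1:] * hermite_poly q - pderiv (hermite_poly q)" by simp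
  have "pderiv (hermite_poly (Suc (Suc q)))
      = hermite_poly (Suc q) + [:0, 1:] * smult (real (Suc q)) (hermite_poly q) - pderiv (smult (real (Suc q)) (hermite_poly q))"
    unfolding hermite_poly.simps(2)[of "Suc q"] pderiv_diff pderiv_mult Suc
    by (simp add: pderiv_pCons del: hermite_poly.simps)
  also have "\<dots> = hermite_poly (Suc q) + smult (real (Suc q)) (hermite_poly (Suc q))"
    unfolding Suc_q pderiv_smult smult_diff_right mult_smult_right by (simp only: add_diff_eq)
  also have "\<dots> = smult (real (Suc (Suc q))) (hermite_poly (Suc q))"
  proof -
    have "real (Suc (Suc q)) = 1 + real (Suc q)" by simp
    then show ?thesis by (simp only: smult_add_left smult_1_left)
  qed
  finally show ?case .
qed (simp add: pderiv_pCons)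

lemma hermite_0: "hermite 0 x = 1"
  by (simp add: hermite_eq_poly)

lemma hermite_Suc_0: "hermite (Suc 0) x = x"
  by (simp add: hermite_eq_poly)

lemma hermite_density_has_derivative:
  "((\<lambda>x. hermite q x * std_normal_density x) has_real_derivative - hermite (Suc q) x * std_normal_density x) (at x)"
proof -
  have "((\<lambda>x. std_normal_density x) has_real_derivative - x * std_normal_density x) (at x)"
  proof -
    have "((\<lambda>x. exp (- x\<^sup>2 / 2)) has_real_derivative - x * exp (- x\<^sup>2 / 2)) (at x)"
      by (auto intro!: derivative_eq_intros)
    from DERIV_cmult[OF this, of "1 / sqrt (2 * pi)"] show ?thesis
      unfolding std_normal_density_def by (rule DERIV_cong) simp
  qed
  from DERIV_mult[OF poly_DERIV this] show ?thesis
    unfolding hermite_eq_poly by (rule DERIV_cong) (simp add: algebra_simps)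
qed

text \<open>At \<open>q = 0\<close> the truncated index \<open>q - 1\<close> is harmless, its coefficient being zero.\<close>

lemma hermite_three_term:
  "x * hermite q x = hermite (Suc q) x + real q * hermite (q - 1) x"
proof (cases q)
  case (Suc r)
  have "hermite (Suc q) x = x * hermite q x - poly (pderiv (hermite_poly q)) x"
    by (simp add: hermite_eq_poly)
  then show ?thesis unfolding Suc pderiv_hermite_poly by (simp add: hermite_eq_poly)
qed (simp add: hermite_0 hermite_Suc_0)

lemma continuous_hermite [continuous_intros]: "continuous_on A (hermite q)"
  unfolding hermite_eq_poly[abs_def] by (intro continuous_intros)

lemma hermite_measurable [measurable]: "hermite q \<in> borel_measurable borel"
  by (rule borel_measurable_continuous_onI) (rule continuous_hermite)

lemma poly_exp_bound: "\<exists>C\<ge>0. \<forall>x. \<bar>poly p x\<bar> \<le> C * exp (C * \<bar>x\<bar>)" for p :: "real poly"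
proof (induction p)
  case 0 show ?case by (intro exI[of _ 0]) simp
next
  case (pCons a p)
  then obtain C where C: "C \<ge> 0" "\<And>x. \<bar>poly p x\<bar> \<le> C * exp (C * \<bar>x\<bar>)" by blast
  have "\<bar>poly (pCons a p) x\<bar> \<le> (\<bar>a\<bar> + C + 1) * exp ((\<bar>a\<bar> + C + 1) * \<bar>x\<bar>)" for x
  proof -
    have "\<bar>poly (pCons a p) x\<bar> \<le> \<bar>a\<bar> + \<bar>x\<bar> * \<bar>poly p x\<bar>"
      using abs_triangle_ineq[of a "x * poly p x"] by (simp add: abs_mult)
    also have "\<dots> \<le> \<bar>a\<bar> * exp ((\<bar>a\<bar> + C + 1) * \<bar>x\<bar>) + exp \<bar>x\<bar> * (C * exp (C * \<bar>x\<bar>))"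
    proof (intro add_mono mult_mono C)
      show "\<bar>a\<bar> \<le> \<bar>a\<bar> * exp ((\<bar>a\<bar> + C + 1) * \<bar>x\<bar>)"
        using C(1) mult_left_mono[of 1 "exp ((\<bar>a\<bar> + C + 1) * \<bar>x\<bar>)" "\<bar>a\<bar>"] by simp
      show "\<bar>x\<bar> \<le> exp \<bar>x\<bar>" using exp_ge_add_one_self[of "\<bar>x\<bar>"] by linarith
    qed auto
    also have "exp \<bar>x\<bar> * (C * exp (C * \<bar>x\<bar>)) = C * exp ((C + 1) * \<bar>x\<bar>)"
      by (simp add: exp_add distrib_right)
    also have "\<dots> \<le> (C + 1) * exp ((\<bar>a\<bar> + C + 1) * \<bar>x\<bar>)"
      using C(1) by (intro mult_mono) (auto intro!: mult_right_mono)
    finally show ?thesis by (simp add: distrib_right)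
  qed
  then show ?case using C(1) by (intro exI[of _ "\<bar>a\<bar> + C + 1"]) auto
qed

lemma hermite_exp_bound: "\<exists>C\<ge>0. \<forall>x. \<bar>hermite q x\<bar> \<le> C * exp (C * \<bar>x\<bar>)"
  using poly_exp_bound[of "hermite_poly q"] by (simp add: hermite_eq_poly)

section \<open>One-dimensional Gaussian integration by parts\<close>

lemma integrable_std_normal_exp_bound:
  assumes [measurable]: "f \<in> borel_measurable borel" and "\<And>x. \<bar>f x\<bar> \<le> K * exp (K * \<bar>x\<bar>)"
  shows "integrable lborel (\<lambda>x. std_normal_density x * f x)"
proof (rule Bochner_Integration.integrable_bound)
  show "integrable lborel (\<lambda>x. K * (std_normal_density x * exp (K * x) + std_normal_density x * exp ((- K) * x)))"
    by (intro integrable_mult_right Bochner_Integration.integrable_add integrable_normal_density_exp) auto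
  have "norm (std_normal_density x * f x)
      \<le> norm (K * (std_normal_density x * exp (K * x) + std_normal_density x * exp ((- K) * x)))" for x
  proof -
    have K: "0 \<le> K" using assms(2)[of 0] by simp
    have "norm (std_normal_density x * f x) \<le> std_normal_density x * (K * exp (K * \<bar>x\<bar>))"
      using assms(2)[of x] by (simp add: abs_mult mult_left_mono)
    also have "\<dots> \<le> std_normal_density x * (K * (exp (K * x) + exp ((- K) * x)))"
      using K by (intro mult_left_mono) (auto simp: abs_if)
    finally show ?thesis using K
      by (simp add: abs_mult add_nonneg_nonneg algebra_simps)
  qed
  then show "AE x in lborel. norm (std_normal_density x * f x)
      \<le> norm (K * (std_normal_density x * exp (K * x) + std_normal_density x * exp ((- K) * x)))" by simp
qed measurable

text \<open>The Gaussian kernel times \<open>H\<^sub>q\<close> is, up to sign, a primitive of the kernel times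
  \<open>H\<^sub>q\<^sub>+\<^sub>1\<close>; the boundary terms vanish because \<open>\<theta>\<close> grows at most exponentially.\<close>

lemma std_normal_ibp_hermite:
  fixes \<theta> \<theta>' :: "real \<Rightarrow> real"
  assumes deriv: "\<And>s. (\<theta> has_real_derivative \<theta>' s) (at s)" and cont: "continuous_on UNIV \<theta>'"
    and bound: "\<And>s. \<bar>\<theta> s\<bar> \<le> C * exp (C * \<bar>s\<bar>)" "\<And>s. \<bar>\<theta>' s\<bar> \<le> C * exp (C * \<bar>s\<bar>)"
  shows "(LINT s|lborel. std_normal_density s * (\<theta> s * hermite (Suc q) s))
       = (LINT s|lborel. std_normal_density s * (\<theta>' s * hermite q s))"
proof -
  have contT: "continuous_on UNIV \<theta>"
    using deriv by (auto intro!: continuous_at_imp_continuous_on DERIV_isCont)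
  have [measurable]: "\<theta> \<in> borel_measurable borel" "\<theta>' \<in> borel_measurable borel"
    using contT cont by (auto intro: borel_measurable_continuous_onI)
  have C: "0 \<le> C" using bound(1)[of 0] by simp
  obtain D where D: "D \<ge> 0" "\<And>x. \<bar>hermite q x\<bar> \<le> D * exp (D * \<bar>x\<bar>)" using hermite_exp_bound by blast
  obtain E where E: "E \<ge> 0" "\<And>x. \<bar>hermite (Suc q) x\<bar> \<le> E * exp (E * \<bar>x\<bar>)" using hermite_exp_bound by blast
  define K where "K = C * D + C * E + C + D + E"
  have prod_bound: "\<bar>u * v\<bar> \<le> K * exp (K * \<bar>x\<bar>)"
    if "\<bar>u\<bar> \<le> C * exp (C * \<bar>x\<bar>)" "\<bar>v\<bar> \<le> B * exp (B * \<bar>x\<bar>)" "B \<ge> 0" "C * B \<le> K" "C + B \<le> K" for u v x B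
  proof -
    have "\<bar>u * v\<bar> \<le> (C * exp (C * \<bar>x\<bar>)) * (B * exp (B * \<bar>x\<bar>))"
      unfolding abs_mult by (intro mult_mono that) (use C in auto)
    also have "\<dots> = (C * B) * exp ((C + B) * \<bar>x\<bar>)" by (simp add: exp_add distrib_right)
    also have "\<dots> \<le> K * exp (K * \<bar>x\<bar>)"
      using that C by (intro mult_mono) (auto intro: mult_right_mono order_trans[OF mult_nonneg_nonneg[of C B]])
    finally show ?thesis .
  qed
  have KD: "C * D \<le> K" "C + D \<le> K" and KE: "C * E \<le> K" "C + E \<le> K"
    using C D E mult_nonneg_nonneg[OF C D(1)] mult_nonneg_nonneg[OF C E(1)] by (auto simp: K_def)
  have K: "K \<ge> 0" using C D E by (simp add: K_def)
  have i1: "integrable lborel (\<lambda>s. std_normal_density s * (\<theta> s * hermite (Suc q) s))"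
    by (rule integrable_std_normal_exp_bound[of _ K]) (auto intro!: prod_bound bound E KE)
  have i2: "integrable lborel (\<lambda>s. std_normal_density s * (\<theta>' s * hermite q s))"
    by (rule integrable_std_normal_exp_bound[of _ K]) (auto intro!: prod_bound bound D KD)
  define f where "f = (\<lambda>s. \<theta> s * (hermite q s * std_normal_density s))"
  define f' where "f' = (\<lambda>s. std_normal_density s * (\<theta>' s * hermite q s) - std_normal_density s * (\<theta> s * hermite (Suc q) s))"
  have f': "(f has_real_derivative f' s) (at s)" for s
    unfolding f_def f'_def
    by (rule DERIV_cong[OF DERIV_mult[OF deriv hermite_density_has_derivative]]) (simp add: algebra_simps)
  have f_le: "norm (f s) \<le> K * exp (K * \<bar>s\<bar>) * std_normal_density s" for s
    unfolding f_def using prod_bound[OF bound(1)[of s] D(2)[of s] D(1) KD]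
    by (simp add: mult.assoc[symmetric] abs_mult mult_right_mono)
  have top: "(f \<longlongrightarrow> 0) at_top"
  proof (rule Lim_null_comparison)
    show "\<forall>\<^sub>F s in at_top. norm (f s) \<le> K * exp (K * s) * std_normal_density s"
      using eventually_ge_at_top[of 0] by eventually_elim (metis abs_of_nonneg f_le)
    have "((\<lambda>s. exp (K * s - s\<^sup>2 / 2)) \<longlongrightarrow> 0) at_top" by real_asymp
    from tendsto_mult_right_zero[OF this, of "K / sqrt (2 * pi)"]
    have l: "((\<lambda>s. K / sqrt (2 * pi) * exp (K * s - s\<^sup>2 / 2)) \<longlongrightarrow> 0) at_top" .
    have "exp (K * s - s\<^sup>2 / 2) = exp (K * s) * exp (- s\<^sup>2 / 2)" for s by (simp flip: exp_add)
    then have "(\<lambda>s. K * exp (K * s) * std_normal_density s) = (\<lambda>s. K / sqrt (2 * pi) * exp (K * s - s\<^sup>2 / 2))"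
      by (simp add: fun_eq_iff std_normal_density_def)
    with l show "((\<lambda>s. K * exp (K * s) * std_normal_density s) \<longlongrightarrow> 0) at_top" by simp
  qed
  have bot: "(f \<longlongrightarrow> 0) at_bot"
  proof (rule Lim_null_comparison)
    show "\<forall>\<^sub>F s in at_bot. norm (f s) \<le> K * exp (K * (- s)) * std_normal_density s"
      using eventually_le_at_bot[of 0] by eventually_elim (metis abs_of_nonpos f_le)
    have "((\<lambda>s. exp (K * (- s) - s\<^sup>2 / 2)) \<longlongrightarrow> 0) at_bot" by real_asymp
    from tendsto_mult_right_zero[OF this, of "K / sqrt (2 * pi)"]
    have l: "((\<lambda>s. K / sqrt (2 * pi) * exp (K * (- s) - s\<^sup>2 / 2)) \<longlongrightarrow> 0) at_bot" .
    have "exp (K * (- s) - s\<^sup>2 / 2) = exp (K * (- s)) * exp (- s\<^sup>2 / 2)" for s by (simp flip: exp_add)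
    then have "(\<lambda>s. K * exp (K * (- s)) * std_normal_density s) = (\<lambda>s. K / sqrt (2 * pi) * exp (K * (- s) - s\<^sup>2 / 2))"
      by (simp add: fun_eq_iff std_normal_density_def)
    with l show "((\<lambda>s. K * exp (K * (- s)) * std_normal_density s) \<longlongrightarrow> 0) at_bot" by simp
  qed
  have "(LBINT s=-\<infinity>..\<infinity>. f' s) = 0 - 0"
  proof (rule interval_integral_FTC_integrable)
    show "(f has_vector_derivative f' s) (at s)" for s
      using f' by (simp add: has_real_derivative_iff_has_vector_derivative)
    have "continuous_on UNIV f'"
      unfolding f'_def std_normal_density_def by (intro continuous_intros cont contT) auto
    then show "isCont f' s" for s by (simp add: continuous_on_eq_continuous_at)
    show "set_integrable lborel (einterval (-\<infinity>) \<infinity>) f'"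
      using i1 i2 by (simp add: f'_def set_integrable_def einterval_def)
    show "((f \<circ> real_of_ereal) \<longlongrightarrow> 0) (at_right (-\<infinity>))" "((f \<circ> real_of_ereal) \<longlongrightarrow> 0) (at_left \<infinity>)"
      using top bot by (simp_all add: ereal_tendsto_simps)
  qed simp
  then have "(LINT s|lborel. f' s) = 0"
    by (simp add: interval_lebesgue_integral_def set_lebesgue_integral_def einterval_def)
  then show ?thesis unfolding f'_def using i1 i2 by simp
qed

section \<open>Totality of the Hermite variables, and independence\<close>

context isonormal_process
begin

lemma exp_abs_X_L2: "(\<lambda>\<omega>. exp (c * \<bar>X h \<omega>\<bar>)) \<in> Lp_fun M 2"
proof -
  have "(norm (exp (c * \<bar>X h \<omega>\<bar>)))\<^sup>2 = exp (2 * c * \<bar>X h \<omega>\<bar>)" for \<omega>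
    by (simp add: power2_eq_square flip: exp_add)
  then show ?thesis using integrable_exp_abs_X[of "2 * c" h] by (simp add: L2_iff)
qed

lemma poly_X_L2: "(\<lambda>\<omega>. poly p (X h \<omega>)) \<in> Lp_fun M 2"
proof -
  obtain C where C: "C \<ge> 0" "\<And>x. \<bar>poly p x\<bar> \<le> C * exp (C * \<bar>x\<bar>)" using poly_exp_bound by blast
  have [measurable]: "poly p \<in> borel_measurable borel"
    by (intro borel_measurable_continuous_onI continuous_intros)
  show ?thesis
    by (rule L2_bound[OF L2_mult_const[OF exp_abs_X_L2, of C C h]]) (use C in \<open>auto simp: abs_mult\<close>)
qed

lemma hermite_X_L2: "(\<lambda>\<omega>. hermite q (X h \<omega>)) \<in> Lp_fun M 2"
  using poly_X_L2 by (simp add: hermite_eq_poly)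

text \<open>All moments \<open>E[R X(h)\<^sup>n]\<close> vanish by the three-term recurrence, hence so does
  \<open>E[R exp(i t X(h))]\<close>, as the exponential series may be integrated termwise.\<close>

lemma orthogonal_hermite_imp_zero:
  fixes R :: "'a \<Rightarrow> real"
  assumes R: "R \<in> Lp_fun M 2" and mean: "(LINT \<omega>|M. R \<omega>) = 0"
    and orth: "\<And>q h. q \<ge> 1 \<Longrightarrow> norm h = 1 \<Longrightarrow> (LINT \<omega>|M. R \<omega> * hermite q (X h \<omega>)) = 0"
  shows "AE \<omega> in M. R \<omega> = 0"
proof (rule orthogonal_exponentials_zero)
  have [measurable]: "R \<in> borel_measurable M" using R by (simp add: L2_iff)
  show "integrable M R" by (rule L2_integrable[OF R])
  fix k :: 'h
  have unit: "(CLINT \<omega>|M. of_real (R \<omega>) * iexp (t * X h \<omega>)) = 0" if h: "norm h = 1" for h t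
  proof -
    have moment: "(LINT \<omega>|M. R \<omega> * (X h \<omega> ^ n * hermite q (X h \<omega>))) = 0" for n q
    proof (induction n arbitrary: q)
      case 0
      show ?case using orth[of q h] mean h by (cases q) (simp_all add: hermite_0)
    next
      case (Suc n)
      have i: "integrable M (\<lambda>\<omega>. R \<omega> * (X h \<omega> ^ n * hermite r (X h \<omega>)))" for r
        using L2_mult_integrable[OF R poly_X_L2[of "monom 1 n * hermite_poly r" h]]
        by (simp add: poly_monom hermite_eq_poly)
      have eq: "R \<omega> * (X h \<omega> ^ Suc n * hermite q (X h \<omega>))
          = R \<omega> * (X h \<omega> ^ n * hermite (Suc q) (X h \<omega>)) + real q * (R \<omega> * (X h \<omega> ^ n * hermite (q - 1) (X h \<omega>)))" for \<omega>
      proof -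
        have "R \<omega> * (X h \<omega> ^ Suc n * hermite q (X h \<omega>)) = R \<omega> * X h \<omega> ^ n * (X h \<omega> * hermite q (X h \<omega>))"
          by (simp add: mult_ac)
        then show ?thesis unfolding hermite_three_term by (simp only: distrib_left mult_ac)
      qed
      show ?case unfolding eq using Suc.IH i by simp
    qed
    have zero: "(CLINT \<omega>|M. of_real (R \<omega>) * (\<Sum>n<N. (\<i> * of_real (t * X h \<omega>)) ^ n /\<^sub>R fact n)) = 0" for N
    proof -
      have i: "complex_integrable M (\<lambda>\<omega>. of_real (R \<omega> * X h \<omega> ^ n))" for n
        using L2_mult_integrable[OF R poly_X_L2[of "monom 1 n" h]] by (simp add: poly_monom del: of_real_mult)
      have m: "(LINT \<omega>|M. R \<omega> * X h \<omega> ^ n) = 0" for n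
        using moment[of n 0] by (simp add: hermite_0)
      have "of_real (R \<omega>) * (\<Sum>n<N. (\<i> * of_real (t * X h \<omega>)) ^ n /\<^sub>R fact n)
          = (\<Sum>n<N. ((\<i> * t) ^ n / fact n) * complex_of_real (R \<omega> * X h \<omega> ^ n))" for \<omega>
        by (simp add: sum_distrib_left power_mult_distrib scaleR_conv_of_real field_simps)
      then show ?thesis by (simp add: i m del: of_real_mult)
    qed
    have "(\<lambda>N. CLINT \<omega>|M. of_real (R \<omega>) * (\<Sum>n<N. (\<i> * of_real (t * X h \<omega>)) ^ n /\<^sub>R fact n))
        \<longlonglongrightarrow> (CLINT \<omega>|M. of_real (R \<omega>) * iexp (t * X h \<omega>))"
    proof (rule integral_dominated_convergence)
      show "integrable M (\<lambda>\<omega>. norm (R \<omega>) * norm (exp (\<bar>t\<bar> * \<bar>X h \<omega>\<bar>)))"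
        by (rule L2_norm_mult_integrable[OF R exp_abs_X_L2])
      show "AE \<omega> in M. (\<lambda>N. of_real (R \<omega>) * (\<Sum>n<N. (\<i> * of_real (t * X h \<omega>)) ^ n /\<^sub>R fact n))
          \<longlonglongrightarrow> of_real (R \<omega>) * iexp (t * X h \<omega>)"
        by (intro AE_I2 tendsto_intros) (use exp_converges[of "\<i> * of_real (t * X h _)"] in \<open>simp add: sums_def\<close>)
      fix N
      have "norm (\<Sum>n<N. (\<i> * of_real y) ^ n /\<^sub>R fact n) \<le> exp \<bar>y\<bar>" for y
      proof -
        have "norm (\<Sum>n<N. (\<i> * of_real y) ^ n /\<^sub>R fact n) \<le> (\<Sum>n<N. \<bar>y\<bar> ^ n /\<^sub>R fact n)"
          by (rule order_trans[OF norm_sum]) (simp add: norm_mult norm_power)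
        also have "\<dots> \<le> exp \<bar>y\<bar>"
          unfolding exp_def by (rule sum_le_suminf) (simp_all add: summable_exp)
        finally show ?thesis .
      qed
      then show "AE \<omega> in M. norm (of_real (R \<omega>) * (\<Sum>n<N. (\<i> * of_real (t * X h \<omega>)) ^ n /\<^sub>R fact n))
          \<le> norm (R \<omega>) * norm (exp (\<bar>t\<bar> * \<bar>X h \<omega>\<bar>))"
        unfolding norm_mult norm_of_real real_norm_def abs_exp_cancel abs_mult[symmetric]
        by (intro AE_I2 mult_left_mono abs_ge_zero)
    qed measurable
    then show ?thesis unfolding zero by (simp add: LIMSEQ_const_iff)
  qed
  show "(CLINT \<omega>|M. of_real (R \<omega>) * iexp (X k \<omega>)) = 0"
  proof (cases "k = 0")
    case True
    have "AE \<omega> in M. X k \<omega> = 0" using X_linear[of 0 0 0 0] True by simp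
    then have "(CLINT \<omega>|M. of_real (R \<omega>) * iexp (X k \<omega>)) = (CLINT \<omega>|M. of_real (R \<omega>))"
      by (intro integral_cong_AE) (auto elim: eventually_mono)
    then show ?thesis using mean by simp
  next
    case False
    define h where "h = (1 / norm k) *\<^sub>R k"
    have h: "norm h = 1" "k = norm k *\<^sub>R h" using False by (simp_all add: h_def)
    have "AE \<omega> in M. X k \<omega> = norm k * X h \<omega>" using X_linear[of "norm k" h 0 0] h(2) by simp
    then have "(CLINT \<omega>|M. of_real (R \<omega>) * iexp (X k \<omega>)) = (CLINT \<omega>|M. of_real (R \<omega>) * iexp (norm k * X h \<omega>))"
      by (intro integral_cong_AE) (auto elim: eventually_mono)
    then show ?thesis using unit[OF h(1)] by simp
  qed
qed

lemma coord_vec_measurable [measurable]: "coord_vec X n \<phi> \<in> borel_measurable M"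
  by (rule measurable_coordinatewise_then_product) (simp add: coord_vec_def)

text \<open>Independence of uncorrelated members of the process, as a product law. Fourier uniqueness
  is used twice. The characteristic functions factorize, so \<open>iexp (X K)\<close> minus its mean is
  orthogonal to all exponentials of \<open>X h\<close>, hence to the events of \<open>X h\<close>; therefore the indicator
  of such an event minus its probability is orthogonal to all exponentials of the
  remaining variables, hence to their joint events.\<close>

lemma indep_orthogonal:
  assumes orth: "\<And>i. i < n \<Longrightarrow> k i \<bullet> h = 0"
  shows "distr M borel (X h) \<Otimes>\<^sub>M distr M borel (coord_vec X n k)
       = distr M (borel \<Otimes>\<^sub>M borel) (\<lambda>\<omega>. (X h \<omega>, coord_vec X n k \<omega>))"
proof -
  have fact: "(LINT \<omega>|M. indicator A (X h \<omega>) * (\<Prod>i<n. indicator (B i) (X (k i) \<omega>)))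
      = (LINT \<omega>|M. indicator A (X h \<omega>)) * (LINT \<omega>|M. (\<Prod>i<n. indicator (B i) (X (k i) \<omega>)) :: real)"
    if A[measurable]: "A \<in> sets borel" and B[measurable]: "\<And>i. B i \<in> sets borel" for A and B :: "nat \<Rightarrow> real set"
  proof -
    define p where "p = (LINT \<omega>|M. indicator A (X h \<omega>) :: real)"
    define R where "R = (\<lambda>\<omega>. complex_of_real (indicator A (X h \<omega>) - p))"
    have iA: "complex_integrable M (\<lambda>\<omega>. indicator A (X h \<omega>))"
      by (rule integrable_const_bound[of _ 1]) (auto simp: indicator_def)
    have R: "integrable M R" unfolding R_def
      by (intro integrable_of_real Bochner_Integration.integrable_diff integrable_const
          integrable_const_bound[of _ 1]) (auto simp: indicator_def)
    have pc: "(CLINT \<omega>|M. indicator A (X h \<omega>)) = complex_of_real p"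
      unfolding p_def integral_complex_of_real[symmetric]
      by (intro Bochner_Integration.integral_cong) (auto simp: indicator_def)
    have "(CLINT \<omega>|M. R \<omega> * (\<Prod>i\<in>{..<n}. indicator (B i) (X (k i) \<omega>))) = 0"
    proof (rule fourier_weight_finite[OF _ R])
      fix c :: "nat \<Rightarrow> real"
      define K where "K = (\<Sum>i<n. c i *\<^sub>R k i)"
      have Kh: "K \<bullet> h = 0" using orth by (simp add: K_def inner_sum_left)
      define e where "e = (CLINT \<omega>|M. iexp (X K \<omega>))"
      have iK: "complex_integrable M (\<lambda>\<omega>. iexp (X g \<omega>))" for g
        using integrable_mult_iexp[of M "\<lambda>_. 1" "X g"] by simp
      have "(CLINT \<omega>|M. (iexp (X K \<omega>) - e) * indicator A (X h \<omega>)) = 0"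
      proof (rule fourier_weight_complex)
        show "integrable M (\<lambda>\<omega>. iexp (X K \<omega>) - e)" using iK by simp
        fix t
        have th: "(CLINT \<omega>|M. iexp (t * X h \<omega>)) = (CLINT \<omega>|M. iexp (X (t *\<^sub>R h) \<omega>))"
          by (rule integral_cong_AE) (use X_linear[of t h 0 0] in \<open>auto elim: eventually_mono\<close>)
        have Kth: "(CLINT \<omega>|M. iexp (X K \<omega>) * iexp (t * X h \<omega>)) = (CLINT \<omega>|M. iexp (X (1 *\<^sub>R K + t *\<^sub>R h) \<omega>))"
          by (rule integral_cong_AE)
             (use X_linear[of 1 K t h] in \<open>auto elim!: eventually_mono simp: distrib_left exp_add\<close>)
        have nrm: "(norm (1 *\<^sub>R K + t *\<^sub>R h))\<^sup>2 = (norm K)\<^sup>2 + (norm (t *\<^sub>R h))\<^sup>2"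
          using Kh by (simp add: power2_norm_eq_inner inner_add inner_commute del: norm_scaleR)
        have i1: "complex_integrable M (\<lambda>\<omega>. iexp (t * X h \<omega>))"
          using integrable_mult_iexp[of M "\<lambda>_. 1" "\<lambda>\<omega>. t * X h \<omega>"] by simp
        have i2: "complex_integrable M (\<lambda>\<omega>. iexp (X K \<omega>) * iexp (t * X h \<omega>))"
          by (rule integrable_mult_iexp[OF iK]) measurable
        have "(CLINT \<omega>|M. (iexp (X K \<omega>) - e) * iexp (t * X h \<omega>))
           = (CLINT \<omega>|M. iexp (X K \<omega>) * iexp (t * X h \<omega>)) - e * (CLINT \<omega>|M. iexp (t * X h \<omega>))"
          unfolding left_diff_distrib using i1 i2 by (subst Bochner_Integration.integral_diff) auto
        also have "\<dots> = exp (- ((norm K)\<^sup>2 + (norm (t *\<^sub>R h))\<^sup>2) / 2) - exp (- (norm K)\<^sup>2 / 2) * exp (- (norm (t *\<^sub>R h))\<^sup>2 / 2)"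
          unfolding Kth th e_def char_X nrm by simp
        also have "\<dots> = 0"
          by (simp only: minus_add_distrib add_divide_distrib exp_add) simp
        finally show "(CLINT \<omega>|M. (iexp (X K \<omega>) - e) * iexp (t * X h \<omega>)) = 0" .
      qed measurable
      then have f1: "(CLINT \<omega>|M. indicator A (X h \<omega>) * iexp (X K \<omega>)) = e * p"
      proof -
        have i3: "complex_integrable M (\<lambda>\<omega>. indicator A (X h \<omega>) * iexp (X K \<omega>))"
          by (rule integrable_mult_iexp[OF iA]) measurable
        have "(CLINT \<omega>|M. (iexp (X K \<omega>) - e) * indicator A (X h \<omega>))
            = (CLINT \<omega>|M. indicator A (X h \<omega>) * iexp (X K \<omega>)) - e * (CLINT \<omega>|M. indicator A (X h \<omega>))"
          unfolding left_diff_distrib using i3 iA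
          by (subst Bochner_Integration.integral_diff) (auto simp: mult.commute)
        then show ?thesis using \<open>(CLINT \<omega>|M. (iexp (X K \<omega>) - e) * indicator A (X h \<omega>)) = 0\<close> pc by simp
      qed
      have "(CLINT \<omega>|M. R \<omega> * iexp (\<Sum>i\<in>{..<n}. c i * X (k i) \<omega>)) = (CLINT \<omega>|M. R \<omega> * iexp (X K \<omega>))"
        by (rule integral_cong_AE)
          (use X_linear_sum[of "{..<n}" c k] R in \<open>auto elim: eventually_mono simp: K_def\<close>)
      also have "\<dots> = (CLINT \<omega>|M. indicator A (X h \<omega>) * iexp (X K \<omega>) - p * iexp (X K \<omega>))"
        unfolding R_def by (intro Bochner_Integration.integral_cong) (auto simp: indicator_def algebra_simps)
      also have "\<dots> = e * p - p * e"
        unfolding e_def f1[unfolded e_def, symmetric] using iK integrable_mult_iexp[OF iA, of "X K"] by simp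
      finally show "(CLINT \<omega>|M. R \<omega> * iexp (\<Sum>i\<in>{..<n}. c i * X (k i) \<omega>)) = 0" by simp
    qed auto
    also have "(\<lambda>\<omega>. R \<omega> * (\<Prod>i\<in>{..<n}. indicator (B i) (X (k i) \<omega>)))
       = (\<lambda>\<omega>. complex_of_real ((indicator A (X h \<omega>) - p) * (\<Prod>i<n. indicator (B i) (X (k i) \<omega>))))"
    proof
      fix \<omega>
      have "complex_of_real (\<Prod>i<n. indicator (B i) (X (k i) \<omega>)) = (\<Prod>i<n. indicator (B i) (X (k i) \<omega>))"
        unfolding of_real_prod by (intro prod.cong) (auto simp: indicator_def)
      then show "R \<omega> * (\<Prod>i\<in>{..<n}. indicator (B i) (X (k i) \<omega>))
       = complex_of_real ((indicator A (X h \<omega>) - p) * (\<Prod>i<n. indicator (B i) (X (k i) \<omega>)))"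
        unfolding R_def of_real_mult by simp
    qed
    finally have z: "(LINT \<omega>|M. (indicator A (X h \<omega>) - p) * (\<Prod>i<n. indicator (B i) (X (k i) \<omega>))) = 0"
      by (simp only: integral_complex_of_real of_real_eq_0_iff)
    have prod01: "(\<Prod>i<n. indicator (B i) (X (k i) \<omega>) :: real) \<in> {0..1}" for \<omega>
      by (auto intro!: prod_nonneg prod_le_1)
    have i4: "integrable M (\<lambda>\<omega>. (\<Prod>i<n. indicator (B i) (X (k i) \<omega>)) :: real)"
      by (rule integrable_const_bound[of _ 1]) (use prod01 in auto)
    have i5: "integrable M (\<lambda>\<omega>. indicator A (X h \<omega>) * (\<Prod>i<n. indicator (B i) (X (k i) \<omega>)) :: real)"
      by (rule integrable_const_bound[of _ 1]) (use prod01 in \<open>auto simp: indicator_def\<close>)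
    show ?thesis using z i4 i5 by (simp add: left_diff_distrib p_def)
  qed
  define G1 where "G1 = {X h -` A \<inter> space M | A. A \<in> sets borel}"
  define G2 where "G2 = {(\<Inter>i<n. X (k i) -` B i) \<inter> space M | B. \<forall>i. B i \<in> sets borel}"
  have G1m: "G1 \<subseteq> events" by (auto simp: G1_def)
  have G2m: "G2 \<subseteq> events"
  proof
    fix S assume "S \<in> G2"
    then obtain B where [measurable]: "\<And>i. B i \<in> sets borel" and S: "S = (\<Inter>i<n. X (k i) -` B i) \<inter> space M"
      by (auto simp: G2_def)
    have "S = {\<omega> \<in> space M. \<forall>i<n. X (k i) \<omega> \<in> B i}" using S by auto
    also have "\<dots> \<in> sets M" by measurable
    finally show "S \<in> events" .
  qed
  have ind: "indep_set G1 G2"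
  proof (rule indep_setI[OF G1m G2m])
    fix a b assume "a \<in> G1" "b \<in> G2"
    then obtain A B where [measurable]: "A \<in> sets borel" "\<And>i. B i \<in> sets borel"
      and a: "a = X h -` A \<inter> space M" and b: "b = (\<Inter>i<n. X (k i) -` B i) \<inter> space M"
      by (auto simp: G1_def G2_def)
    have [measurable]: "a \<in> events" "b \<in> events" using \<open>a \<in> G1\<close> \<open>b \<in> G2\<close> G1m G2m by auto
    have eqs: "indicator A (X h \<omega>) = (indicator a \<omega> :: real)"
      "(\<Prod>i<n. indicator (B i) (X (k i) \<omega>)) = (indicator b \<omega> :: real)" if "\<omega> \<in> space M" for \<omega>
      using that unfolding a b by (auto simp: indicator_def)
    have "prob (a \<inter> b) = (LINT \<omega>|M. indicator A (X h \<omega>) * (\<Prod>i<n. indicator (B i) (X (k i) \<omega>)))"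
      by (subst Bochner_Integration.integral_cong[of M M _ "\<lambda>\<omega>. indicator (a \<inter> b) \<omega>"])
         (auto simp: eqs indicator_inter_arith Int_absorb1 sets.sets_into_space)
    also have "\<dots> = (LINT \<omega>|M. indicator A (X h \<omega>)) * (LINT \<omega>|M. (\<Prod>i<n. indicator (B i) (X (k i) \<omega>)) :: real)"
      by (rule fact) measurable
    also have "(LINT \<omega>|M. indicator A (X h \<omega>)) = prob a"
      by (subst Bochner_Integration.integral_cong[of M M _ "\<lambda>\<omega>. indicator a \<omega>"]) (auto simp: eqs Int_absorb1 sets.sets_into_space)
    also have "(LINT \<omega>|M. (\<Prod>i<n. indicator (B i) (X (k i) \<omega>)) :: real) = prob b"
      by (subst Bochner_Integration.integral_cong[of M M _ "\<lambda>\<omega>. indicator b \<omega>"]) (auto simp: eqs Int_absorb1 sets.sets_into_space)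
    finally show "prob (a \<inter> b) = prob a * prob b" .
  qed
  have "Int_stable G1"
  proof (rule Int_stableI)
    fix a b assume "a \<in> G1" "b \<in> G1"
    then obtain A B where "A \<in> sets borel" "B \<in> sets borel" "a = X h -` A \<inter> space M" "b = X h -` B \<inter> space M"
      by (auto simp: G1_def)
    then show "a \<inter> b \<in> G1" unfolding G1_def by (intro CollectI exI[of _ "A \<inter> B"]) auto
  qed
  moreover have "Int_stable G2"
  proof (rule Int_stableI)
    fix a b assume "a \<in> G2" "b \<in> G2"
    then obtain A B where "\<forall>i. A i \<in> sets borel" "\<forall>i. B i \<in> sets borel"
      "a = (\<Inter>i<n. X (k i) -` A i) \<inter> space M" "b = (\<Inter>i<n. X (k i) -` B i) \<inter> space M"
      by (auto simp: G2_def)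
    then show "a \<inter> b \<in> G2" unfolding G2_def by (intro CollectI exI[of _ "\<lambda>i. A i \<inter> B i"]) auto
  qed
  ultimately have ind2: "indep_set (sigma_sets (space M) G1) (sigma_sets (space M) G2)"
    by (intro indep_set_sigma_sets ind)
  have G2P: "G2 \<subseteq> Pow (space M)" by (auto simp: G2_def)
  have coord2: "coord_vec X n k \<in> borel_measurable (sigma (space M) G2)"
  proof (rule measurable_coordinatewise_then_product)
    fix i
    show "(\<lambda>\<omega>. coord_vec X n k \<omega> i) \<in> borel_measurable (sigma (space M) G2)"
    proof (cases "i < n")
      case True
      have "X (k i) \<in> borel_measurable (sigma (space M) G2)"
      proof (rule measurableI)
        fix B :: "real set" assume B: "B \<in> sets borel"
        have "X (k i) -` B \<inter> space M = (\<Inter>j<n. X (k j) -` (if j = i then B else UNIV)) \<inter> space M"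
          using True by (auto split: if_splits)
        also have "\<dots> \<in> G2" unfolding G2_def using B by (intro CollectI exI[of _ "\<lambda>j. if j = i then B else UNIV"]) auto
        finally show "X (k i) -` B \<inter> space (sigma (space M) G2) \<in> sets (sigma (space M) G2)"
          using G2P by (auto simp: sets_measure_of)
      qed simp
      then show ?thesis using True by (simp add: coord_vec_def)
    qed (simp add: coord_vec_def)
  qed
  interpret D1: prob_space "distr M borel (X h)" by (rule prob_space_distr) measurable
  interpret D2: prob_space "distr M borel (coord_vec X n k)" by (rule prob_space_distr) measurable
  show ?thesis
  proof (rule pair_measure_eqI[OF D1.sigma_finite_measure_axioms D2.sigma_finite_measure_axioms])
    show "sets (distr M borel (X h) \<Otimes>\<^sub>M distr M borel (coord_vec X n k))
        = sets (distr M (borel \<Otimes>\<^sub>M borel) (\<lambda>\<omega>. (X h \<omega>, coord_vec X n k \<omega>)))"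
      unfolding sets_distr by (intro sets_pair_measure_cong) simp_all
  next
    fix A B assume "A \<in> sets (distr M borel (X h))" "B \<in> sets (distr M borel (coord_vec X n k))"
    then have [measurable]: "A \<in> sets borel" "B \<in> sets borel" by auto
    have "X h -` A \<inter> space M \<in> sigma_sets (space M) G1"
      unfolding G1_def using \<open>A \<in> sets borel\<close> by (intro sigma_sets.Basic) blast
    moreover have "coord_vec X n k -` B \<inter> space M \<in> sigma_sets (space M) G2"
      using measurable_sets[OF coord2, of B] G2P by (auto simp: space_measure_of sets_measure_of)
    ultimately have "prob ((X h -` A \<inter> space M) \<inter> (coord_vec X n k -` B \<inter> space M))
        = prob (X h -` A \<inter> space M) * prob (coord_vec X n k -` B \<inter> space M)"
      by (rule indep_setD[OF ind2])
    moreover have "(X h -` A \<inter> space M) \<inter> (coord_vec X n k -` B \<inter> space M)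
        = (\<lambda>\<omega>. (X h \<omega>, coord_vec X n k \<omega>)) -` (A \<times> B) \<inter> space M" by auto
    ultimately show "emeasure (distr M borel (X h)) A * emeasure (distr M borel (coord_vec X n k)) B
        = emeasure (distr M (borel \<Otimes>\<^sub>M borel) (\<lambda>\<omega>. (X h \<omega>, coord_vec X n k \<omega>))) (A \<times> B)"
      by (simp add: emeasure_distr emeasure_eq_measure ennreal_mult)
  qed
qed

end

section \<open>Cylindrical functionals\<close>

text \<open>One constant serves as factor and as rate, which keeps the class stable under sums and
  products. Functionals of exponential growth have moments of all orders.\<close>

definition exp_growth :: "nat \<Rightarrow> ((nat \<Rightarrow> real) \<Rightarrow> real) \<Rightarrow> bool"
  where "exp_growth n \<psi> \<longleftrightarrow> (\<exists>C\<ge>0. \<forall>x. \<bar>\<psi> x\<bar> \<le> C * exp (C * (\<Sum>i<n. \<bar>x i\<bar>)))"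

lemma exp_growthI:
  assumes "\<And>x. \<bar>\<psi> x\<bar> \<le> A * exp (B * (\<Sum>i<n. \<bar>x i\<bar>))" "A \<ge> 0" "B \<ge> 0"
  shows "exp_growth n \<psi>"
  unfolding exp_growth_def
proof (intro exI conjI allI)
  show "0 \<le> A + B" using assms by simp
  fix x
  have "A * exp (B * (\<Sum>i<n. \<bar>x i\<bar>)) \<le> (A + B) * exp ((A + B) * (\<Sum>i<n. \<bar>x i\<bar>))"
    using assms(2,3) by (intro mult_mono) (auto intro!: mult_right_mono sum_nonneg)
  then show "\<bar>\<psi> x\<bar> \<le> (A + B) * exp ((A + B) * (\<Sum>i<n. \<bar>x i\<bar>))" using assms(1)[of x] by linarith
qed

lemma exp_growth_mult:
  assumes "exp_growth n f" "exp_growth n g"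
  shows "exp_growth n (\<lambda>x. f x * g x)"
proof -
  obtain A B where A: "A \<ge> 0" "\<And>x. \<bar>f x\<bar> \<le> A * exp (A * (\<Sum>i<n. \<bar>x i\<bar>))"
    and B: "B \<ge> 0" "\<And>x. \<bar>g x\<bar> \<le> B * exp (B * (\<Sum>i<n. \<bar>x i\<bar>))"
    using assms unfolding exp_growth_def by blast
  have "\<bar>f x * g x\<bar> \<le> (A * B) * exp ((A + B) * (\<Sum>i<n. \<bar>x i\<bar>))" for x
  proof -
    have "\<bar>f x * g x\<bar> \<le> (A * exp (A * (\<Sum>i<n. \<bar>x i\<bar>))) * (B * exp (B * (\<Sum>i<n. \<bar>x i\<bar>)))"
      unfolding abs_mult by (intro mult_mono A B) (use A(1) in auto)
    then show ?thesis by (simp add: exp_add distrib_right mult_ac)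
  qed
  then show ?thesis using A(1) B(1) by (intro exp_growthI[where A = "A * B" and B = "A + B"]) auto
qed

lemma exp_growth_add:
  assumes "exp_growth n f" "exp_growth n g"
  shows "exp_growth n (\<lambda>x. f x + g x)"
proof -
  obtain A B where A: "A \<ge> 0" "\<And>x. \<bar>f x\<bar> \<le> A * exp (A * (\<Sum>i<n. \<bar>x i\<bar>))"
    and B: "B \<ge> 0" "\<And>x. \<bar>g x\<bar> \<le> B * exp (B * (\<Sum>i<n. \<bar>x i\<bar>))"
    using assms unfolding exp_growth_def by blast
  have "\<bar>f x + g x\<bar> \<le> (A + B) * exp ((A + B) * (\<Sum>i<n. \<bar>x i\<bar>))" for x
  proof -
    have S: "0 \<le> (\<Sum>i<n. \<bar>x i\<bar>)" by (simp add: sum_nonneg)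
    have "A * exp (A * (\<Sum>i<n. \<bar>x i\<bar>)) \<le> A * exp ((A + B) * (\<Sum>i<n. \<bar>x i\<bar>))"
      "B * exp (B * (\<Sum>i<n. \<bar>x i\<bar>)) \<le> B * exp ((A + B) * (\<Sum>i<n. \<bar>x i\<bar>))"
      using A(1) B(1) S by (auto intro!: mult_left_mono mult_right_mono)
    then show ?thesis using A(2)[of x] B(2)[of x] abs_triangle_ineq[of "f x" "g x"]
      by (simp add: distrib_right)
  qed
  then show ?thesis using A(1) B(1) by (intro exp_growthI[where A = "A + B" and B = "A + B"]) auto
qed

lemma exp_growth_const: "exp_growth n (\<lambda>x. c)"
  by (rule exp_growthI[where A = "\<bar>c\<bar>" and B = 0]) auto

lemma exp_growth_sum:
  assumes "\<And>i. i \<in> I \<Longrightarrow> exp_growth n (f i)"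
  shows "exp_growth n (\<lambda>x. \<Sum>i\<in>I. f i x)"
  using assms by (induction I rule: infinite_finite_induct) (auto intro: exp_growth_add exp_growth_const)

lemma exp_growth_bounded:
  assumes "\<And>x. \<bar>\<psi> x\<bar> \<le> B"
  shows "exp_growth n \<psi>"
  by (rule exp_growthI[where A = B and B = 0]) (use assms order_trans[OF abs_ge_zero assms] in auto)

lemma exp_growth_upd:
  assumes "exp_growth n \<psi>"
  shows "exp_growth (Suc n) (\<lambda>x. \<psi> (x(n := 0)))"
proof -
  obtain A where A: "A \<ge> 0" "\<And>x. \<bar>\<psi> x\<bar> \<le> A * exp (A * (\<Sum>i<n. \<bar>x i\<bar>))"
    using assms unfolding exp_growth_def by blast
  have "\<bar>\<psi> (x(n := 0))\<bar> \<le> A * exp (A * (\<Sum>i<Suc n. \<bar>x i\<bar>))" for x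
  proof -
    have "(\<Sum>i<n. \<bar>(x(n := 0)) i\<bar>) = (\<Sum>i<n. \<bar>x i\<bar>)" by (intro sum.cong) auto
    then have "\<bar>\<psi> (x(n := 0))\<bar> \<le> A * exp (A * (\<Sum>i<n. \<bar>x i\<bar>))" using A(2)[of "x(n := 0)"] by simp
    also have "\<dots> \<le> A * exp (A * (\<Sum>i<Suc n. \<bar>x i\<bar>))" using A(1) by (auto intro!: mult_left_mono)
    finally show ?thesis .
  qed
  then show ?thesis using A(1) by (intro exp_growthI[where A = A and B = A]) auto
qed

text \<open>\<open>\<psi>\<close> is a \<open>C\<^sup>1\<close> function of its first \<open>n\<close> arguments with partial derivatives \<open>d\<psi> i\<close>; the
  chain rule along lines is all that the integration by parts needs.\<close>

definition C1_fun :: "nat \<Rightarrow> ((nat \<Rightarrow> real) \<Rightarrow> real) \<Rightarrow> (nat \<Rightarrow> (nat \<Rightarrow> real) \<Rightarrow> real) \<Rightarrow> bool"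
  where "C1_fun n \<psi> d\<psi> \<longleftrightarrow> continuous_on UNIV \<psi> \<and> exp_growth n \<psi> \<and>
    (\<forall>i<n. continuous_on UNIV (d\<psi> i) \<and> exp_growth n (d\<psi> i)) \<and>
    (\<forall>x a s. ((\<lambda>s. \<psi> (\<lambda>i. x i + s * a i)) has_real_derivative
       (\<Sum>i<n. a i * d\<psi> i (\<lambda>i. x i + s * a i))) (at s))"

lemma continuous_on_fun_line: "continuous_on A (\<lambda>s::real. (\<lambda>i. x i + s * a i) :: nat \<Rightarrow> real)"
  by (intro continuous_on_coordinatewise_then_product continuous_intros)

context isonormal_process
begin

lemma exp_growth_coord_L2:
  assumes "continuous_on UNIV \<psi>" "exp_growth n \<psi>"
  shows "(\<lambda>\<omega>. \<psi> (coord_vec X n \<phi> \<omega>)) \<in> Lp_fun M 2"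
proof -
  have [measurable]: "\<psi> \<in> borel_measurable borel" using assms(1) by (rule borel_measurable_continuous_onI)
  obtain C where C: "C \<ge> 0" "\<And>x. \<bar>\<psi> x\<bar> \<le> C * exp (C * (\<Sum>i<n. \<bar>x i\<bar>))"
    using assms unfolding exp_growth_def by blast
  have "(norm (exp (C * (\<Sum>i<n. \<bar>X (\<phi> i) \<omega>\<bar>))))\<^sup>2 = exp (2 * C * (\<Sum>i<n. \<bar>X (\<phi> i) \<omega>\<bar>))" for \<omega>
    by (simp add: power2_eq_square flip: exp_add)
  then have e: "(\<lambda>\<omega>. exp (C * (\<Sum>i<n. \<bar>X (\<phi> i) \<omega>\<bar>))) \<in> Lp_fun M 2"
    using integrable_exp_sum_abs_X[where c = "2 * C" and n = n and \<phi> = \<phi>] by (simp add: L2_iff)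
  show ?thesis
  proof (rule L2_bound[OF L2_mult_const[OF e, of C]])
    fix \<omega>
    have "(\<Sum>i<n. \<bar>coord_vec X n \<phi> \<omega> i\<bar>) = (\<Sum>i<n. \<bar>X (\<phi> i) \<omega>\<bar>)"
      by (intro sum.cong) (auto simp: coord_vec_def)
    then show "norm (\<psi> (coord_vec X n \<phi> \<omega>)) \<le> norm (C * exp (C * (\<Sum>i<n. \<bar>X (\<phi> i) \<omega>\<bar>)))"
      using C(2)[of "coord_vec X n \<phi> \<omega>"] C(1) by (simp add: abs_mult)
  qed measurable
qed

text \<open>Splitting each \<open>\<phi> i\<close> into its component along \<open>h\<close> and an orthogonal rest makes the
  functional a function of \<open>X h\<close> and of variables independent of it; the one-dimensional formula
  applies to the former with the latter fixed.\<close>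

lemma coord_ibp_hermite:
  assumes h: "norm h = 1"
    and cont: "continuous_on UNIV \<psi>" "continuous_on UNIV \<psi>'"
    and growth: "exp_growth n \<psi>" "exp_growth n \<psi>'"
    and deriv: "\<And>x s. ((\<lambda>s. \<psi> (\<lambda>i. x i + s * a i)) has_real_derivative \<psi>' (\<lambda>i. x i + s * a i)) (at s)"
    and a: "a = (\<lambda>i. if i < n then \<phi> i \<bullet> h else 0)"
  shows "(LINT \<omega>|M. \<psi> (coord_vec X n \<phi> \<omega>) * hermite (Suc q) (X h \<omega>))
       = (LINT \<omega>|M. \<psi>' (coord_vec X n \<phi> \<omega>) * hermite q (X h \<omega>))"
proof -
  define k where "k = (\<lambda>i. \<phi> i - (\<phi> i \<bullet> h) *\<^sub>R h)"
  have hh: "h \<bullet> h = 1" using h by (simp add: norm_eq_sqrt_inner)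
  have orth: "k i \<bullet> h = 0" for i by (simp add: k_def inner_diff_left hh)
  let ?Y = "coord_vec X n k"
  have [measurable]: "\<psi> \<in> borel_measurable borel" "\<psi>' \<in> borel_measurable borel"
    using cont by (auto intro: borel_measurable_continuous_onI)
  have coord: "AE \<omega> in M. coord_vec X n \<phi> \<omega> = (\<lambda>i. ?Y \<omega> i + X h \<omega> * a i)"
  proof -
    have "AE \<omega> in M. \<forall>i\<in>{..<n}. X (1 *\<^sub>R k i + (\<phi> i \<bullet> h) *\<^sub>R h) \<omega> = 1 * X (k i) \<omega> + (\<phi> i \<bullet> h) * X h \<omega>"
      by (intro AE_finite_allI X_linear) simp
    then show ?thesis
      by eventually_elim (auto simp: coord_vec_def fun_eq_iff a k_def)
  qed
  have [measurable]: "(\<lambda>z. (\<lambda>i. snd z i + fst z * a i)) \<in> borel_measurable (borel \<Otimes>\<^sub>M borel :: (real \<times> (nat \<Rightarrow> real)) measure)"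
  proof (rule measurable_coordinatewise_then_product)
    fix i
    have [measurable]: "(\<lambda>y. y i) \<in> borel_measurable (borel :: (nat \<Rightarrow> real) measure)"
      by (intro borel_measurable_continuous_onI continuous_on_product_coordinates)
    show "(\<lambda>z. snd z i + fst z * a i) \<in> borel_measurable (borel \<Otimes>\<^sub>M borel :: (real \<times> (nat \<Rightarrow> real)) measure)"
      by measurable
  qed
  interpret D1: prob_space "distr M borel (X h)" by (rule prob_space_distr) measurable
  interpret D2: prob_space "distr M borel ?Y" by (rule prob_space_distr) measurable
  interpret P: pair_sigma_finite "distr M borel (X h)" "distr M borel ?Y" ..
  note prodlaw = indep_orthogonal[of n k h, OF orth]
  have "h \<noteq> 0" using h by auto
  from X_distributed[OF this] h have dist: "distributed M lborel (X h) std_normal_density" by simp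
  have fubini: "(LINT \<omega>|M. f (coord_vec X n \<phi> \<omega>) * hermite r (X h \<omega>))
      = (LINT y|distr M borel ?Y. LINT s|lborel. std_normal_density s * (f (\<lambda>i. y i + s * a i) * hermite r s))"
    if f: "continuous_on UNIV f" "exp_growth n f" for f r
  proof -
    have [measurable]: "f \<in> borel_measurable borel" using f by (auto intro: borel_measurable_continuous_onI)
    define g where "g = (\<lambda>(s, y). f (\<lambda>i. y i + s * a i) * hermite r s)"
    have gm[measurable]: "g \<in> borel_measurable (borel \<Otimes>\<^sub>M borel)" unfolding g_def case_prod_beta by measurable
    have int: "integrable M (\<lambda>\<omega>. f (coord_vec X n \<phi> \<omega>) * hermite r (X h \<omega>))"
      by (intro L2_mult_integrable exp_growth_coord_L2 f hermite_X_L2)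
    have eq: "AE \<omega> in M. f (coord_vec X n \<phi> \<omega>) * hermite r (X h \<omega>) = g (X h \<omega>, ?Y \<omega>)"
      using coord by eventually_elim (simp add: g_def)
    have int2: "integrable M (\<lambda>\<omega>. g (X h \<omega>, ?Y \<omega>))"
      using int by (rule integrable_cong_AE_imp) (use eq in \<open>auto elim: eventually_mono\<close>)
    have int3: "integrable (distr M borel (X h) \<Otimes>\<^sub>M distr M borel ?Y) (case_prod (\<lambda>s y. g (s, y)))"
      unfolding prodlaw using int2 by (subst integrable_distr_eq) auto
    have "(LINT \<omega>|M. f (coord_vec X n \<phi> \<omega>) * hermite r (X h \<omega>)) = (LINT \<omega>|M. g (X h \<omega>, ?Y \<omega>))"
      by (rule integral_cong_AE) (use eq in auto)
    also have "\<dots> = (LINT z|(distr M borel (X h) \<Otimes>\<^sub>M distr M borel ?Y). case_prod (\<lambda>s y. g (s, y)) z)"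
      unfolding prodlaw by (subst integral_distr) auto
    also have "\<dots> = (LINT y|distr M borel ?Y. LINT s|distr M borel (X h). g (s, y))"
      using P.integral_snd[OF int3] by simp
    also have "\<dots> = (LINT y|distr M borel ?Y. LINT s|lborel. std_normal_density s * g (s, y))"
    proof (rule Bochner_Integration.integral_cong[OF refl])
      fix y
      have m: "(\<lambda>s. g (s, y)) \<in> borel_measurable borel"
        using measurable_compose[OF measurable_Pair2' gm, of y] by simp
      have "(LINT s|distr M borel (X h). g (s, y)) = (LINT \<omega>|M. g (X h \<omega>, y))"
        using m by (subst integral_distr) auto
      also have "\<dots> = (LINT s|lborel. std_normal_density s * g (s, y))"
        using distributed_integral[OF dist, of "\<lambda>s. g (s, y)"] m by simp
      finally show "(LINT s|distr M borel (X h). g (s, y)) = (LINT s|lborel. std_normal_density s * g (s, y))" .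
    qed
    finally show ?thesis by (simp add: g_def)
  qed
  obtain C where C: "C \<ge> 0" "\<And>x. \<bar>\<psi> x\<bar> \<le> C * exp (C * (\<Sum>i<n. \<bar>x i\<bar>))"
    using growth unfolding exp_growth_def by blast
  obtain C' where C': "C' \<ge> 0" "\<And>x. \<bar>\<psi>' x\<bar> \<le> C' * exp (C' * (\<Sum>i<n. \<bar>x i\<bar>))"
    using growth unfolding exp_growth_def by blast
  have line_bound: "\<bar>f (\<lambda>i. y i + s * a i)\<bar> \<le> K * exp (K * \<bar>s\<bar>)"
    if "B \<ge> 0" "\<And>x. \<bar>f x\<bar> \<le> B * exp (B * (\<Sum>i<n. \<bar>x i\<bar>))"
      "K \<ge> B * exp (B * (\<Sum>i<n. \<bar>y i\<bar>))" "K \<ge> B * (\<Sum>i<n. \<bar>a i\<bar>)" for f B y s K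
  proof -
    have "(\<Sum>i<n. \<bar>y i + s * a i\<bar>) \<le> (\<Sum>i<n. \<bar>y i\<bar> + \<bar>s\<bar> * \<bar>a i\<bar>)"
      by (intro sum_mono) (metis abs_mult abs_triangle_ineq)
    also have "\<dots> = (\<Sum>i<n. \<bar>y i\<bar>) + \<bar>s\<bar> * (\<Sum>i<n. \<bar>a i\<bar>)" by (simp add: sum.distrib sum_distrib_left)
    finally have "B * (\<Sum>i<n. \<bar>y i + s * a i\<bar>) \<le> B * (\<Sum>i<n. \<bar>y i\<bar>) + (B * (\<Sum>i<n. \<bar>a i\<bar>)) * \<bar>s\<bar>"
      using that(1) mult_left_mono by (fastforce simp: algebra_simps)
    then have "B * exp (B * (\<Sum>i<n. \<bar>y i + s * a i\<bar>)) \<le> B * exp (B * (\<Sum>i<n. \<bar>y i\<bar>) + (B * (\<Sum>i<n. \<bar>a i\<bar>)) * \<bar>s\<bar>)"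
      using that(1) by (intro mult_left_mono) auto
    also have "\<dots> = B * exp (B * (\<Sum>i<n. \<bar>y i\<bar>)) * exp ((B * (\<Sum>i<n. \<bar>a i\<bar>)) * \<bar>s\<bar>)" by (simp add: exp_add)
    also have "\<dots> \<le> K * exp (K * \<bar>s\<bar>)"
      using that(1,3,4) by (intro mult_mono) (auto intro: mult_right_mono order_trans[OF _ that(3)])
    finally show ?thesis using that(2)[of "\<lambda>i. y i + s * a i"] by linarith
  qed
  show ?thesis unfolding fubini[OF cont(1) growth(1)] fubini[OF cont(2) growth(2)]
  proof (rule Bochner_Integration.integral_cong[OF refl], rule std_normal_ibp_hermite[OF deriv])
    fix y :: "nat \<Rightarrow> real" and s :: real
    define K where "K = C * exp (C * (\<Sum>i<n. \<bar>y i\<bar>)) + C * (\<Sum>i<n. \<bar>a i\<bar>)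
       + C' * exp (C' * (\<Sum>i<n. \<bar>y i\<bar>)) + C' * (\<Sum>i<n. \<bar>a i\<bar>)"
    have nn: "0 \<le> C * exp (C * (\<Sum>i<n. \<bar>y i\<bar>))" "0 \<le> C * (\<Sum>i<n. \<bar>a i\<bar>)"
       "0 \<le> C' * exp (C' * (\<Sum>i<n. \<bar>y i\<bar>))" "0 \<le> C' * (\<Sum>i<n. \<bar>a i\<bar>)"
      using C(1) C'(1) by (auto intro!: mult_nonneg_nonneg sum_nonneg)
    show "continuous_on UNIV (\<lambda>s. \<psi>' (\<lambda>i. y i + s * a i))"
      by (rule continuous_on_compose2[OF cont(2) continuous_on_fun_line]) auto
    show "\<bar>\<psi> (\<lambda>i. y i + s * a i)\<bar> \<le> K * exp (K * \<bar>s\<bar>)"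
      using nn by (intro line_bound[OF C]) (auto simp: K_def)
    show "\<bar>\<psi>' (\<lambda>i. y i + s * a i)\<bar> \<le> K * exp (K * \<bar>s\<bar>)"
      using nn by (intro line_bound[OF C']) (auto simp: K_def)
  qed
qed

text \<open>Cylindrical variables paired with their derivatives. This class is wider than the smooth
  variables of polynomial growth: it also contains their compositions with bounded functions
  and their products with \<open>f (X k)\<close>, which serve as test variables.\<close>

definition cyl :: "('a \<Rightarrow> real) \<Rightarrow> ('a \<Rightarrow> 'h) \<Rightarrow> bool"
  where "cyl \<Phi> U \<longleftrightarrow> (\<exists>n \<phi> \<psi> d\<psi>. C1_fun n \<psi> d\<psi> \<and> \<Phi> = (\<lambda>\<omega>. \<psi> (coord_vec X n \<phi> \<omega>)) \<and>
     U = (\<lambda>\<omega>. \<Sum>i<n. d\<psi> i (coord_vec X n \<phi> \<omega>) *\<^sub>R \<phi> i))"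

lemma cyl_L2: assumes "cyl \<Phi> U" shows "\<Phi> \<in> Lp_fun M 2"
  using assms unfolding cyl_def C1_fun_def by (auto intro!: exp_growth_coord_L2)

lemma cyl_deriv_L2: assumes "cyl \<Phi> U" shows "U \<in> Lp_fun M 2"
proof -
  obtain n \<phi> \<psi> d\<psi> where C1: "C1_fun n \<psi> d\<psi>"
    and U: "U = (\<lambda>\<omega>. \<Sum>i<n. d\<psi> i (coord_vec X n \<phi> \<omega>) *\<^sub>R \<phi> i)" using assms unfolding cyl_def by blast
  have "(\<lambda>\<omega>. d\<psi> i (coord_vec X n \<phi> \<omega>) *\<^sub>R \<phi> i) \<in> Lp_fun M 2" if "i < n" for i
  proof -
    have "(\<lambda>\<omega>. d\<psi> i (coord_vec X n \<phi> \<omega>)) \<in> Lp_fun M 2"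
      using C1 that unfolding C1_fun_def by (intro exp_growth_coord_L2) auto
    then show ?thesis by (auto simp: L2_iff power_mult_distrib)
  qed
  then show ?thesis unfolding U by (intro L2_sum) auto
qed

lemma cyl_ibp:
  assumes "cyl \<Phi> U" and h: "norm h = 1"
  shows "(LINT \<omega>|M. \<Phi> \<omega> * hermite (Suc q) (X h \<omega>)) = (LINT \<omega>|M. (U \<omega> \<bullet> h) * hermite q (X h \<omega>))"
proof -
  obtain n \<phi> \<psi> d\<psi> where C1: "C1_fun n \<psi> d\<psi>" and \<Phi>: "\<Phi> = (\<lambda>\<omega>. \<psi> (coord_vec X n \<phi> \<omega>))"
    and U: "U = (\<lambda>\<omega>. \<Sum>i<n. d\<psi> i (coord_vec X n \<phi> \<omega>) *\<^sub>R \<phi> i)" using assms unfolding cyl_def by blast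
  define a where "a = (\<lambda>i. if i < n then \<phi> i \<bullet> h else 0)"
  have "(LINT \<omega>|M. \<psi> (coord_vec X n \<phi> \<omega>) * hermite (Suc q) (X h \<omega>))
      = (LINT \<omega>|M. (\<Sum>i<n. a i * d\<psi> i (coord_vec X n \<phi> \<omega>)) * hermite q (X h \<omega>))"
  proof (rule coord_ibp_hermite[OF h _ _ _ _ _ a_def])
    show "continuous_on UNIV (\<lambda>x. \<Sum>i<n. a i * d\<psi> i x)"
      using C1 unfolding C1_fun_def by (intro continuous_intros) auto
    show "exp_growth n (\<lambda>x. \<Sum>i<n. a i * d\<psi> i x)"
      using C1 unfolding C1_fun_def by (intro exp_growth_sum exp_growth_mult exp_growth_const) auto
  qed (use C1 in \<open>auto simp: C1_fun_def\<close>)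
  moreover have "(\<Sum>i<n. a i * d\<psi> i (coord_vec X n \<phi> \<omega>)) = U \<omega> \<bullet> h" for \<omega>
    unfolding U inner_sum_left by (intro sum.cong) (auto simp: a_def)
  ultimately show ?thesis by (simp add: \<Phi>)
qed

lemma cyl_comp:
  assumes "cyl \<Phi> U" and f: "\<And>x. (f has_real_derivative f' x) (at x)" "continuous_on UNIV f'"
    and bound: "\<And>x. \<bar>f x\<bar> \<le> B" "\<And>x. \<bar>f' x\<bar> \<le> B'"
  shows "cyl (\<lambda>\<omega>. f (\<Phi> \<omega>)) (\<lambda>\<omega>. f' (\<Phi> \<omega>) *\<^sub>R U \<omega>)"
proof -
  obtain n \<phi> \<psi> d\<psi> where C1: "C1_fun n \<psi> d\<psi>" and \<Phi>: "\<Phi> = (\<lambda>\<omega>. \<psi> (coord_vec X n \<phi> \<omega>))"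
    and U: "U = (\<lambda>\<omega>. \<Sum>i<n. d\<psi> i (coord_vec X n \<phi> \<omega>) *\<^sub>R \<phi> i)" using assms unfolding cyl_def by blast
  have cf: "continuous_on UNIV f" using f(1) by (auto intro!: continuous_at_imp_continuous_on DERIV_isCont)
  have "C1_fun n (\<lambda>x. f (\<psi> x)) (\<lambda>i x. f' (\<psi> x) * d\<psi> i x)"
    unfolding C1_fun_def
  proof (intro conjI allI impI)
    show "continuous_on UNIV (\<lambda>x. f (\<psi> x))"
      using C1 by (intro continuous_on_compose2[OF cf]) (auto simp: C1_fun_def)
    show "exp_growth n (\<lambda>x. f (\<psi> x))" using bound by (intro exp_growth_bounded)
    show "exp_growth n (\<lambda>x. f' (\<psi> x) * d\<psi> i x)" if "i < n" for i
      using C1 that by (intro exp_growth_mult[OF exp_growth_bounded[OF bound(2)]]) (auto simp: C1_fun_def)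
    show "continuous_on UNIV (\<lambda>x. f' (\<psi> x) * d\<psi> i x)" if "i < n" for i
      using C1 that by (intro continuous_on_mult continuous_on_compose2[OF f(2)]) (auto simp: C1_fun_def)
    fix x a s
    show "((\<lambda>s. f (\<psi> (\<lambda>i. x i + s * a i))) has_real_derivative
       (\<Sum>i<n. a i * (f' (\<psi> (\<lambda>i. x i + s * a i)) * d\<psi> i (\<lambda>i. x i + s * a i)))) (at s)"
      using DERIV_chain2[OF f(1), of "\<lambda>s. \<psi> (\<lambda>i. x i + s * a i)" "(\<Sum>i<n. a i * d\<psi> i (\<lambda>i. x i + s * a i))" s UNIV] C1
      by (simp add: C1_fun_def sum_distrib_left mult_ac)
  qed
  then show ?thesis unfolding cyl_def \<Phi> U
    by (intro exI[of _ n] exI[of _ \<phi>] exI) (auto simp: scaleR_sum_right)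
qed

text \<open>The factor \<open>f (X k)\<close> enters as a function of one additional coordinate, of index \<open>n\<close>.\<close>

lemma cyl_mult_X:
  assumes "cyl \<Phi> U" and f: "\<And>x. (f has_real_derivative f' x) (at x)" "continuous_on UNIV f'"
    and bound: "\<And>x. \<bar>f x\<bar> \<le> B" "\<And>x. \<bar>f' x\<bar> \<le> B'"
  shows "cyl (\<lambda>\<omega>. \<Phi> \<omega> * f (X k \<omega>)) (\<lambda>\<omega>. f (X k \<omega>) *\<^sub>R U \<omega> + (\<Phi> \<omega> * f' (X k \<omega>)) *\<^sub>R k)"
proof -
  obtain n \<phi> \<psi> d\<psi> where C1: "C1_fun n \<psi> d\<psi>" and \<Phi>: "\<Phi> = (\<lambda>\<omega>. \<psi> (coord_vec X n \<phi> \<omega>))"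
    and U: "U = (\<lambda>\<omega>. \<Sum>i<n. d\<psi> i (coord_vec X n \<phi> \<omega>) *\<^sub>R \<phi> i)" using assms unfolding cyl_def by blast
  have cf: "continuous_on UNIV f" using f(1) by (auto intro!: continuous_at_imp_continuous_on DERIV_isCont)
  define \<psi>2 where "\<psi>2 = (\<lambda>x. \<psi> (x(n := 0)) * f (x n))"
  define d\<psi>2 where "d\<psi>2 = (\<lambda>i x. if i < n then d\<psi> i (x(n := 0)) * f (x n) else \<psi> (x(n := 0)) * f' (x n))"
  have upd: "continuous_on UNIV (\<lambda>x::nat \<Rightarrow> real. x(n := 0))"
  proof (rule continuous_on_coordinatewise_then_product)
    show "continuous_on UNIV (\<lambda>x::nat \<Rightarrow> real. (x(n := 0)) i)" for i
      by (cases "i = n") (auto intro: continuous_on_product_coordinates)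
  qed
  have c0: "continuous_on UNIV (\<lambda>x. g (x(n := 0)))" if "continuous_on UNIV g" for g :: "(nat \<Rightarrow> real) \<Rightarrow> real"
    by (rule continuous_on_compose2[OF that upd]) auto
  have cn: "continuous_on UNIV (\<lambda>x::nat \<Rightarrow> real. g (x n))" if "continuous_on UNIV g" for g :: "real \<Rightarrow> real"
    by (rule continuous_on_compose2[OF that continuous_on_product_coordinates]) auto
  have "C1_fun (Suc n) \<psi>2 d\<psi>2"
    unfolding C1_fun_def
  proof (intro conjI allI impI)
    show "continuous_on UNIV \<psi>2"
      unfolding \<psi>2_def using C1 by (intro continuous_on_mult c0 cn cf) (auto simp: C1_fun_def)
    show "exp_growth (Suc n) \<psi>2"
      unfolding \<psi>2_def using C1 by (intro exp_growth_mult[OF exp_growth_upd exp_growth_bounded[OF bound(1)]]) (auto simp: C1_fun_def)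
    show "exp_growth (Suc n) (d\<psi>2 i)" if "i < Suc n" for i
    proof (cases "i < n")
      case True then show ?thesis
        unfolding d\<psi>2_def using C1 by simp (intro exp_growth_mult[OF exp_growth_upd exp_growth_bounded[OF bound(1)]], auto simp: C1_fun_def)
    next
      case False then show ?thesis
        unfolding d\<psi>2_def using C1 by simp (intro exp_growth_mult[OF exp_growth_upd exp_growth_bounded[OF bound(2)]], auto simp: C1_fun_def)
    qed
    show "continuous_on UNIV (d\<psi>2 i)" if "i < Suc n" for i
    proof (cases "i < n")
      case True then show ?thesis
        unfolding d\<psi>2_def using C1 by simp (intro continuous_on_mult c0 cn cf, auto simp: C1_fun_def)
    next
      case False then show ?thesis
        unfolding d\<psi>2_def using C1 by simp (intro continuous_on_mult c0 cn f, auto simp: C1_fun_def)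
    qed
    fix x a :: "nat \<Rightarrow> real" and s
    let ?l = "\<lambda>s i. x i + s * a i" and ?z = "\<lambda>s i. (x(n := 0)) i + s * (a(n := 0)) i"
    have l0: "(?l s)(n := 0) = ?z s" for s by (auto simp: fun_eq_iff)
    have d1: "((\<lambda>s. \<psi> (?z s)) has_real_derivative (\<Sum>i<n. (a(n := 0)) i * d\<psi> i (?z s))) (at s)"
      using C1 unfolding C1_fun_def by blast
    have d2: "((\<lambda>s. f (?l s n)) has_real_derivative f' (?l s n) * a n) (at s)"
      by (rule DERIV_chain2[OF f(1), where g = "\<lambda>s. x n + s * a n"]) (auto intro!: derivative_eq_intros)
    have s: "(\<Sum>i<n. (a(n := 0)) i * d\<psi> i (?z s)) = (\<Sum>i<n. a i * d\<psi> i (?z s))"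
      by (intro sum.cong) auto
    have s2: "(\<Sum>i<n. a i * d\<psi>2 i (?l s)) = (\<Sum>i<n. a i * d\<psi> i (?z s)) * f (?l s n)"
      unfolding sum_distrib_right by (intro sum.cong) (auto simp: d\<psi>2_def l0)
    show "((\<lambda>s. \<psi>2 (?l s)) has_real_derivative (\<Sum>i<Suc n. a i * d\<psi>2 i (?l s))) (at s)"
      using DERIV_mult[OF d1 d2] unfolding \<psi>2_def l0 sum.lessThan_Suc s2 s
      by (simp add: d\<psi>2_def l0 algebra_simps)
  qed
  moreover have c: "(coord_vec X (Suc n) (\<phi>(n := k)) \<omega>)(n := 0) = coord_vec X n \<phi> \<omega>" for \<omega>
    by (auto simp: coord_vec_def fun_eq_iff)
  have cn': "coord_vec X (Suc n) (\<phi>(n := k)) \<omega> n = X k \<omega>" for \<omega> by (simp add: coord_vec_def)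
  have "(\<lambda>\<omega>. \<Phi> \<omega> * f (X k \<omega>)) = (\<lambda>\<omega>. \<psi>2 (coord_vec X (Suc n) (\<phi>(n := k)) \<omega>))"
    by (simp add: \<psi>2_def c cn' \<Phi>)
  moreover have "(\<lambda>\<omega>. f (X k \<omega>) *\<^sub>R U \<omega> + (\<Phi> \<omega> * f' (X k \<omega>)) *\<^sub>R k)
      = (\<lambda>\<omega>. \<Sum>i<Suc n. d\<psi>2 i (coord_vec X (Suc n) (\<phi>(n := k)) \<omega>) *\<^sub>R (\<phi>(n := k)) i)"
  proof
    fix \<omega>
    have "(\<Sum>i<n. d\<psi>2 i (coord_vec X (Suc n) (\<phi>(n := k)) \<omega>) *\<^sub>R (\<phi>(n := k)) i) = f (X k \<omega>) *\<^sub>R U \<omega>"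
      unfolding U scaleR_sum_right by (intro sum.cong) (auto simp: d\<psi>2_def c cn' mult.commute)
    then show "f (X k \<omega>) *\<^sub>R U \<omega> + (\<Phi> \<omega> * f' (X k \<omega>)) *\<^sub>R k
      = (\<Sum>i<Suc n. d\<psi>2 i (coord_vec X (Suc n) (\<phi>(n := k)) \<omega>) *\<^sub>R (\<phi>(n := k)) i)"
      unfolding sum.lessThan_Suc by (simp add: d\<psi>2_def c cn' \<Phi>)
  qed
  ultimately show ?thesis unfolding cyl_def by blast
qed

lemma cyl_poly_X: "cyl (\<lambda>\<omega>. poly p (X g \<omega>)) (\<lambda>\<omega>. poly (pderiv p) (X g \<omega>) *\<^sub>R g)"
proof -
  have cn: "continuous_on UNIV (\<lambda>x::nat \<Rightarrow> real. poly p (x 0))" for p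
    by (intro continuous_intros continuous_on_product_coordinates)
  have gr: "exp_growth 1 (\<lambda>x. poly p (x 0))" for p
    using poly_exp_bound[of p] unfolding exp_growth_def by auto
  have "C1_fun 1 (\<lambda>x. poly p (x 0)) (\<lambda>i x. poly (pderiv p) (x 0))"
    unfolding C1_fun_def
    by (intro conjI allI impI cn gr) (auto intro!: derivative_eq_intros)
  then show ?thesis unfolding cyl_def
    by (intro exI[of _ 1] exI[of _ "\<lambda>_. g"] exI conjI) (auto simp: coord_vec_def)
qed

end

section \<open>Smooth random variables\<close>

lemma continuous_on_Euclidean_space_compose:
  fixes P :: "'b::topological_space \<Rightarrow> nat \<Rightarrow> real"
  assumes g: "continuous_map (Euclidean_space n) euclideanreal g"
    and P: "\<And>i. continuous_on UNIV (\<lambda>z. P z i)" "\<And>z i. i \<ge> n \<Longrightarrow> P z i = 0"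
  shows "continuous_on UNIV (\<lambda>z. g (P z))"
proof -
  have "continuous_map euclidean (Euclidean_space n) P"
    unfolding Euclidean_space_def using P
    by (simp add: continuous_map_in_subtopology continuous_map_componentwise_UNIV image_subset_iff Pi_iff)
  from continuous_map_compose[OF this g] show ?thesis by (simp add: comp_def)
qed

text \<open>One coordinate is set in motion at a time; the derivative along the diagonal of
  the resulting function of two real variables comes from its continuous partial derivatives.\<close>

lemma Euclidean_space_directional_derivative:
  assumes cont: "\<And>i. i < n \<Longrightarrow> continuous_map (Euclidean_space n) euclideanreal (partial_deriv i g)"
    and diff: "\<And>i x. i < n \<Longrightarrow> x \<in> topspace (Euclidean_space n) \<Longrightarrow> (\<lambda>t. g (x(i := t))) differentiable (at (x i))"
    and "k \<le> n" and "x \<in> topspace (Euclidean_space n)"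
  shows "((\<lambda>s. g (\<lambda>i. if i < k then x i + s * a i else x i)) has_real_derivative
     (\<Sum>i<k. a i * partial_deriv i g (\<lambda>i. if i < k then x i + s * a i else x i))) (at s)"
  using assms(3,4)
proof (induction k arbitrary: x s)
  case 0 then show ?case by simp
next
  case (Suc k)
  then have k: "k < n" by simp
  have x0: "x i = 0" if "i \<ge> n" for i using Suc.prems(2) that by (simp add: topspace_Euclidean_space)
  define P where "P = (\<lambda>u v i. if i < k then x i + u * a i else if i = k then x k + v * a k else x i)"
  have PE: "P u v \<in> topspace (Euclidean_space n)" for u v
    using k x0 by (auto simp: P_def topspace_Euclidean_space)
  define D1 where "D1 = (\<Sum>i<k. a i * partial_deriv i g (P s s))"
  have fx: "((\<lambda>u. g (P u s)) has_derivative (\<lambda>h. h * D1)) (at s within UNIV)"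
  proof -
    let ?x = "x(k := x k + s * a k)"
    have e: "(\<lambda>i. if i < k then ?x i + u * a i else ?x i) = P u s" for u
      by (auto simp: P_def fun_eq_iff)
    have xE: "?x \<in> topspace (Euclidean_space n)" using k x0 by (auto simp: topspace_Euclidean_space)
    have "((\<lambda>u. g (\<lambda>i. if i < k then ?x i + u * a i else ?x i)) has_real_derivative
        (\<Sum>i<k. a i * partial_deriv i g (\<lambda>i. if i < k then ?x i + s * a i else ?x i))) (at s)"
      by (rule Suc.IH[OF less_imp_le[OF k] xE])
    moreover have "(\<lambda>h. h * D1) = (*) D1" by (simp add: fun_eq_iff)
    ultimately show ?thesis unfolding e D1_def has_field_derivative_def by simp
  qed
  have fy: "((\<lambda>v. g (P u v)) has_derivative blinfun_apply ((a k * partial_deriv k g (P u v)) *\<^sub>R id_blinfun)) (at v within UNIV)" for u v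
  proof -
    let ?w = "P u v"
    have "((\<lambda>t. g (?w(k := t))) has_real_derivative partial_deriv k g ?w) (at (?w k))"
      using diff[OF k PE[of u v]] unfolding partial_deriv_def
      by (simp add: DERIV_deriv_iff_real_differentiable)
    moreover have "?w k = x k + v * a k" by (simp add: P_def)
    ultimately have "((\<lambda>t. g (?w(k := t))) has_real_derivative partial_deriv k g ?w) (at (x k + v * a k))" by simp
    then have "((\<lambda>v'. g (?w(k := x k + v' * a k))) has_real_derivative partial_deriv k g ?w * a k) (at v)"
      by (rule DERIV_chain2[where g = "\<lambda>v'. x k + v' * a k"]) (auto intro!: derivative_eq_intros)
    moreover have "?w(k := x k + v' * a k) = P u v'" for v' by (auto simp: P_def fun_eq_iff)
    moreover have "blinfun_apply ((a k * partial_deriv k g (P u v)) *\<^sub>R id_blinfun) = (*) (partial_deriv k g ?w * a k)"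
      by (simp add: fun_eq_iff blinfun.scaleR_left)
    ultimately show ?thesis
      by (simp only: has_field_derivative_def)
  qed
  have "continuous_on UNIV (\<lambda>z. partial_deriv k g (P (fst z) (snd z)))"
  proof (rule continuous_on_Euclidean_space_compose[OF cont[OF k]])
    show "continuous_on UNIV (\<lambda>z. P (fst z) (snd z) i)" for i
      by (cases "i < k"; cases "i = k") (auto simp: P_def intro!: continuous_intros)
    show "P (fst z) (snd z) i = 0" if "i \<ge> n" for z i
      using that k x0 by (simp add: P_def)
  qed
  then have "continuous_on UNIV (\<lambda>z. (a k * partial_deriv k g (P (fst z) (snd z))) *\<^sub>R (id_blinfun :: real \<Rightarrow>\<^sub>L real))"
    by (intro continuous_intros)
  then have cont2: "continuous (at (s, s) within UNIV \<times> UNIV)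
      (\<lambda>(u, v). (a k * partial_deriv k g (P u v)) *\<^sub>R (id_blinfun :: real \<Rightarrow>\<^sub>L real))"
    unfolding case_prod_beta' by (simp add: continuous_on_eq_continuous_at)
  have "((\<lambda>(u, v). g (P u v)) has_derivative
      (\<lambda>(tx, ty). tx * D1 + blinfun_apply ((a k * partial_deriv k g (P s s)) *\<^sub>R id_blinfun) ty)) (at (s, s) within UNIV \<times> UNIV)"
    by (rule has_derivative_partialsI[OF fx fy cont2]) auto
  then have d: "((\<lambda>(u, v). g (P u v)) has_derivative
      (\<lambda>(tx, ty). tx * D1 + ty * (a k * partial_deriv k g (P s s)))) (at (s, s))"
    by (simp add: blinfun.scaleR_left mult.commute)
  have "((\<lambda>s. (s, s)) has_derivative (\<lambda>h. (h, h))) (at s)" by (auto intro!: derivative_eq_intros)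
  from has_derivative_compose[OF this d]
  have "((\<lambda>s. g (P s s)) has_derivative (\<lambda>h. h * D1 + h * (a k * partial_deriv k g (P s s)))) (at s)" by simp
  then have "((\<lambda>s. g (P s s)) has_real_derivative D1 + a k * partial_deriv k g (P s s)) (at s)"
    unfolding has_field_derivative_def by (rule has_derivative_eq_rhs) (simp add: fun_eq_iff algebra_simps)
  moreover have "P s s = (\<lambda>i. if i < Suc k then x i + s * a i else x i)" for s
    by (auto simp: P_def fun_eq_iff less_Suc_eq)
  ultimately show ?case by (simp add: D1_def)
qed

text \<open>Nothing is known of \<open>g\<close> at sequences with nonzero entries beyond \<open>n\<close>; truncating the
  argument first gives a function that is regular on all sequences.\<close>

lemma smooth_poly_growth_C1:
  assumes "smooth_poly_growth n g"
  shows "C1_fun n (\<lambda>x. g (\<lambda>i. if i < n then x i else 0))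
     (\<lambda>j x. partial_deriv j g (\<lambda>i. if i < n then x i else 0))"
proof -
  let ?T = "\<lambda>x i. if i < n then x i else (0::real)"
  have TE: "?T x \<in> topspace (Euclidean_space n)" for x by (simp add: topspace_Euclidean_space)
  have base: "continuous_map (Euclidean_space n) euclideanreal g" "\<exists>C N. \<forall>x \<in> topspace (Euclidean_space n). \<bar>g x\<bar> \<le> C * (1 + L2_set x {..<n}) ^ N"
    "\<And>i x. i < n \<Longrightarrow> x \<in> topspace (Euclidean_space n) \<Longrightarrow> (\<lambda>t. g (x(i := t))) differentiable (at (x i))"
    using assms[unfolded smooth_poly_growth_def, rule_format, of "[]"] by (auto simp: partial_derivs_def)
  have step: "continuous_map (Euclidean_space n) euclideanreal (partial_deriv i g)" "\<exists>C N. \<forall>x \<in> topspace (Euclidean_space n). \<bar>partial_deriv i g x\<bar> \<le> C * (1 + L2_set x {..<n}) ^ N"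
    if "i < n" for i
    using assms[unfolded smooth_poly_growth_def, rule_format, of "[i]"] that by (auto simp: partial_derivs_def)
  have gr: "exp_growth n (\<lambda>x. f (?T x))"
    if gf: "\<exists>C N. \<forall>x \<in> topspace (Euclidean_space n). \<bar>f x\<bar> \<le> C * (1 + L2_set x {..<n}) ^ N" for f
  proof -
    obtain C N where CN: "\<forall>x \<in> topspace (Euclidean_space n). \<bar>f x\<bar> \<le> C * (1 + L2_set x {..<n}) ^ N"
      using gf by blast
    have "\<bar>f (?T x)\<bar> \<le> \<bar>C\<bar> * exp (real N * (\<Sum>i<n. \<bar>x i\<bar>))" for x
    proof -
      have "L2_set (?T x) {..<n} \<le> (\<Sum>i<n. \<bar>?T x i\<bar>)" by (rule L2_set_le_sum_abs)
      also have "\<dots> = (\<Sum>i<n. \<bar>x i\<bar>)" by (intro sum.cong) auto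
      finally have "1 + L2_set (?T x) {..<n} \<le> exp (\<Sum>i<n. \<bar>x i\<bar>)"
        using exp_ge_add_one_self[of "\<Sum>i<n. \<bar>x i\<bar>"] by linarith
      then have "(1 + L2_set (?T x) {..<n}) ^ N \<le> exp (\<Sum>i<n. \<bar>x i\<bar>) ^ N"
        by (intro power_mono) auto
      also have "\<dots> = exp (real N * (\<Sum>i<n. \<bar>x i\<bar>))" by (simp add: exp_of_nat_mult)
      finally have "\<bar>C\<bar> * (1 + L2_set (?T x) {..<n}) ^ N \<le> \<bar>C\<bar> * exp (real N * (\<Sum>i<n. \<bar>x i\<bar>))"
        by (intro mult_left_mono) auto
      moreover have "C * (1 + L2_set (?T x) {..<n}) ^ N \<le> \<bar>C\<bar> * (1 + L2_set (?T x) {..<n}) ^ N"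
        by (intro mult_right_mono) auto
      ultimately show ?thesis using CN TE[of x] by force
    qed
    then show ?thesis by (intro exp_growthI[where A = "\<bar>C\<bar>" and B = "real N"]) auto
  qed
  have coord: "continuous_on UNIV (\<lambda>x::nat \<Rightarrow> real. ?T x i)" for i
    by (cases "i < n") (auto intro: continuous_on_product_coordinates)
  show ?thesis unfolding C1_fun_def
  proof (intro conjI allI impI)
    show "continuous_on UNIV (\<lambda>x. g (?T x))"
      by (rule continuous_on_Euclidean_space_compose[OF base(1) coord]) auto
    show "exp_growth n (\<lambda>x. g (?T x))" by (rule gr[OF base(2)])
    show "continuous_on UNIV (\<lambda>x. partial_deriv i g (?T x))" if "i < n" for i
      by (rule continuous_on_Euclidean_space_compose[OF step(1)[OF that] coord]) auto
    show "exp_growth n (\<lambda>x. partial_deriv i g (?T x))" if "i < n" for i by (rule gr[OF step(2)[OF that]])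
    fix x a s
    have e: "(\<lambda>i. if i < n then ?T x i + s * a i else ?T x i) = ?T (\<lambda>i. x i + s * a i)" for s
      by (auto simp: fun_eq_iff)
    show "((\<lambda>s. g (?T (\<lambda>i. x i + s * a i))) has_real_derivative
       (\<Sum>i<n. a i * partial_deriv i g (?T (\<lambda>i. x i + s * a i)))) (at s)"
      using Euclidean_space_directional_derivative[OF step(1) base(3) order_refl TE, of x a s]
      unfolding e by blast
  qed
qed

lemma (in isonormal_process) smooth_rv_deriv_cyl:
  assumes "smooth_rv_deriv X F U"
  shows "cyl F U"
proof -
  obtain n g \<phi> where g: "smooth_poly_growth n g" and F: "F = (\<lambda>\<omega>. g (coord_vec X n \<phi> \<omega>))"
    and U: "U = (\<lambda>\<omega>. \<Sum>i<n. partial_deriv i g (coord_vec X n \<phi> \<omega>) *\<^sub>R \<phi> i)"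
    using assms unfolding smooth_rv_deriv_def by blast
  have e: "(\<lambda>i. if i < n then coord_vec X n \<phi> \<omega> i else 0) = coord_vec X n \<phi> \<omega>" for \<omega>
    by (auto simp: coord_vec_def)
  show ?thesis unfolding cyl_def F U
    by (intro exI[of _ n] exI[of _ \<phi>] exI conjI, rule smooth_poly_growth_C1[OF g]) (simp_all add: e)
qed

definition poly_sum :: "nat \<Rightarrow> (nat \<Rightarrow> real poly) \<Rightarrow> (nat \<Rightarrow> real) \<Rightarrow> real"
  where "poly_sum n p x = (\<Sum>i<n. poly (p i) (x i))"

lemma poly_sum_has_derivative:
  assumes "j < n"
  shows "((\<lambda>t. poly_sum n p (x(j := t))) has_real_derivative
     poly_sum n (\<lambda>i. if i = j then pderiv (p j) else 0) x) (at (x j))"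
proof -
  have "((\<lambda>t. poly (p i) ((x(j := t)) i)) has_real_derivative poly (if i = j then pderiv (p j) else 0) (x i)) (at (x j))" for i
    by (cases "i = j") (auto intro!: poly_DERIV)
  then show ?thesis unfolding poly_sum_def by (intro DERIV_sum) auto
qed

text \<open>Sums of one-variable polynomials are stable under partial derivatives, so
  regularity and growth need to be examined for such sums only.\<close>

lemma partial_derivs_poly_sum:
  assumes "set is \<subseteq> {..<n}"
  shows "\<exists>p'. partial_derivs is (poly_sum n p) = poly_sum n p'"
  using assms
proof (induction "is")
  case Nil then show ?case by (auto simp: partial_derivs_def)
next
  case (Cons j js)
  then obtain p' where p': "partial_derivs js (poly_sum n p) = poly_sum n p'" by auto
  have "partial_derivs (j # js) (poly_sum n p) = partial_deriv j (poly_sum n p')"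
    using p' by (simp add: partial_derivs_def)
  also have "\<dots> = poly_sum n (\<lambda>i. if i = j then pderiv (p' j) else 0)"
    unfolding partial_deriv_def using Cons.prems
    by (intro ext DERIV_imp_deriv poly_sum_has_derivative) auto
  finally show ?case by blast
qed

lemma poly_growth: "\<exists>C\<ge>0. \<exists>N. \<forall>y. \<bar>poly p y\<bar> \<le> C * (1 + \<bar>y\<bar>) ^ N" for p :: "real poly"
proof (induction p)
  case 0 show ?case by (intro exI[of _ 0]) simp
next
  case (pCons a p)
  then obtain C N where C: "C \<ge> 0" "\<And>y. \<bar>poly p y\<bar> \<le> C * (1 + \<bar>y\<bar>) ^ N" by blast
  have "\<bar>poly (pCons a p) y\<bar> \<le> (\<bar>a\<bar> + C) * (1 + \<bar>y\<bar>) ^ Suc N" for y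
  proof -
    have "\<bar>poly (pCons a p) y\<bar> \<le> \<bar>a\<bar> + \<bar>y\<bar> * \<bar>poly p y\<bar>"
      using abs_triangle_ineq[of a "y * poly p y"] by (simp add: abs_mult)
    also have "\<dots> \<le> \<bar>a\<bar> * (1 + \<bar>y\<bar>) ^ Suc N + (1 + \<bar>y\<bar>) * (C * (1 + \<bar>y\<bar>) ^ N)"
    proof (intro add_mono mult_mono C)
      have "1 \<le> (1 + \<bar>y\<bar>) ^ Suc N" by (rule one_le_power) simp
      then show "\<bar>a\<bar> \<le> \<bar>a\<bar> * (1 + \<bar>y\<bar>) ^ Suc N"
        using mult_left_mono[of 1 "(1 + \<bar>y\<bar>) ^ Suc N" "\<bar>a\<bar>"] by simp
    qed auto
    finally show ?thesis by (simp add: algebra_simps)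
  qed
  then show ?case using C(1) by (intro exI[of _ "\<bar>a\<bar> + C"]) (auto intro!: exI[of _ "Suc N"])
qed

lemma poly_sum_growth:
  "\<exists>C N. \<forall>x. \<bar>poly_sum n p x\<bar> \<le> C * (1 + L2_set x {..<n}) ^ N"
proof -
  obtain C N where C: "\<And>i. C i \<ge> 0" "\<And>i y. \<bar>poly (p i) y\<bar> \<le> C i * (1 + \<bar>y\<bar>) ^ N i"
    using poly_growth[of "p _"] by metis
  define K where "K = (\<Sum>i<n. N i)"
  have "\<bar>poly_sum n p x\<bar> \<le> (\<Sum>i<n. C i) * (1 + L2_set x {..<n}) ^ K" for x
  proof -
    have "\<bar>poly_sum n p x\<bar> \<le> (\<Sum>i<n. \<bar>poly (p i) (x i)\<bar>)" unfolding poly_sum_def by (rule sum_abs)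
    also have "\<dots> \<le> (\<Sum>i<n. C i * (1 + L2_set x {..<n}) ^ K)"
    proof (intro sum_mono)
      fix i assume i: "i \<in> {..<n}"
      have "\<bar>x i\<bar> = L2_set x {i}" by (simp add: L2_set_def)
      also have "\<dots> \<le> L2_set x {..<n}" unfolding L2_set_def
        using i by (intro real_sqrt_le_mono sum_mono2) auto
      finally have xi: "\<bar>x i\<bar> \<le> L2_set x {..<n}" .
      have "N i \<le> K" unfolding K_def using i by (intro member_le_sum) auto
      have "(1 + \<bar>x i\<bar>) ^ N i \<le> (1 + L2_set x {..<n}) ^ N i" using xi by (intro power_mono) auto
      also have "\<dots> \<le> (1 + L2_set x {..<n}) ^ K" using \<open>N i \<le> K\<close> by (intro power_increasing) auto
      finally show "\<bar>poly (p i) (x i)\<bar> \<le> C i * (1 + L2_set x {..<n}) ^ K"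
        using C(2)[of i "x i"] C(1)[of i] mult_left_mono by fastforce
    qed
    finally show ?thesis by (simp add: sum_distrib_right)
  qed
  then show ?thesis by blast
qed

lemma smooth_poly_sum: "smooth_poly_growth n (poly_sum n p)"
  unfolding smooth_poly_growth_def
proof (intro allI impI)
  fix is' :: "nat list" assume "set is' \<subseteq> {..<n}"
  then obtain p' where p': "partial_derivs is' (poly_sum n p) = poly_sum n p'"
    using partial_derivs_poly_sum by blast
  have "continuous_map (Euclidean_space n) euclideanreal (poly_sum n p')"
    unfolding Euclidean_space_def poly_sum_def[abs_def]
    by (intro continuous_map_from_subtopology) (auto intro!: continuous_intros continuous_on_product_coordinates simp: euclidean_product_topology)
  moreover have "(\<lambda>t. poly_sum n p' (x(i := t))) differentiable (at (x i))" if "i < n" for i x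
    using poly_sum_has_derivative[OF that] real_differentiable_def by blast
  ultimately show "continuous_map (Euclidean_space n) euclideanreal (partial_derivs is' (poly_sum n p)) \<and>
    (\<forall>i<n. \<forall>x \<in> topspace (Euclidean_space n).
       (\<lambda>t. partial_derivs is' (poly_sum n p) (x(i := t))) differentiable (at (x i))) \<and>
    (\<exists>C N. \<forall>x \<in> topspace (Euclidean_space n).
       \<bar>partial_derivs is' (poly_sum n p) x\<bar> \<le> C * (1 + L2_set x {..<n}) ^ N)"
    using poly_sum_growth[of n p'] unfolding p' by blast
qed

text \<open>The index range is one longer than \<open>J\<close>, with the zero polynomial at the end, since a smooth
  random variable must depend on at least one variable.\<close>

lemma smooth_rv_deriv_poly:
  assumes "finite J"
  shows "smooth_rv_deriv X (\<lambda>\<omega>. \<Sum>j\<in>J. poly (p j) (X (\<phi> j) \<omega>))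
     (\<lambda>\<omega>. \<Sum>j\<in>J. poly (pderiv (p j)) (X (\<phi> j) \<omega>) *\<^sub>R \<phi> j)"
proof -
  define c where "c = card J"
  obtain e where e: "bij_betw e {..<c} J"
    using ex_bij_betw_nat_finite[OF assms] by (auto simp: c_def atLeast0LessThan)
  define r where "r = (\<lambda>i. if i < c then p (e i) else 0)"
  define \<theta> where "\<theta> = (\<lambda>i. if i < c then \<phi> (e i) else 0)"
  note reindex = sum.reindex_bij_betw[OF e, symmetric]
  have coord: "coord_vec X (Suc c) \<theta> \<omega> i = X (\<theta> i) \<omega>" if "i < Suc c" for \<omega> i using that by (simp add: coord_vec_def)
  have coord': "coord_vec X (Suc c) \<theta> \<omega> i = X (\<phi> (e i)) \<omega>" if "i < c" for \<omega> i using that by (simp add: coord_vec_def \<theta>_def)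
  have "(\<Sum>j\<in>J. poly (p j) (X (\<phi> j) \<omega>)) = poly_sum (Suc c) r (coord_vec X (Suc c) \<theta> \<omega>)" for \<omega>
    unfolding poly_sum_def reindex sum.lessThan_Suc by (simp add: coord' r_def)
  moreover have "(\<Sum>j\<in>J. poly (pderiv (p j)) (X (\<phi> j) \<omega>) *\<^sub>R \<phi> j)
      = (\<Sum>i<Suc c. partial_deriv i (poly_sum (Suc c) r) (coord_vec X (Suc c) \<theta> \<omega>) *\<^sub>R \<theta> i)" for \<omega>
  proof -
    have pd: "partial_deriv i (poly_sum (Suc c) r) x = poly (pderiv (r i)) (x i)" if "i < Suc c" for i x
    proof -
      have "partial_deriv i (poly_sum (Suc c) r) x = poly_sum (Suc c) (\<lambda>k. if k = i then pderiv (r i) else 0) x"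
        unfolding partial_deriv_def by (intro DERIV_imp_deriv poly_sum_has_derivative that)
      also have "\<dots> = (\<Sum>k<Suc c. if k = i then poly (pderiv (r i)) (x i) else 0)"
        unfolding poly_sum_def by (intro sum.cong) auto
      also have "\<dots> = poly (pderiv (r i)) (x i)" using that by (subst sum.delta) auto
      finally show ?thesis .
    qed
    have "(\<Sum>i<Suc c. partial_deriv i (poly_sum (Suc c) r) (coord_vec X (Suc c) \<theta> \<omega>) *\<^sub>R \<theta> i)
      = (\<Sum>i<Suc c. poly (pderiv (r i)) (X (\<theta> i) \<omega>) *\<^sub>R \<theta> i)"
      by (intro sum.cong) (auto simp: pd coord)
    then show ?thesis unfolding reindex sum.lessThan_Suc by (simp add: r_def \<theta>_def)
  qed
  ultimately show ?thesis unfolding smooth_rv_deriv_def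
    by (intro exI[of _ "Suc c"] conjI exI[of _ "poly_sum (Suc c) r"] exI[of _ \<theta>] smooth_poly_sum) auto
qed

section \<open>Orthogonal families in \<open>L\<^sup>2\<close>\<close>

lemma l2norm_orthogonal_sum:
  fixes W :: "'i \<Rightarrow> 'a \<Rightarrow> 'b::{real_inner, banach, second_countable_topology}"
  assumes "finite I" and "\<And>i. i \<in> I \<Longrightarrow> W i \<in> Lp_fun M 2"
    and "\<And>i j. i \<in> I \<Longrightarrow> j \<in> I \<Longrightarrow> i \<noteq> j \<Longrightarrow> (LINT \<omega>|M. W i \<omega> \<bullet> W j \<omega>) = 0"
  shows "(l2norm M (\<lambda>\<omega>. \<Sum>i\<in>I. W i \<omega>))\<^sup>2 = (\<Sum>i\<in>I. (l2norm M (W i))\<^sup>2)"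
proof -
  have "(norm (\<Sum>i\<in>I. W i \<omega>))\<^sup>2 = (\<Sum>i\<in>I. \<Sum>j\<in>I. W i \<omega> \<bullet> W j \<omega>)" for \<omega>
    by (simp add: power2_norm_eq_inner inner_sum_left inner_sum_right) (rule sum.swap)
  then have "(l2norm M (\<lambda>\<omega>. \<Sum>i\<in>I. W i \<omega>))\<^sup>2 = (\<Sum>i\<in>I. \<Sum>j\<in>I. LINT \<omega>|M. W i \<omega> \<bullet> W j \<omega>)"
    unfolding l2norm_sq by (simp add: assms L2_inner_integrable)
  also have "\<dots> = (\<Sum>i\<in>I. \<Sum>j\<in>I. if j = i then (l2norm M (W i))\<^sup>2 else 0)"
    by (intro sum.cong) (auto simp: assms l2norm_sq power2_norm_eq_inner)
  also have "\<dots> = (\<Sum>i\<in>I. (l2norm M (W i))\<^sup>2)"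
    using assms(1) by (intro sum.cong) (auto simp: sum.delta')
  finally show ?thesis .
qed

lemma l2norm_sum_le:
  fixes W :: "'i \<Rightarrow> 'a \<Rightarrow> 'b::{real_inner, banach, second_countable_topology}"
  assumes "\<And>i. i \<in> I \<Longrightarrow> W i \<in> Lp_fun M 2"
  shows "l2norm M (\<lambda>\<omega>. \<Sum>i\<in>I. W i \<omega>) \<le> (\<Sum>i\<in>I. l2norm M (W i))"
  using assms
proof (induction I rule: infinite_finite_induct)
  case (insert i I)
  then show ?case
    using l2norm_triangle[of "W i" M "\<lambda>\<omega>. \<Sum>i\<in>I. W i \<omega>"] L2_sum[of I W M] by force
qed (simp_all add: l2norm_def)

lemma (in prob_space) L2_orthogonal_series:
  fixes W :: "nat \<Rightarrow> 'a \<Rightarrow> 'b::{real_inner, banach, second_countable_topology}"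
  assumes W: "\<And>i. W i \<in> Lp_fun M 2"
    and orth: "\<And>i j. i \<noteq> j \<Longrightarrow> (LINT \<omega>|M. W i \<omega> \<bullet> W j \<omega>) = 0"
    and summable: "summable (\<lambda>i. (l2norm M (W i))\<^sup>2)"
  shows "\<exists>S\<in>Lp_fun M 2. (\<lambda>N. l2norm M (\<lambda>\<omega>. (\<Sum>i<N. W i \<omega>) - S \<omega>)) \<longlonglongrightarrow> 0"
proof (rule L2_complete)
  show "(\<lambda>\<omega>. \<Sum>i<N. W i \<omega>) \<in> Lp_fun M 2" for N by (rule L2_sum[OF W])
  fix e :: real assume e: "e > 0"
  obtain N where N: "\<And>m n. m \<ge> N \<Longrightarrow> norm (\<Sum>i\<in>{m..<n}. (l2norm M (W i))\<^sup>2) < e\<^sup>2"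
    using summable e unfolding summable_Cauchy by (meson zero_less_power)
  have *: "l2norm M (\<lambda>\<omega>. (\<Sum>i<n. W i \<omega>) - (\<Sum>i<m. W i \<omega>)) < e" if "N \<le> m" "m \<le> n" for m n
  proof (rule power2_less_imp_less)
    have "(\<Sum>i<n. W i \<omega>) - (\<Sum>i<m. W i \<omega>) = (\<Sum>i\<in>{m..<n}. W i \<omega>)" for \<omega>
      using that(2) by (simp add: lessThan_atLeast0 sum_diff_nat_ivl)
    then have "(l2norm M (\<lambda>\<omega>. (\<Sum>i<n. W i \<omega>) - (\<Sum>i<m. W i \<omega>)))\<^sup>2 = (\<Sum>i\<in>{m..<n}. (l2norm M (W i))\<^sup>2)"
      using l2norm_orthogonal_sum[of "{m..<n}" W M] W orth by simp
    then show "(l2norm M (\<lambda>\<omega>. (\<Sum>i<n. W i \<omega>) - (\<Sum>i<m. W i \<omega>)))\<^sup>2 < e\<^sup>2"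
      using N[OF that(1), of n] by simp
  qed (use e in simp)
  have "l2norm M (\<lambda>\<omega>. (\<Sum>i<m. W i \<omega>) - (\<Sum>i<n. W i \<omega>)) < e" if "m \<ge> N" "n \<ge> N" for m n
  proof (cases "m \<le> n")
    case True
    then show ?thesis using *[of m n] that l2norm_commute[of M "\<lambda>\<omega>. \<Sum>i<m. W i \<omega>" "\<lambda>\<omega>. \<Sum>i<n. W i \<omega>"] by simp
  next
    case False then show ?thesis using *[of n m] that by simp
  qed
  then show "\<exists>N. \<forall>m\<ge>N. \<forall>n\<ge>N. l2norm M (\<lambda>\<omega>. (\<Sum>i<m. W i \<omega>) - (\<Sum>i<n. W i \<omega>)) < e" by blast
qed

section \<open>Wiener chaos\<close>

context isonormal_process
begin

lemma has_malliavin_deriv_L2_iff: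
  "has_malliavin_deriv M X 2 F U \<longleftrightarrow> F \<in> Lp_fun M 2 \<and> U \<in> Lp_fun M 2 \<and>
    (\<exists>Fs Us. (\<forall>n. smooth_rv_deriv X (Fs n) (Us n)) \<and>
      (\<lambda>n. l2norm M (\<lambda>\<omega>. Fs n \<omega> - F \<omega>)) \<longlonglongrightarrow> 0 \<and> (\<lambda>n. l2norm M (\<lambda>\<omega>. Us n \<omega> - U \<omega>)) \<longlonglongrightarrow> 0)"
proof -
  have "(\<lambda>n. (LINT \<omega>|M. \<bar>Fs n \<omega> - F \<omega>\<bar> powr 2) + (LINT \<omega>|M. norm (Us n \<omega> - U \<omega>) powr 2)) \<longlonglongrightarrow> 0
    \<longleftrightarrow> (\<lambda>n. l2norm M (\<lambda>\<omega>. Fs n \<omega> - F \<omega>)) \<longlonglongrightarrow> 0 \<and> (\<lambda>n. l2norm M (\<lambda>\<omega>. Us n \<omega> - U \<omega>)) \<longlonglongrightarrow> 0"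
    (is "?A \<longlonglongrightarrow> 0 \<longleftrightarrow> ?B \<longlonglongrightarrow> 0 \<and> ?C \<longlonglongrightarrow> 0") for Fs and Us :: "nat \<Rightarrow> 'a \<Rightarrow> 'h"
  proof -
    have A: "?A = (\<lambda>n. (?B n)\<^sup>2 + (?C n)\<^sup>2)" by (simp add: l2norm_sq)
    show ?thesis
    proof
      assume lim: "?A \<longlonglongrightarrow> 0"
      have sq: "(\<lambda>n. sqrt (?A n)) \<longlonglongrightarrow> 0" using tendsto_real_sqrt[OF lim] by simp
      have "norm (?B n) \<le> sqrt (?A n)" "norm (?C n) \<le> sqrt (?A n)" for n
        using fun_cong[OF A, of n] by (auto intro!: real_le_rsqrt)
      then show "?B \<longlonglongrightarrow> 0 \<and> ?C \<longlonglongrightarrow> 0"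
        by (intro conjI) (rule Lim_null_comparison[OF _ sq], simp)+
    next
      assume lim: "?B \<longlonglongrightarrow> 0 \<and> ?C \<longlonglongrightarrow> 0"
      have "(\<lambda>n. (?B n)\<^sup>2 + (?C n)\<^sup>2) \<longlonglongrightarrow> 0\<^sup>2 + 0\<^sup>2" using lim by (intro tendsto_intros) auto
      then show "?A \<longlonglongrightarrow> 0" unfolding A by simp
    qed
  qed
  then show ?thesis unfolding has_malliavin_deriv_def by simp
qed

text \<open>\<open>U\<close> is the Malliavin derivative of \<open>Z\<close>. At \<open>q = 0\<close> the truncated index \<open>q - 1\<close> comes with the
  factor zero.\<close>

definition chaos_poly :: "nat \<Rightarrow> ('a \<Rightarrow> real) \<Rightarrow> ('a \<Rightarrow> 'h) \<Rightarrow> bool"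
  where "chaos_poly q Z U \<longleftrightarrow> (\<exists>I c. finite I \<and> (\<forall>h\<in>I. norm h = 1) \<and>
     Z = (\<lambda>\<omega>. \<Sum>h\<in>I. c h * hermite q (X h \<omega>)) \<and>
     U = (\<lambda>\<omega>. \<Sum>h\<in>I. (c h * (real q * hermite (q - 1) (X h \<omega>))) *\<^sub>R h))"

lemma chaos_poly_zero: "chaos_poly q (\<lambda>_. 0) (\<lambda>_. 0)"
  unfolding chaos_poly_def by (intro exI[of _ "{}"]) auto

lemma chaos_poly_hermite: "norm h = 1 \<Longrightarrow> \<exists>U. chaos_poly q (\<lambda>\<omega>. hermite q (X h \<omega>)) U"
  unfolding chaos_poly_def by (intro exI exI[of _ "{h}"] exI[of _ "\<lambda>_. 1"]) auto

lemma chaos_poly_lin: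
  assumes "chaos_poly q Z U" "chaos_poly q Z' U'"
  shows "chaos_poly q (\<lambda>\<omega>. a * Z \<omega> + b * Z' \<omega>) (\<lambda>\<omega>. a *\<^sub>R U \<omega> + b *\<^sub>R U' \<omega>)"
proof -
  obtain I c I' c' where *: "finite I" "\<forall>h\<in>I. norm h = 1" "finite I'" "\<forall>h\<in>I'. norm h = 1"
    and Z: "Z = (\<lambda>\<omega>. \<Sum>h\<in>I. c h * hermite q (X h \<omega>))"
    and U: "U = (\<lambda>\<omega>. \<Sum>h\<in>I. (c h * (real q * hermite (q - 1) (X h \<omega>))) *\<^sub>R h)"
    and Z': "Z' = (\<lambda>\<omega>. \<Sum>h\<in>I'. c' h * hermite q (X h \<omega>))"
    and U': "U' = (\<lambda>\<omega>. \<Sum>h\<in>I'. (c' h * (real q * hermite (q - 1) (X h \<omega>))) *\<^sub>R h)"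
    using assms unfolding chaos_poly_def by blast
  define d where "d = (\<lambda>h. a * (if h \<in> I then c h else 0) + b * (if h \<in> I' then c' h else 0))"
  have split: "(\<Sum>h\<in>I \<union> I'. (if h \<in> I then f h else 0)) = sum f I"
    "(\<Sum>h\<in>I \<union> I'. (if h \<in> I' then f h else 0)) = sum f I'" for f :: "'h \<Rightarrow> 'c::comm_monoid_add"
    by (rule sum.mono_neutral_cong_right; use * in auto)+
  have "(\<Sum>h\<in>I \<union> I'. d h * f h) = a * (\<Sum>h\<in>I. c h * f h) + b * (\<Sum>h\<in>I'. c' h * f h)" for f
    unfolding split(1)[symmetric, of "\<lambda>h. c h * f h"] split(2)[symmetric, of "\<lambda>h. c' h * f h"]
    unfolding sum_distrib_left sum.distrib[symmetric]
    by (intro sum.cong) (auto simp: d_def algebra_simps)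
  moreover have "(\<Sum>h\<in>I \<union> I'. (d h * f h) *\<^sub>R h) = a *\<^sub>R (\<Sum>h\<in>I. (c h * f h) *\<^sub>R h) + b *\<^sub>R (\<Sum>h\<in>I'. (c' h * f h) *\<^sub>R h)" for f
    unfolding split(1)[symmetric, of "\<lambda>h. (c h * f h) *\<^sub>R h"] split(2)[symmetric, of "\<lambda>h. (c' h * f h) *\<^sub>R h"]
    unfolding scaleR_sum_right sum.distrib[symmetric]
    by (intro sum.cong) (auto simp: d_def algebra_simps)
  ultimately show ?thesis unfolding chaos_poly_def Z U Z' U' using *
    by (intro exI[of _ "I \<union> I'"] exI[of _ d]) auto
qed

lemma chaos_poly_sum_smooth:
  assumes "\<And>q. q \<in> {1..N} \<Longrightarrow> chaos_poly q (Z q) (U q)"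
  shows "smooth_rv_deriv X (\<lambda>\<omega>. \<Sum>q=1..N. a q * Z q \<omega>) (\<lambda>\<omega>. \<Sum>q=1..N. a q *\<^sub>R U q \<omega>)"
proof -
  have "\<forall>q\<in>{1..N}. \<exists>I c. finite I \<and> (\<forall>h\<in>I. norm h = 1) \<and>
     Z q = (\<lambda>\<omega>. \<Sum>h\<in>I. c h * hermite q (X h \<omega>)) \<and>
     U q = (\<lambda>\<omega>. \<Sum>h\<in>I. (c h * (real q * hermite (q - 1) (X h \<omega>))) *\<^sub>R h)"
    using assms unfolding chaos_poly_def by blast
  from bchoice[OF this] obtain I where "\<forall>q\<in>{1..N}. \<exists>c. finite (I q) \<and> (\<forall>h\<in>I q. norm h = 1) \<and>
     Z q = (\<lambda>\<omega>. \<Sum>h\<in>I q. c h * hermite q (X h \<omega>)) \<and>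
     U q = (\<lambda>\<omega>. \<Sum>h\<in>I q. (c h * (real q * hermite (q - 1) (X h \<omega>))) *\<^sub>R h)" by blast
  from bchoice[OF this] obtain c where *: "\<And>q. q \<in> {1..N} \<Longrightarrow> finite (I q)"
    "\<And>q. q \<in> {1..N} \<Longrightarrow> Z q = (\<lambda>\<omega>. \<Sum>h\<in>I q. c q h * hermite q (X h \<omega>))"
    "\<And>q. q \<in> {1..N} \<Longrightarrow> U q = (\<lambda>\<omega>. \<Sum>h\<in>I q. (c q h * (real q * hermite (q - 1) (X h \<omega>))) *\<^sub>R h)"
    by blast
  define p where "p = (\<lambda>(q, h). smult (a q * c q h) (hermite_poly q))"
  let ?J = "Sigma {1..N} I"
  have fin: "finite ?J" using *(1) by auto
  have pd: "pderiv (p (q, h)) = smult (a q * c q h * real q) (hermite_poly (q - 1))" if "q \<in> {1..N}" for q h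
    using that pderiv_hermite_poly[of "q - 1"] by (simp add: p_def pderiv_smult)
  have "(\<Sum>q=1..N. a q * Z q \<omega>) = (\<Sum>j\<in>?J. poly (p j) (X (snd j) \<omega>))" for \<omega>
  proof -
    have "(\<Sum>q=1..N. a q * Z q \<omega>) = (\<Sum>q=1..N. \<Sum>h\<in>I q. poly (p (q, h)) (X h \<omega>))"
      by (intro sum.cong) (auto simp: *(2) p_def hermite_eq_poly sum_distrib_left mult.assoc)
    also have "\<dots> = (\<Sum>(q, h)\<in>?J. poly (p (q, h)) (X h \<omega>))"
      by (rule sum.Sigma) (use *(1) in auto)
    finally show ?thesis by (simp add: case_prod_beta)
  qed
  moreover have "(\<Sum>q=1..N. a q *\<^sub>R U q \<omega>) = (\<Sum>j\<in>?J. poly (pderiv (p j)) (X (snd j) \<omega>) *\<^sub>R snd j)" for \<omega>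
  proof -
    have "(\<Sum>q=1..N. a q *\<^sub>R U q \<omega>) = (\<Sum>q=1..N. \<Sum>h\<in>I q. poly (pderiv (p (q, h))) (X h \<omega>) *\<^sub>R h)"
      by (intro sum.cong refl) (simp add: *(3) pd hermite_eq_poly scaleR_sum_right mult.assoc)
    also have "\<dots> = (\<Sum>(q, h)\<in>?J. poly (pderiv (p (q, h))) (X h \<omega>) *\<^sub>R h)"
      by (rule sum.Sigma) (use *(1) in auto)
    finally show ?thesis by (simp add: case_prod_beta)
  qed
  ultimately show ?thesis using smooth_rv_deriv_poly[OF fin, of X p snd] by simp
qed

lemma chaos_poly_cyl: "chaos_poly q Z U \<Longrightarrow> q \<ge> 1 \<Longrightarrow> cyl Z U"
proof -
  assume *: "chaos_poly q Z U" "q \<ge> 1"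
  have "smooth_rv_deriv X (\<lambda>\<omega>. \<Sum>p=1..q. (if p = q then 1 else 0) * (if p = q then Z else (\<lambda>_. 0)) \<omega>)
    (\<lambda>\<omega>. \<Sum>p=1..q. (if p = q then 1 else 0) *\<^sub>R (if p = q then U else (\<lambda>_. 0)) \<omega>)"
    by (rule chaos_poly_sum_smooth) (use * chaos_poly_zero in auto)
  also have "(\<lambda>\<omega>. \<Sum>p=1..q. (if p = q then 1 else 0) * (if p = q then Z else (\<lambda>_. 0)) \<omega>) = Z"
  proof
    fix \<omega>
    have "(\<Sum>p=1..q. (if p = q then 1 else 0) * (if p = q then Z else (\<lambda>_. 0)) \<omega>) = (\<Sum>p=1..q. if p = q then Z \<omega> else 0)"
      by (intro sum.cong) auto
    then show "(\<Sum>p=1..q. (if p = q then 1 else 0) * (if p = q then Z else (\<lambda>_. 0)) \<omega>) = Z \<omega>" using *(2) by simp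
  qed
  also have "(\<lambda>\<omega>. \<Sum>p=1..q. (if p = q then 1 else 0) *\<^sub>R (if p = q then U else (\<lambda>_. 0)) \<omega>) = U"
  proof
    fix \<omega>
    have "(\<Sum>p=1..q. (if p = q then 1 else 0) *\<^sub>R (if p = q then U else (\<lambda>_. 0)) \<omega>) = (\<Sum>p=1..q. if p = q then U \<omega> else 0)"
      by (intro sum.cong) auto
    then show "(\<Sum>p=1..q. (if p = q then 1 else 0) *\<^sub>R (if p = q then U else (\<lambda>_. 0)) \<omega>) = U \<omega>" using *(2) by simp
  qed
  finally show "cyl Z U" by (rule smooth_rv_deriv_cyl)
qed

text \<open>Derivatives of variables in the \<open>q\<close>th chaos are dual to multiplication: each
  \<open>D H\<^sub>q(X h) = q H\<^sub>q\<^sub>-\<^sub>1(X h) h\<close> is integrated by parts in the direction \<open>h\<close>.\<close>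

lemma cyl_inner_chaos_poly:
  assumes cyl: "cyl \<Phi> D" and Z: "chaos_poly q Z U" and q: "q \<ge> 1"
  shows "(LINT \<omega>|M. D \<omega> \<bullet> U \<omega>) = real q * (LINT \<omega>|M. \<Phi> \<omega> * Z \<omega>)"
proof -
  obtain I c where *: "finite I" "\<forall>h\<in>I. norm h = 1"
    and Z: "Z = (\<lambda>\<omega>. \<Sum>h\<in>I. c h * hermite q (X h \<omega>))"
    and U: "U = (\<lambda>\<omega>. \<Sum>h\<in>I. (c h * (real q * hermite (q - 1) (X h \<omega>))) *\<^sub>R h)"
    using Z unfolding chaos_poly_def by blast
  have [measurable]: "D \<in> borel_measurable M" using cyl_deriv_L2[OF cyl] by (simp add: L2_iff)
  have Dh: "(\<lambda>\<omega>. D \<omega> \<bullet> h) \<in> Lp_fun M 2" for h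
  proof (rule L2_bound)
    show "(\<lambda>\<omega>. norm h *\<^sub>R D \<omega>) \<in> Lp_fun M 2" by (rule L2_scaleR[OF cyl_deriv_L2[OF cyl]])
    show "norm (D \<omega> \<bullet> h) \<le> norm (norm h *\<^sub>R D \<omega>)" for \<omega>
      using Cauchy_Schwarz_ineq2[of "D \<omega>" h] by (simp add: mult.commute)
  qed measurable
  have "(LINT \<omega>|M. D \<omega> \<bullet> U \<omega>) = (LINT \<omega>|M. (\<Sum>h\<in>I. c h * real q * ((D \<omega> \<bullet> h) * hermite (q - 1) (X h \<omega>))))"
    unfolding U by (simp add: inner_sum_right mult_ac)
  also have "\<dots> = (\<Sum>h\<in>I. c h * real q * (LINT \<omega>|M. (D \<omega> \<bullet> h) * hermite (q - 1) (X h \<omega>)))"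
    by (simp add: L2_mult_integrable[OF Dh hermite_X_L2])
  also have "\<dots> = (\<Sum>h\<in>I. c h * real q * (LINT \<omega>|M. \<Phi> \<omega> * hermite q (X h \<omega>)))"
    using cyl_ibp[OF cyl, of _ "q - 1"] q *(2) by (intro sum.cong) auto
  also have "\<dots> = real q * (\<Sum>h\<in>I. c h * (LINT \<omega>|M. \<Phi> \<omega> * hermite q (X h \<omega>)))"
    by (simp add: sum_distrib_left mult_ac)
  also have "(\<Sum>h\<in>I. c h * (LINT \<omega>|M. \<Phi> \<omega> * hermite q (X h \<omega>)))
      = (LINT \<omega>|M. (\<Sum>h\<in>I. c h * (\<Phi> \<omega> * hermite q (X h \<omega>))))"
    by (simp add: L2_mult_integrable[OF cyl_L2[OF cyl] hermite_X_L2])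
  also have "\<dots> = (LINT \<omega>|M. \<Phi> \<omega> * Z \<omega>)" unfolding Z by (simp add: sum_distrib_left mult_ac)
  finally show ?thesis .
qed

lemma chaos_poly_L2: "chaos_poly q Z U \<Longrightarrow> q \<ge> 1 \<Longrightarrow> Z \<in> Lp_fun M 2"
  by (rule cyl_L2[OF chaos_poly_cyl])

lemma chaos_poly_deriv_L2: "chaos_poly q Z U \<Longrightarrow> q \<ge> 1 \<Longrightarrow> U \<in> Lp_fun M 2"
  by (rule cyl_deriv_L2[OF chaos_poly_cyl])

text \<open>The inner product of the derivatives is both \<open>q\<close> and \<open>q'\<close> times that of the variables.\<close>

lemma chaos_poly_orthogonal:
  assumes Z: "chaos_poly q Z U" "chaos_poly q' Z' U'" and "q \<ge> 1" "q' \<ge> 1" "q \<noteq> q'"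
  shows "(LINT \<omega>|M. Z \<omega> * Z' \<omega>) = 0" "(LINT \<omega>|M. U \<omega> \<bullet> U' \<omega>) = 0"
proof -
  have "(LINT \<omega>|M. U \<omega> \<bullet> U' \<omega>) = real q' * (LINT \<omega>|M. Z \<omega> * Z' \<omega>)"
    by (rule cyl_inner_chaos_poly[OF chaos_poly_cyl[OF Z(1)] Z(2)]) (use assms in auto)
  moreover have "(LINT \<omega>|M. U' \<omega> \<bullet> U \<omega>) = real q * (LINT \<omega>|M. Z' \<omega> * Z \<omega>)"
    by (rule cyl_inner_chaos_poly[OF chaos_poly_cyl[OF Z(2)] Z(1)]) (use assms in auto)
  ultimately have "(real q - real q') * (LINT \<omega>|M. Z \<omega> * Z' \<omega>) = 0"
    by (auto simp: inner_commute mult.commute left_diff_distrib)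
  with \<open>q \<noteq> q'\<close> show "(LINT \<omega>|M. Z \<omega> * Z' \<omega>) = 0" by auto
  then show "(LINT \<omega>|M. U \<omega> \<bullet> U' \<omega>) = 0"
    using \<open>(LINT \<omega>|M. U \<omega> \<bullet> U' \<omega>) = real q' * (LINT \<omega>|M. Z \<omega> * Z' \<omega>)\<close> by simp
qed

lemma chaos_poly_mean:
  assumes "chaos_poly q Z U" "q \<ge> 1"
  shows "(LINT \<omega>|M. Z \<omega>) = 0"
  using cyl_inner_chaos_poly[OF cyl_poly_X[of 1 0] assms] assms(2) by simp

lemma chaos_poly_deriv_norm:
  assumes "chaos_poly q Z U" "q \<ge> 1"
  shows "(l2norm M U)\<^sup>2 = real q * (l2norm M Z)\<^sup>2"
  using cyl_inner_chaos_poly[OF chaos_poly_cyl[OF assms] assms]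
  unfolding l2norm_sq power2_norm_eq_inner by simp

lemma chaos_eq_closure:
  assumes "q \<ge> 1"
  shows "G \<in> wiener_chaos M X q \<longleftrightarrow> G \<in> Lp_fun M 2 \<and>
     (\<forall>e>0. \<exists>Z U. chaos_poly q Z U \<and> l2norm M (\<lambda>\<omega>. G \<omega> - Z \<omega>) < e)"
proof -
  have "(\<forall>\<epsilon>>0. \<exists>I c. finite I \<and> (\<forall>h\<in>I. norm h = 1) \<and>
             (LINT \<omega>|M. (G \<omega> - (\<Sum>h\<in>I. c h * hermite q (X h \<omega>)))\<^sup>2) < \<epsilon>)
     \<longleftrightarrow> (\<forall>\<epsilon>>0. \<exists>Z U. chaos_poly q Z U \<and> (l2norm M (\<lambda>\<omega>. G \<omega> - Z \<omega>))\<^sup>2 < \<epsilon>)"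
    unfolding chaos_poly_def l2norm_sq by simp blast
  also have "\<dots> \<longleftrightarrow> (\<forall>e>0. \<exists>Z U. chaos_poly q Z U \<and> l2norm M (\<lambda>\<omega>. G \<omega> - Z \<omega>) < e)"
  proof safe
    fix e :: real assume *: "\<forall>\<epsilon>>0. \<exists>Z U. chaos_poly q Z U \<and> (l2norm M (\<lambda>\<omega>. G \<omega> - Z \<omega>))\<^sup>2 < \<epsilon>" and "e > 0"
    then obtain Z U where "chaos_poly q Z U" "(l2norm M (\<lambda>\<omega>. G \<omega> - Z \<omega>))\<^sup>2 < e\<^sup>2" by (meson zero_less_power)
    then show "\<exists>Z U. chaos_poly q Z U \<and> l2norm M (\<lambda>\<omega>. G \<omega> - Z \<omega>) < e"
      using \<open>e > 0\<close> by (meson less_imp_le power2_less_imp_less)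
  next
    fix \<epsilon> :: real assume *: "\<forall>e>0. \<exists>Z U. chaos_poly q Z U \<and> l2norm M (\<lambda>\<omega>. G \<omega> - Z \<omega>) < e" and "\<epsilon> > 0"
    then obtain Z U where Z: "chaos_poly q Z U" "l2norm M (\<lambda>\<omega>. G \<omega> - Z \<omega>) < sqrt \<epsilon>" by (meson real_sqrt_gt_zero)
    then have "(l2norm M (\<lambda>\<omega>. G \<omega> - Z \<omega>))\<^sup>2 < (sqrt \<epsilon>)\<^sup>2" by (intro power_strict_mono) auto
    then show "\<exists>Z U. chaos_poly q Z U \<and> (l2norm M (\<lambda>\<omega>. G \<omega> - Z \<omega>))\<^sup>2 < \<epsilon>" using Z \<open>\<epsilon> > 0\<close> by auto
  qed
  finally show ?thesis using assms by (simp add: wiener_chaos_def)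
qed

lemma chaos_poly_in_chaos: "chaos_poly q Z U \<Longrightarrow> q \<ge> 1 \<Longrightarrow> Z \<in> wiener_chaos M X q"
  by (subst chaos_eq_closure) (auto intro!: chaos_poly_L2 exI[of _ Z] simp: l2norm_def)

lemma chaos_L2: "G \<in> wiener_chaos M X q \<Longrightarrow> G \<in> Lp_fun M 2"
  by (auto simp: wiener_chaos_def split: if_splits)

lemma chaos_approx:
  assumes "G \<in> wiener_chaos M X q" "q \<ge> 1"
  obtains Z U where "\<And>n. chaos_poly q (Z n) (U n)" "(\<lambda>n. l2norm M (\<lambda>\<omega>. Z n \<omega> - G \<omega>)) \<longlonglongrightarrow> 0"
proof -
  have "\<exists>Z U. chaos_poly q Z U \<and> l2norm M (\<lambda>\<omega>. G \<omega> - Z \<omega>) < 1 / real (Suc n)" for n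
    using assms unfolding chaos_eq_closure[OF assms(2)] by simp
  then obtain Z U where *: "\<And>n. chaos_poly q (Z n) (U n)" "\<And>n. l2norm M (\<lambda>\<omega>. G \<omega> - Z n \<omega>) < 1 / real (Suc n)"
    by metis
  have "(\<lambda>n. l2norm M (\<lambda>\<omega>. Z n \<omega> - G \<omega>)) \<longlonglongrightarrow> 0"
  proof (rule Lim_null_comparison)
    show "\<forall>\<^sub>F n in sequentially. norm (l2norm M (\<lambda>\<omega>. Z n \<omega> - G \<omega>)) \<le> 1 / real (Suc n)"
      using *(2) l2norm_commute[of M _ G] by (intro always_eventually) (auto intro!: less_imp_le)
  qed (rule LIMSEQ_Suc[OF lim_1_over_n])
  with * that show ?thesis by blast
qed

lemma chaos_orthogonal:
  assumes "G \<in> wiener_chaos M X q" "G' \<in> wiener_chaos M X q'" "q \<ge> 1" "q' \<ge> 1" "q \<noteq> q'"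
  shows "(LINT \<omega>|M. G \<omega> * G' \<omega>) = 0"
proof -
  obtain Z U where Z: "\<And>n. chaos_poly q (Z n) (U n)" "(\<lambda>n. l2norm M (\<lambda>\<omega>. Z n \<omega> - G \<omega>)) \<longlonglongrightarrow> 0"
    using chaos_approx assms by blast
  obtain Z' U' where Z': "\<And>n. chaos_poly q' (Z' n) (U' n)" "(\<lambda>n. l2norm M (\<lambda>\<omega>. Z' n \<omega> - G' \<omega>)) \<longlonglongrightarrow> 0"
    using chaos_approx assms by blast
  have L: "Z n \<in> Lp_fun M 2" "Z' n \<in> Lp_fun M 2" "G \<in> Lp_fun M 2" "G' \<in> Lp_fun M 2" for n
    using Z Z' assms chaos_poly_L2 chaos_L2 by blast+
  have 1: "(LINT \<omega>|M. G \<omega> * Z' m \<omega>) = 0" for m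
  proof -
    have "(\<lambda>n. LINT \<omega>|M. Z n \<omega> \<bullet> Z' m \<omega>) \<longlonglongrightarrow> (LINT \<omega>|M. G \<omega> \<bullet> Z' m \<omega>)"
      by (rule L2_inner_tendsto) (use L Z in auto)
    then show ?thesis using chaos_poly_orthogonal(1)[OF Z(1) Z'(1) assms(3-5)] by (simp add: LIMSEQ_const_iff)
  qed
  have "(\<lambda>n. LINT \<omega>|M. Z' n \<omega> \<bullet> G \<omega>) \<longlonglongrightarrow> (LINT \<omega>|M. G' \<omega> \<bullet> G \<omega>)"
    by (rule L2_inner_tendsto) (use L Z' in auto)
  then show ?thesis using 1 by (simp add: LIMSEQ_const_iff mult.commute)
qed

lemma chaos_mean:
  assumes "G \<in> wiener_chaos M X q" "q \<ge> 1"
  shows "(LINT \<omega>|M. G \<omega>) = 0"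
proof -
  obtain Z U where Z: "\<And>n. chaos_poly q (Z n) (U n)" "(\<lambda>n. l2norm M (\<lambda>\<omega>. Z n \<omega> - G \<omega>)) \<longlonglongrightarrow> 0"
    using chaos_approx assms by blast
  have "(\<lambda>n. LINT \<omega>|M. Z n \<omega> \<bullet> 1) \<longlonglongrightarrow> (LINT \<omega>|M. G \<omega> \<bullet> 1)"
    by (rule L2_inner_tendsto) (use Z assms chaos_poly_L2 chaos_L2 L2_const in blast)+
  then show ?thesis using chaos_poly_mean[OF Z(1) assms(2)] by (simp add: LIMSEQ_const_iff)
qed

lemma chaos_lin:
  assumes "f \<in> wiener_chaos M X q" "g \<in> wiener_chaos M X q" "q \<ge> 1"
  shows "(\<lambda>\<omega>. a * f \<omega> + b * g \<omega>) \<in> wiener_chaos M X q"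
proof -
  have L: "f \<in> Lp_fun M 2" "g \<in> Lp_fun M 2" using assms chaos_L2 by blast+
  have "\<exists>Z U. chaos_poly q Z U \<and> l2norm M (\<lambda>\<omega>. a * f \<omega> + b * g \<omega> - Z \<omega>) < e" if e: "e > 0" for e
  proof -
    define d where "d = e / (\<bar>a\<bar> + \<bar>b\<bar> + 1)"
    have d: "d > 0" "(\<bar>a\<bar> + \<bar>b\<bar>) * d < e" using e by (simp_all add: d_def field_simps)
    obtain Z U Z' U' where Z: "chaos_poly q Z U" "l2norm M (\<lambda>\<omega>. f \<omega> - Z \<omega>) < d"
      "chaos_poly q Z' U'" "l2norm M (\<lambda>\<omega>. g \<omega> - Z' \<omega>) < d"
      using assms d(1) unfolding chaos_eq_closure[OF assms(3)] by blast
    have ZL: "Z \<in> Lp_fun M 2" "Z' \<in> Lp_fun M 2" using Z chaos_poly_L2 assms(3) by blast+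
    have "l2norm M (\<lambda>\<omega>. a * f \<omega> + b * g \<omega> - (a * Z \<omega> + b * Z' \<omega>))
       = l2norm M (\<lambda>\<omega>. a *\<^sub>R (f \<omega> - Z \<omega>) + b *\<^sub>R (g \<omega> - Z' \<omega>))"
      by (simp add: algebra_simps)
    also have "\<dots> \<le> \<bar>a\<bar> * l2norm M (\<lambda>\<omega>. f \<omega> - Z \<omega>) + \<bar>b\<bar> * l2norm M (\<lambda>\<omega>. g \<omega> - Z' \<omega>)"
      unfolding l2norm_scaleR[symmetric] by (intro l2norm_triangle L2_scaleR L2_diff L ZL)
    also have "\<dots> \<le> \<bar>a\<bar> * d + \<bar>b\<bar> * d" using Z by (intro add_mono mult_left_mono) auto
    also have "\<dots> < e" using d(2) by (simp add: distrib_right)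
    finally show ?thesis using chaos_poly_lin[OF Z(1,3), of a b] by blast
  qed
  then show ?thesis unfolding chaos_eq_closure[OF assms(3)]
    using L by (auto intro!: L2_add L2_mult_const)
qed

lemma chaos_closed:
  assumes f: "f \<in> Lp_fun M 2" and q: "q \<ge> 1"
    and approx: "\<And>e. e > 0 \<Longrightarrow> \<exists>g\<in>wiener_chaos M X q. l2norm M (\<lambda>\<omega>. f \<omega> - g \<omega>) < e"
  shows "f \<in> wiener_chaos M X q"
  unfolding chaos_eq_closure[OF q]
proof (intro conjI f allI impI)
  fix e :: real assume "e > 0"
  then obtain g where g: "g \<in> wiener_chaos M X q" "l2norm M (\<lambda>\<omega>. f \<omega> - g \<omega>) < e / 2"
    using approx[of "e/2"] by auto
  then obtain Z U where Z: "chaos_poly q Z U" "l2norm M (\<lambda>\<omega>. g \<omega> - Z \<omega>) < e / 2"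
    unfolding chaos_eq_closure[OF q] using \<open>e > 0\<close> by (meson half_gt_zero)
  have "l2norm M (\<lambda>\<omega>. f \<omega> - Z \<omega>) \<le> l2norm M (\<lambda>\<omega>. f \<omega> - g \<omega>) + l2norm M (\<lambda>\<omega>. g \<omega> - Z \<omega>)"
    by (rule l2norm_diff_triangle[OF f chaos_L2[OF g(1)] chaos_poly_L2[OF Z(1) q]])
  then show "\<exists>Z U. chaos_poly q Z U \<and> l2norm M (\<lambda>\<omega>. f \<omega> - Z \<omega>) < e" using g Z by force
qed

text \<open>The choice in the definition of the projection is from a nonempty set, since each chaos
  is a closed subspace.\<close>

lemma chaos_proj:
  assumes G: "G \<in> Lp_fun M 2" and q: "q \<ge> 1"
  shows "chaos_proj M X q G \<in> wiener_chaos M X q"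
    and "W \<in> wiener_chaos M X q \<Longrightarrow> (LINT \<omega>|M. (G \<omega> - chaos_proj M X q G \<omega>) * W \<omega>) = 0"
proof -
  have "\<exists>Z\<in>wiener_chaos M X q. \<forall>W\<in>wiener_chaos M X q. (LINT \<omega>|M. (G \<omega> - Z \<omega>) * W \<omega>) = 0"
    by (rule L2_projection_exists[OF _ chaos_poly_in_chaos[OF chaos_poly_zero q] _ _ G])
      (auto intro: chaos_L2 chaos_lin[OF _ _ q] chaos_closed[OF _ q])
  then have "\<exists>Z. Z \<in> wiener_chaos M X q \<and> (\<forall>W\<in>wiener_chaos M X q. (LINT \<omega>|M. (G \<omega> - Z \<omega>) * W \<omega>) = 0)" by blast
  from someI_ex[OF this] show "chaos_proj M X q G \<in> wiener_chaos M X q"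
    and "W \<in> wiener_chaos M X q \<Longrightarrow> (LINT \<omega>|M. (G \<omega> - chaos_proj M X q G \<omega>) * W \<omega>) = 0"
    unfolding chaos_proj_def by auto
qed

lemma chaos_proj_L2: "G \<in> Lp_fun M 2 \<Longrightarrow> q \<ge> 1 \<Longrightarrow> chaos_proj M X q G \<in> Lp_fun M 2"
  by (rule chaos_L2[OF chaos_proj(1)])

text \<open>Bessel's inequality for the mutually orthogonal components.\<close>

lemma summable_chaos_proj:
  assumes G: "G \<in> Lp_fun M 2"
  shows "summable (\<lambda>i. (l2norm M (chaos_proj M X (Suc i) G))\<^sup>2)"
proof (rule summableI_nonneg_bounded)
  fix N
  let ?J = "\<lambda>i. chaos_proj M X (Suc i) G"
  have JL: "?J i \<in> Lp_fun M 2" for i by (rule chaos_proj_L2[OF G]) simp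
  have JC: "?J i \<in> wiener_chaos M X (Suc i)" for i by (rule chaos_proj(1)[OF G]) simp
  define S where "S = (\<lambda>\<omega>. \<Sum>i<N. ?J i \<omega>)"
  have SL: "S \<in> Lp_fun M 2" unfolding S_def by (intro L2_sum JL)
  have "(LINT \<omega>|M. ?J i \<omega> * ?J j \<omega>) = 0" if "i \<noteq> j" for i j
    using chaos_orthogonal[OF JC JC] that by simp
  then have SS: "(l2norm M S)\<^sup>2 = (\<Sum>i<N. (l2norm M (?J i))\<^sup>2)"
    unfolding S_def by (intro l2norm_orthogonal_sum JL) auto
  have GJ: "(LINT \<omega>|M. G \<omega> * ?J i \<omega>) = (l2norm M (?J i))\<^sup>2" for i
  proof -
    have "(LINT \<omega>|M. (G \<omega> - ?J i \<omega>) * ?J i \<omega>) = 0" using chaos_proj(2)[OF G _ JC] by simp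
    then show ?thesis
      unfolding l2norm_sq left_diff_distrib
      using L2_mult_integrable[OF G JL[of i]] L2_mult_integrable[OF JL[of i] JL[of i]] by (simp add: power2_eq_square)
  qed
  have GS: "(LINT \<omega>|M. G \<omega> * S \<omega>) = (l2norm M S)\<^sup>2"
    unfolding S_def sum_distrib_left SS[unfolded S_def]
    by (subst Bochner_Integration.integral_sum) (auto intro: L2_mult_integrable[OF G JL] simp: GJ)
  have "(norm (G \<omega> - S \<omega>))\<^sup>2 = (norm (G \<omega>))\<^sup>2 - 2 * (G \<omega> * S \<omega>) + (norm (S \<omega>))\<^sup>2" for \<omega>
    by (simp add: power2_eq_square algebra_simps)
  then have "(l2norm M (\<lambda>\<omega>. G \<omega> - S \<omega>))\<^sup>2 = (l2norm M G)\<^sup>2 - 2 * (l2norm M S)\<^sup>2 + (l2norm M S)\<^sup>2"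
    using G SL L2_mult_integrable[OF G SL] GS by (simp add: l2norm_sq L2_iff)
  moreover have "0 \<le> (l2norm M (\<lambda>\<omega>. G \<omega> - S \<omega>))\<^sup>2" by simp
  ultimately show "(\<Sum>i<N. (l2norm M (?J i))\<^sup>2) \<le> (l2norm M G)\<^sup>2" unfolding SS by linarith
qed simp

text \<open>The part of \<open>G - E G\<close> outside the sum of its components is orthogonal to every Hermite
  variable and hence zero.\<close>

lemma chaos_decomposition:
  assumes G: "G \<in> Lp_fun M 2"
  shows "(\<lambda>N. l2norm M (\<lambda>\<omega>. (\<Sum>q=1..N. chaos_proj M X q G \<omega>) - (G \<omega> - (LINT \<omega>|M. G \<omega>)))) \<longlonglongrightarrow> 0"
proof -
  let ?J = "\<lambda>i. chaos_proj M X (Suc i) G"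
  have JL: "?J i \<in> Lp_fun M 2" for i by (rule chaos_proj_L2[OF G]) simp
  have JC: "?J i \<in> wiener_chaos M X (Suc i)" for i by (rule chaos_proj(1)[OF G]) simp
  have orth: "(LINT \<omega>|M. ?J i \<omega> \<bullet> ?J j \<omega>) = 0" if "i \<noteq> j" for i j
    using chaos_orthogonal[OF JC JC] that by simp
  obtain S where SL: "S \<in> Lp_fun M 2" and lim: "(\<lambda>N. l2norm M (\<lambda>\<omega>. (\<Sum>i<N. ?J i \<omega>) - S \<omega>)) \<longlonglongrightarrow> 0"
    using L2_orthogonal_series[OF JL orth summable_chaos_proj[OF G]] by blast
  have inner: "(\<lambda>N. LINT \<omega>|M. (\<Sum>i<N. ?J i \<omega>) * W \<omega>) \<longlonglongrightarrow> (LINT \<omega>|M. S \<omega> * W \<omega>)" if "W \<in> Lp_fun M 2" for W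
    using L2_inner_tendsto[OF L2_sum[OF JL] SL that lim] by simp
  define \<mu> where "\<mu> = (LINT \<omega>|M. G \<omega>)"
  define R where "R = (\<lambda>\<omega>. G \<omega> - \<mu> - S \<omega>)"
  have RL: "R \<in> Lp_fun M 2" unfolding R_def by (intro L2_diff G SL L2_const)
  have "AE \<omega> in M. R \<omega> = 0"
  proof (rule orthogonal_hermite_imp_zero[OF RL])
    have "(LINT \<omega>|M. (\<Sum>i<N. ?J i \<omega>) * 1) = 0" for N
      using chaos_mean[OF JC] by (simp add: L2_integrable[OF JL])
    then have "(LINT \<omega>|M. S \<omega>) = 0" using inner[OF L2_const[of 1]] by (simp add: LIMSEQ_const_iff)
    then show "(LINT \<omega>|M. R \<omega>) = 0"
      unfolding R_def using L2_integrable[OF G] L2_integrable[OF SL] by (simp add: \<mu>_def prob_space)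
  next
    fix q :: nat and h :: 'h assume q: "q \<ge> 1" and h: "norm h = 1"
    let ?H = "\<lambda>\<omega>. hermite q (X h \<omega>)"
    have HC: "?H \<in> wiener_chaos M X q" using chaos_poly_hermite[OF h] chaos_poly_in_chaos q by blast
    note HL = hermite_X_L2[of q h]
    have "(LINT \<omega>|M. (G \<omega> - ?J (q - 1) \<omega>) * ?H \<omega>) = 0" using chaos_proj(2)[OF G _ HC] q by simp
    then have GH: "(LINT \<omega>|M. ?J (q - 1) \<omega> * ?H \<omega>) = (LINT \<omega>|M. G \<omega> * ?H \<omega>)"
      unfolding left_diff_distrib using L2_mult_integrable[OF G HL] L2_mult_integrable[OF JL[of "q - 1"] HL] by simp
    have "(LINT \<omega>|M. (\<Sum>i<N. ?J i \<omega>) * ?H \<omega>) = (LINT \<omega>|M. G \<omega> * ?H \<omega>)" if N: "N \<ge> q" for N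
    proof -
      have "(LINT \<omega>|M. (\<Sum>i<N. ?J i \<omega>) * ?H \<omega>) = (\<Sum>i<N. LINT \<omega>|M. ?J i \<omega> * ?H \<omega>)"
        unfolding sum_distrib_right by (rule Bochner_Integration.integral_sum) (rule L2_mult_integrable[OF JL HL])
      also have "\<dots> = (\<Sum>i<N. if i = q - 1 then (LINT \<omega>|M. G \<omega> * ?H \<omega>) else 0)"
      proof (intro sum.cong refl)
        fix i
        show "(LINT \<omega>|M. ?J i \<omega> * ?H \<omega>) = (if i = q - 1 then (LINT \<omega>|M. G \<omega> * ?H \<omega>) else 0)"
        proof (cases "i = q - 1")
          case True then show ?thesis using GH by simp
        next
          case False
          then have "Suc i \<noteq> q" by simp
          then show ?thesis using chaos_orthogonal[OF JC[of i] HC] q False by simp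
        qed
      qed
      also have "\<dots> = (LINT \<omega>|M. G \<omega> * ?H \<omega>)" using N q by simp
      finally show ?thesis .
    qed
    then have "\<forall>\<^sub>F N in sequentially. (LINT \<omega>|M. (\<Sum>i<N. ?J i \<omega>) * ?H \<omega>) = (LINT \<omega>|M. G \<omega> * ?H \<omega>)"
      unfolding eventually_sequentially by blast
    then have "(\<lambda>N. LINT \<omega>|M. (\<Sum>i<N. ?J i \<omega>) * ?H \<omega>) \<longlonglongrightarrow> (LINT \<omega>|M. G \<omega> * ?H \<omega>)"
      by (rule tendsto_eventually)
    then have SH: "(LINT \<omega>|M. S \<omega> * ?H \<omega>) = (LINT \<omega>|M. G \<omega> * ?H \<omega>)"
      using inner[OF HL] LIMSEQ_unique by blast
    have "(LINT \<omega>|M. ?H \<omega>) = 0" by (rule chaos_mean[OF HC q])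
    then show "(LINT \<omega>|M. R \<omega> * ?H \<omega>) = 0"
      unfolding R_def left_diff_distrib
      using SH L2_mult_integrable[OF G HL] L2_mult_integrable[OF SL HL] L2_integrable[OF HL] by simp
  qed
  then have ae: "AE \<omega> in M. S \<omega> = G \<omega> - \<mu>" by eventually_elim (simp add: R_def)
  have "l2norm M (\<lambda>\<omega>. (\<Sum>q=1..N. chaos_proj M X q G \<omega>) - (G \<omega> - \<mu>)) = l2norm M (\<lambda>\<omega>. (\<Sum>i<N. ?J i \<omega>) - S \<omega>)" for N
  proof -
    have "(\<Sum>q=1..N. chaos_proj M X q G \<omega>) = (\<Sum>i<N. ?J i \<omega>)" for \<omega>
      by (rule sum.reindex_bij_witness[of _ Suc "\<lambda>q. q - 1"]) auto
    then show ?thesis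
    proof (simp, intro l2norm_cong_AE)
      show "(\<lambda>\<omega>. (\<Sum>i<N. ?J i \<omega>) - (G \<omega> - \<mu>)) \<in> borel_measurable M"
        by (intro L2_measurable L2_diff L2_sum JL G L2_const)
      show "(\<lambda>\<omega>. (\<Sum>i<N. ?J i \<omega>) - S \<omega>) \<in> borel_measurable M"
        by (intro L2_measurable L2_diff L2_sum JL SL)
      show "AE \<omega> in M. (\<Sum>i<N. ?J i \<omega>) - (G \<omega> - \<mu>) = (\<Sum>i<N. ?J i \<omega>) - S \<omega>"
        using ae by eventually_elim simp
    qed
  qed
  then show ?thesis using lim unfolding \<mu>_def by simp
qed

text \<open>The series defining \<open>L\<^sup>-\<^sup>1 G\<close> converges in \<open>L\<^sup>2\<close>, being dominated termwise by
  the chaos expansion of \<open>G\<close>; so the choice in the definition is of its limit.\<close>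

lemma OU_pinv:
  assumes G: "G \<in> Lp_fun M 2"
  shows "OU_pinv M X G \<in> Lp_fun M 2"
    and "(\<lambda>N. l2norm M (\<lambda>\<omega>. (\<Sum>q=1..N. (- 1 / real q) * chaos_proj M X q G \<omega>) - OU_pinv M X G \<omega>)) \<longlonglongrightarrow> 0"
proof -
  define W where "W = (\<lambda>i \<omega>. (- 1 / real (Suc i)) * chaos_proj M X (Suc i) G \<omega>)"
  have JL: "chaos_proj M X (Suc i) G \<in> Lp_fun M 2" for i by (rule chaos_proj_L2[OF G]) simp
  have JC: "chaos_proj M X (Suc i) G \<in> wiener_chaos M X (Suc i)" for i by (rule chaos_proj(1)[OF G]) simp
  have WL: "W i \<in> Lp_fun M 2" for i unfolding W_def by (intro L2_mult_const JL)
  have orth: "(LINT \<omega>|M. W i \<omega> \<bullet> W j \<omega>) = 0" if "i \<noteq> j" for i j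
  proof -
    have "(LINT \<omega>|M. W i \<omega> \<bullet> W j \<omega>)
       = (LINT \<omega>|M. (1 / real (Suc i) * (1 / real (Suc j))) * (chaos_proj M X (Suc i) G \<omega> * chaos_proj M X (Suc j) G \<omega>))"
      unfolding W_def by (intro Bochner_Integration.integral_cong) auto
    also have "\<dots> = (1 / real (Suc i) * (1 / real (Suc j))) * (LINT \<omega>|M. chaos_proj M X (Suc i) G \<omega> * chaos_proj M X (Suc j) G \<omega>)"
      by (rule integral_mult_right_zero)
    also have "\<dots> = 0" using chaos_orthogonal[OF JC JC] that by simp
    finally show ?thesis .
  qed
  have "summable (\<lambda>i. (l2norm M (W i))\<^sup>2)"
  proof (rule summable_comparison_test'[OF summable_chaos_proj[OF G]])
    fix i :: nat
    have "l2norm M (W i) = 1 / real (Suc i) * l2norm M (chaos_proj M X (Suc i) G)"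
      using l2norm_scaleR[of M "- 1 / real (Suc i)" "chaos_proj M X (Suc i) G"] by (simp add: W_def)
    also have "\<dots> \<le> 1 * l2norm M (chaos_proj M X (Suc i) G)"
      by (intro mult_right_mono) auto
    finally show "norm ((l2norm M (W i))\<^sup>2) \<le> (l2norm M (chaos_proj M X (Suc i) G))\<^sup>2"
      by (simp add: power_mono)
  qed
  then have "\<exists>S\<in>Lp_fun M 2. (\<lambda>N. l2norm M (\<lambda>\<omega>. (\<Sum>i<N. W i \<omega>) - S \<omega>)) \<longlonglongrightarrow> 0"
    using L2_orthogonal_series[of W] WL orth by blast
  then obtain S where S: "S \<in> Lp_fun M 2" "(\<lambda>N. l2norm M (\<lambda>\<omega>. (\<Sum>i<N. W i \<omega>) - S \<omega>)) \<longlonglongrightarrow> 0"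
    by (elim bexE)
  have reindex: "(\<Sum>q=1..N. (- 1 / real q) * chaos_proj M X q G \<omega>) = (\<Sum>i<N. W i \<omega>)" for N \<omega>
    by (rule sum.reindex_bij_witness[of _ Suc "\<lambda>q. q - 1"]) (auto simp: W_def)
  have form: "(LINT \<omega>|M. (Z \<omega> - (- (\<Sum>q=1..N. 1 / real q * chaos_proj M X q G \<omega>)))\<^sup>2)
      = (l2norm M (\<lambda>\<omega>. (\<Sum>q=1..N. (- 1 / real q) * chaos_proj M X q G \<omega>) - Z \<omega>))\<^sup>2" for Z N
    unfolding l2norm_sq by (simp add: sum_negf power2_commute)
  have "\<exists>Z. Z \<in> Lp_fun M 2 \<and> (\<lambda>N. LINT \<omega>|M. (Z \<omega> - (- (\<Sum>q=1..N. 1 / real q * chaos_proj M X q G \<omega>)))\<^sup>2) \<longlonglongrightarrow> 0"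
    unfolding form using S tendsto_power[OF S(2), of 2] unfolding reindex[symmetric] by auto
  from someI_ex[OF this] have *: "OU_pinv M X G \<in> Lp_fun M 2"
    "(\<lambda>N. (l2norm M (\<lambda>\<omega>. (\<Sum>q=1..N. (- 1 / real q) * chaos_proj M X q G \<omega>) - OU_pinv M X G \<omega>))\<^sup>2) \<longlonglongrightarrow> 0"
    unfolding OU_pinv_def form by auto
  show "OU_pinv M X G \<in> Lp_fun M 2" by (rule *)
  show "(\<lambda>N. l2norm M (\<lambda>\<omega>. (\<Sum>q=1..N. (- 1 / real q) * chaos_proj M X q G \<omega>) - OU_pinv M X G \<omega>)) \<longlonglongrightarrow> 0"
    using tendsto_real_sqrt[OF *(2)] by simp
qed

text \<open>Approximating each chaos component by Hermite combinations gives smooth \<open>T N\<close> tending to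
  \<open>L\<^sup>-\<^sup>1 G\<close>. Since \<open>E\<parallel>D Z\<parallel>\<^sup>2 = q E[Z\<^sup>2]\<close> in the \<open>q\<close>th chaos, the weights \<open>1 / q\<close> bound the
  derivatives of \<open>T N - T K\<close> by \<open>P N - P K\<close>, where \<open>P N\<close> tends to \<open>G - E G\<close>.\<close>

lemma OU_pinv_malliavin:
  assumes G: "G \<in> Lp_fun M 2"
  shows "\<exists>V. has_malliavin_deriv M X 2 (OU_pinv M X G) V \<and>
    (\<forall>\<Phi> D. cyl \<Phi> D \<longrightarrow> (LINT \<omega>|M. D \<omega> \<bullet> V \<omega>) = - (LINT \<omega>|M. \<Phi> \<omega> * (G \<omega> - (LINT \<omega>|M. G \<omega>))))"
proof -
  let ?J = "\<lambda>q. chaos_proj M X q G"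
  have JL: "?J q \<in> Lp_fun M 2" if "q \<ge> 1" for q by (rule chaos_proj_L2[OF G that])
  define Q where "Q = (\<lambda>N q Z U. chaos_poly q Z U \<and>
     (if q \<in> {1..N} then l2norm M (\<lambda>\<omega>. Z \<omega> - ?J q \<omega>) < 1 / (real (Suc N))\<^sup>2 else Z = (\<lambda>_. 0) \<and> U = (\<lambda>_. 0)))"
  have "\<exists>Z U. chaos_poly q Z U \<and>
     (if q \<in> {1..N} then l2norm M (\<lambda>\<omega>. Z \<omega> - ?J q \<omega>) < 1 / (real (Suc N))\<^sup>2 else Z = (\<lambda>_. 0) \<and> U = (\<lambda>_. 0))" for N q
  proof (cases "q \<in> {1..N}")
    case True
    then have "\<exists>Z U. chaos_poly q Z U \<and> l2norm M (\<lambda>\<omega>. ?J q \<omega> - Z \<omega>) < 1 / (real (Suc N))\<^sup>2"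
      using chaos_proj(1)[OF G, of q] chaos_eq_closure[of q "?J q"] by auto
    with True show ?thesis using l2norm_commute[of M "?J q"] by auto
  next
    case False then show ?thesis using chaos_poly_zero by auto
  qed
  then have "\<forall>N q. \<exists>Z U. Q N q Z U" by (simp add: Q_def)
  then obtain Z U where Q: "\<And>N q. Q N q (Z N q) (U N q)" by metis
  have CP: "\<And>N q. chaos_poly q (Z N q) (U N q)"
    and ZJ: "\<And>N q. q \<in> {1..N} \<Longrightarrow> l2norm M (\<lambda>\<omega>. Z N q \<omega> - ?J q \<omega>) < 1 / (real (Suc N))\<^sup>2"
    and Z0: "\<And>N q. q \<notin> {1..N} \<Longrightarrow> Z N q = (\<lambda>_. 0)" "\<And>N q. q \<notin> {1..N} \<Longrightarrow> U N q = (\<lambda>_. 0)"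
    using Q unfolding Q_def by presburger+
  have ZL: "Z N q \<in> Lp_fun M 2" and UL: "U N q \<in> Lp_fun M 2" if "q \<ge> 1" for N q
    using chaos_poly_L2[OF CP that] chaos_poly_deriv_L2[OF CP that] by auto
  define P where "P = (\<lambda>N \<omega>. \<Sum>q=1..N. Z N q \<omega>)"
  define T where "T = (\<lambda>N \<omega>. \<Sum>q=1..N. (- 1 / real q) * Z N q \<omega>)"
  define D where "D = (\<lambda>N \<omega>. \<Sum>q=1..N. (- 1 / real q) *\<^sub>R U N q \<omega>)"
  have PL: "P N \<in> Lp_fun M 2" for N unfolding P_def by (intro L2_sum ZL) auto
  have DL: "D N \<in> Lp_fun M 2" for N unfolding D_def by (intro L2_sum L2_scaleR UL) auto
  have smooth: "smooth_rv_deriv X (T N) (D N)" for N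
    unfolding T_def D_def by (rule chaos_poly_sum_smooth[OF CP])
  have close: "l2norm M (\<lambda>\<omega>. (\<Sum>q=1..N. a q * Z N q \<omega>) - (\<Sum>q=1..N. a q * ?J q \<omega>)) \<le> 1 / real (Suc N)"
    if a: "\<And>q. q \<ge> 1 \<Longrightarrow> \<bar>a q\<bar> \<le> 1" for a N
  proof -
    have "l2norm M (\<lambda>\<omega>. (\<Sum>q=1..N. a q * Z N q \<omega>) - (\<Sum>q=1..N. a q * ?J q \<omega>))
       = l2norm M (\<lambda>\<omega>. \<Sum>q=1..N. a q *\<^sub>R (Z N q \<omega> - ?J q \<omega>))"
      by (simp add: sum_subtractf right_diff_distrib)
    also have "\<dots> \<le> (\<Sum>q=1..N. l2norm M (\<lambda>\<omega>. a q *\<^sub>R (Z N q \<omega> - ?J q \<omega>)))"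
      by (intro l2norm_sum_le L2_scaleR L2_diff ZL JL) auto
    also have "\<dots> \<le> (\<Sum>q=1..N. 1 / (real (Suc N))\<^sup>2)"
    proof (rule sum_mono)
      fix q assume q: "q \<in> {1..N}"
      have "\<bar>a q\<bar> * l2norm M (\<lambda>\<omega>. Z N q \<omega> - ?J q \<omega>) \<le> 1 * (1 / (real (Suc N))\<^sup>2)"
        using a[of q] ZJ[OF q] q by (intro mult_mono) auto
      then show "l2norm M (\<lambda>\<omega>. a q *\<^sub>R (Z N q \<omega> - ?J q \<omega>)) \<le> 1 / (real (Suc N))\<^sup>2"
        unfolding l2norm_scaleR by simp
    qed
    also have "\<dots> \<le> real (Suc N) / (real (Suc N))\<^sup>2" by (simp add: divide_right_mono)
    also have "\<dots> = 1 / real (Suc N)" by (simp add: power2_eq_square)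
    finally show ?thesis .
  qed
  have lim0: "(\<lambda>N. 1 / real (Suc N)) \<longlonglongrightarrow> 0" by (rule LIMSEQ_Suc[OF lim_1_over_n])
  define S where "S = (\<lambda>\<omega>. G \<omega> - (LINT \<omega>|M. G \<omega>))"
  have SL: "S \<in> Lp_fun M 2" unfolding S_def by (intro L2_diff G L2_const)
  have Plim: "(\<lambda>N. l2norm M (\<lambda>\<omega>. P N \<omega> - S \<omega>)) \<longlonglongrightarrow> 0"
  proof (rule Lim_null_comparison)
    show "(\<lambda>N. 1 / real (Suc N) + l2norm M (\<lambda>\<omega>. (\<Sum>q=1..N. ?J q \<omega>) - S \<omega>)) \<longlonglongrightarrow> 0"
      using tendsto_add[OF lim0 chaos_decomposition[OF G]] by (simp add: S_def)
    have "l2norm M (\<lambda>\<omega>. P N \<omega> - S \<omega>) \<le> 1 / real (Suc N) + l2norm M (\<lambda>\<omega>. (\<Sum>q=1..N. ?J q \<omega>) - S \<omega>)" for N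
    proof -
      have "(\<lambda>\<omega>. \<Sum>q=1..N. ?J q \<omega>) \<in> Lp_fun M 2" by (intro L2_sum JL) auto
      from l2norm_diff_triangle[OF PL[of N] this SL] show ?thesis
        using close[of "\<lambda>_. 1" N] by (simp add: P_def)
    qed
    then show "\<forall>\<^sub>F N in sequentially. norm (l2norm M (\<lambda>\<omega>. P N \<omega> - S \<omega>))
        \<le> 1 / real (Suc N) + l2norm M (\<lambda>\<omega>. (\<Sum>q=1..N. ?J q \<omega>) - S \<omega>)" by simp
  qed
  have TL: "T N \<in> Lp_fun M 2" for N unfolding T_def by (intro L2_sum L2_mult_const ZL) auto
  have Tlim: "(\<lambda>N. l2norm M (\<lambda>\<omega>. T N \<omega> - OU_pinv M X G \<omega>)) \<longlonglongrightarrow> 0"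
  proof (rule Lim_null_comparison)
    show "(\<lambda>N. 1 / real (Suc N) + l2norm M (\<lambda>\<omega>. (\<Sum>q=1..N. (- 1 / real q) * ?J q \<omega>) - OU_pinv M X G \<omega>)) \<longlonglongrightarrow> 0"
      using tendsto_add[OF lim0 OU_pinv(2)[OF G]] by simp
    have "l2norm M (\<lambda>\<omega>. T N \<omega> - OU_pinv M X G \<omega>)
       \<le> 1 / real (Suc N) + l2norm M (\<lambda>\<omega>. (\<Sum>q=1..N. (- 1 / real q) * ?J q \<omega>) - OU_pinv M X G \<omega>)" for N
    proof -
      have "(\<lambda>\<omega>. \<Sum>q=1..N. (- 1 / real q) * ?J q \<omega>) \<in> Lp_fun M 2" by (intro L2_sum L2_mult_const JL) auto
      note tri = l2norm_diff_triangle[OF TL[of N] this OU_pinv(1)[OF G]]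
      have "l2norm M (\<lambda>\<omega>. T N \<omega> - (\<Sum>q=1..N. (- 1 / real q) * ?J q \<omega>)) \<le> 1 / real (Suc N)"
        unfolding T_def by (rule close) simp
      then show ?thesis using tri by linarith
    qed
    then show "\<forall>\<^sub>F N in sequentially. norm (l2norm M (\<lambda>\<omega>. T N \<omega> - OU_pinv M X G \<omega>))
        \<le> 1 / real (Suc N) + l2norm M (\<lambda>\<omega>. (\<Sum>q=1..N. (- 1 / real q) * ?J q \<omega>) - OU_pinv M X G \<omega>)" by simp
  qed
  have dom: "l2norm M (\<lambda>\<omega>. D N \<omega> - D K \<omega>) \<le> l2norm M (\<lambda>\<omega>. P N \<omega> - P K \<omega>)" for N K
  proof -
    define L where "L = max N K"
    define z where "z = (\<lambda>q \<omega>. 1 * Z N q \<omega> + (-1) * Z K q \<omega>)"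
    define u where "u = (\<lambda>q \<omega>. 1 *\<^sub>R U N q \<omega> + (-1) *\<^sub>R U K q \<omega>)"
    have cp: "chaos_poly q (z q) (u q)" for q unfolding z_def u_def by (intro chaos_poly_lin CP)
    have PL': "P N' \<omega> = (\<Sum>q=1..L. Z N' q \<omega>)" if "N' \<le> L" for N' \<omega>
      unfolding P_def using that Z0(1) by (intro sum.mono_neutral_left) auto
    have DL': "D N' \<omega> = (\<Sum>q=1..L. (- 1 / real q) *\<^sub>R U N' q \<omega>)" if "N' \<le> L" for N' \<omega>
      unfolding D_def using that Z0(2) by (intro sum.mono_neutral_left) auto
    have NK: "N \<le> L" "K \<le> L" by (auto simp: L_def)
    have PP: "P N \<omega> - P K \<omega> = (\<Sum>q=1..L. z q \<omega>)" for \<omega>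
      unfolding PL'[OF NK(1)] PL'[OF NK(2)] by (simp add: z_def sum_subtractf)
    have DD: "D N \<omega> - D K \<omega> = (\<Sum>q=1..L. (- 1 / real q) *\<^sub>R u q \<omega>)" for \<omega>
      unfolding DL'[OF NK(1)] DL'[OF NK(2)] sum_subtractf[symmetric] by (intro sum.cong) (auto simp: u_def algebra_simps)
    have a: "(l2norm M (\<lambda>\<omega>. P N \<omega> - P K \<omega>))\<^sup>2 = (\<Sum>q=1..L. (l2norm M (z q))\<^sup>2)"
      unfolding PP by (rule l2norm_orthogonal_sum)
        (use chaos_poly_L2[OF cp] chaos_poly_orthogonal(1)[OF cp cp] in auto)
    have b: "(l2norm M (\<lambda>\<omega>. D N \<omega> - D K \<omega>))\<^sup>2 = (\<Sum>q=1..L. (l2norm M (\<lambda>\<omega>. (- 1 / real q) *\<^sub>R u q \<omega>))\<^sup>2)"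
      unfolding DD
    proof (rule l2norm_orthogonal_sum)
      show "(\<lambda>\<omega>. (- 1 / real q) *\<^sub>R u q \<omega>) \<in> Lp_fun M 2" if "q \<in> {1..L}" for q
        by (intro L2_scaleR chaos_poly_deriv_L2[OF cp]) (use that in simp)
      show "(LINT \<omega>|M. (- 1 / real i) *\<^sub>R u i \<omega> \<bullet> (- 1 / real j) *\<^sub>R u j \<omega>) = 0"
        if "i \<in> {1..L}" "j \<in> {1..L}" "i \<noteq> j" for i j
        using chaos_poly_orthogonal(2)[OF cp[of i] cp[of j]] that by simp
    qed simp
    have c: "(l2norm M (\<lambda>\<omega>. (- 1 / real q) *\<^sub>R u q \<omega>))\<^sup>2 \<le> (l2norm M (z q))\<^sup>2" if "q \<in> {1..L}" for q
    proof -
      have "(l2norm M (\<lambda>\<omega>. (- 1 / real q) *\<^sub>R u q \<omega>))\<^sup>2 = (1 / real q)\<^sup>2 * (real q * (l2norm M (z q))\<^sup>2)"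
        unfolding l2norm_scaleR power_mult_distrib using chaos_poly_deriv_norm[OF cp, of q] that by simp
      also have "\<dots> = 1 / real q * (l2norm M (z q))\<^sup>2" using that by (simp add: power2_eq_square)
      also have "\<dots> \<le> 1 * (l2norm M (z q))\<^sup>2" using that by (intro mult_right_mono) auto
      finally show ?thesis by simp
    qed
    have "(l2norm M (\<lambda>\<omega>. D N \<omega> - D K \<omega>))\<^sup>2 \<le> (l2norm M (\<lambda>\<omega>. P N \<omega> - P K \<omega>))\<^sup>2"
      unfolding a b by (intro sum_mono c)
    then show ?thesis by (rule power2_le_imp_le) simp
  qed
  have "\<exists>V\<in>Lp_fun M 2. (\<lambda>N. l2norm M (\<lambda>\<omega>. D N \<omega> - V \<omega>)) \<longlonglongrightarrow> 0"
  proof (rule L2_complete[OF DL])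
    fix e :: real assume "e > 0"
    then obtain N0 where N0: "\<And>N. N \<ge> N0 \<Longrightarrow> l2norm M (\<lambda>\<omega>. P N \<omega> - S \<omega>) < e / 2"
      using order_tendstoD(2)[OF Plim, of "e/2"] by (auto simp: eventually_sequentially)
    have "l2norm M (\<lambda>\<omega>. D N \<omega> - D K \<omega>) < e" if "N \<ge> N0" "K \<ge> N0" for N K
      using dom[of N K] l2norm_diff_triangle[OF PL[of N] SL PL[of K]] N0[OF that(1)] N0[OF that(2)]
        l2norm_commute[of M S "P K"] by linarith
    then show "\<exists>N0. \<forall>N\<ge>N0. \<forall>K\<ge>N0. l2norm M (\<lambda>\<omega>. D N \<omega> - D K \<omega>) < e" by blast
  qed
  then obtain V where VL: "V \<in> Lp_fun M 2" and Vlim: "(\<lambda>N. l2norm M (\<lambda>\<omega>. D N \<omega> - V \<omega>)) \<longlonglongrightarrow> 0" by blast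
  have "(LINT \<omega>|M. E \<omega> \<bullet> V \<omega>) = - (LINT \<omega>|M. \<Phi> \<omega> * S \<omega>)" if cyl: "cyl \<Phi> E" for \<Phi> E
  proof -
    note \<Phi>L = cyl_L2[OF cyl] and EL = cyl_deriv_L2[OF cyl]
    have "(LINT \<omega>|M. D N \<omega> \<bullet> E \<omega>) = - (LINT \<omega>|M. P N \<omega> * \<Phi> \<omega>)" for N
    proof -
      have "(LINT \<omega>|M. D N \<omega> \<bullet> E \<omega>) = (LINT \<omega>|M. (\<Sum>q=1..N. (- 1 / real q) * (E \<omega> \<bullet> U N q \<omega>)))"
        unfolding D_def inner_sum_left inner_scaleR_left by (simp add: inner_commute)
      also have "\<dots> = (\<Sum>q=1..N. (- 1 / real q) * (LINT \<omega>|M. E \<omega> \<bullet> U N q \<omega>))"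
        by (subst Bochner_Integration.integral_sum) (auto intro!: integrable_mult_right L2_inner_integrable EL UL)
      also have "\<dots> = (\<Sum>q=1..N. - (LINT \<omega>|M. \<Phi> \<omega> * Z N q \<omega>))"
        using cyl_inner_chaos_poly[OF cyl CP] by (intro sum.cong) auto
      also have "\<dots> = - (\<Sum>q=1..N. LINT \<omega>|M. Z N q \<omega> * \<Phi> \<omega>)" by (simp add: sum_negf mult.commute)
      also have "\<dots> = - (LINT \<omega>|M. P N \<omega> * \<Phi> \<omega>)"
        unfolding P_def sum_distrib_right
        by (subst Bochner_Integration.integral_sum) (auto intro!: L2_mult_integrable \<Phi>L ZL)
      finally show ?thesis .
    qed
    moreover have "(\<lambda>N. LINT \<omega>|M. D N \<omega> \<bullet> E \<omega>) \<longlonglongrightarrow> (LINT \<omega>|M. V \<omega> \<bullet> E \<omega>)"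
      by (rule L2_inner_tendsto[OF DL VL EL Vlim])
    moreover have "(\<lambda>N. LINT \<omega>|M. P N \<omega> \<bullet> \<Phi> \<omega>) \<longlonglongrightarrow> (LINT \<omega>|M. S \<omega> \<bullet> \<Phi> \<omega>)"
      by (rule L2_inner_tendsto[OF PL SL \<Phi>L Plim])
    then have "(\<lambda>N. - (LINT \<omega>|M. P N \<omega> * \<Phi> \<omega>)) \<longlonglongrightarrow> - (LINT \<omega>|M. S \<omega> * \<Phi> \<omega>)"
      by (intro tendsto_minus) simp
    ultimately have "(LINT \<omega>|M. V \<omega> \<bullet> E \<omega>) = - (LINT \<omega>|M. S \<omega> * \<Phi> \<omega>)"
      by (simp add: LIMSEQ_unique)
    then show ?thesis by (simp add: inner_commute mult.commute)
  qed
  moreover have "has_malliavin_deriv M X 2 (OU_pinv M X G) V"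
    unfolding has_malliavin_deriv_L2_iff using OU_pinv(1)[OF G] VL smooth Tlim Vlim by blast
  ultimately show ?thesis unfolding S_def by blast
qed

end

section \<open>Integration by parts on Wiener space\<close>

context isonormal_process
begin

lemma bounded_X_L2:
  assumes "continuous_on UNIV f" "\<And>x. \<bar>f x\<bar> \<le> (B::real)"
  shows "(\<lambda>\<omega>. f (X k \<omega>)) \<in> Lp_fun M 2"
proof (rule L2_bound[OF L2_const[of B]])
  have [measurable]: "f \<in> borel_measurable borel" using assms(1) by (rule borel_measurable_continuous_onI)
  show "(\<lambda>\<omega>. f (X k \<omega>)) \<in> borel_measurable M" by measurable
  show "norm (f (X k \<omega>)) \<le> norm B" for \<omega> using assms(2)[of "X k \<omega>"] by simp
qed

text \<open>Tested against \<open>f(X k) h\<close>, a Malliavin derivative is determined by the variable, since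
  the integration by parts formula on smooth variables passes to the limit.\<close>

lemma malliavin_deriv_test:
  assumes "has_malliavin_deriv M X 2 W V" and h: "norm h = 1"
    and f: "\<And>x. (f has_real_derivative f' x) (at x)" "continuous_on UNIV f'"
    and bound: "\<And>x. \<bar>f x\<bar> \<le> B" "\<And>x. \<bar>f' x\<bar> \<le> B'"
  shows "(LINT \<omega>|M. f (X k \<omega>) * (V \<omega> \<bullet> h))
      = (LINT \<omega>|M. W \<omega> * (f (X k \<omega>) * X h \<omega>)) - (k \<bullet> h) * (LINT \<omega>|M. W \<omega> * f' (X k \<omega>))"
proof -
  have cf: "continuous_on UNIV f" using f(1) by (auto intro!: continuous_at_imp_continuous_on DERIV_isCont)
  have [measurable]: "f \<in> borel_measurable borel" "f' \<in> borel_measurable borel"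
    using cf f(2) by (auto intro: borel_measurable_continuous_onI)
  obtain Ws Vs where WL: "W \<in> Lp_fun M 2" and VL: "V \<in> Lp_fun M 2" and sm: "\<And>n. smooth_rv_deriv X (Ws n) (Vs n)"
    and lim: "(\<lambda>n. l2norm M (\<lambda>\<omega>. Ws n \<omega> - W \<omega>)) \<longlonglongrightarrow> 0" "(\<lambda>n. l2norm M (\<lambda>\<omega>. Vs n \<omega> - V \<omega>)) \<longlonglongrightarrow> 0"
    using assms(1) unfolding has_malliavin_deriv_L2_iff by blast
  have cyl: "cyl (Ws n) (Vs n)" for n by (rule smooth_rv_deriv_cyl[OF sm])
  note L = cyl_L2[OF cyl] cyl_deriv_L2[OF cyl]
  have fX: "(\<lambda>\<omega>. f (X k \<omega>) * X h \<omega>) \<in> Lp_fun M 2"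
    using L2_bounded_mult[OF X_L2[of h], of "\<lambda>\<omega>. f (X k \<omega>)" B] bound(1) by simp
  have fh: "(\<lambda>\<omega>. f (X k \<omega>) *\<^sub>R h) \<in> Lp_fun M 2"
    by (rule L2_bounded_mult[OF L2_const]) (use bound(1) in auto)
  have f'L: "(\<lambda>\<omega>. f' (X k \<omega>)) \<in> Lp_fun M 2" by (rule bounded_X_L2[OF f(2) bound(2)])
  have "(LINT \<omega>|M. Vs n \<omega> \<bullet> (f (X k \<omega>) *\<^sub>R h))
      = (LINT \<omega>|M. Ws n \<omega> \<bullet> (f (X k \<omega>) * X h \<omega>)) - (k \<bullet> h) * (LINT \<omega>|M. Ws n \<omega> \<bullet> f' (X k \<omega>))" for n
  proof -
    have "(LINT \<omega>|M. (Ws n \<omega> * f (X k \<omega>)) * hermite (Suc 0) (X h \<omega>))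
        = (LINT \<omega>|M. ((f (X k \<omega>) *\<^sub>R Vs n \<omega> + (Ws n \<omega> * f' (X k \<omega>)) *\<^sub>R k) \<bullet> h) * hermite 0 (X h \<omega>))"
      by (rule cyl_ibp[OF cyl_mult_X[OF cyl f bound] h])
    then have "(LINT \<omega>|M. Ws n \<omega> * (f (X k \<omega>) * X h \<omega>))
        = (LINT \<omega>|M. Vs n \<omega> \<bullet> (f (X k \<omega>) *\<^sub>R h) + (k \<bullet> h) * (Ws n \<omega> * f' (X k \<omega>)))"
      by (simp add: hermite_0 hermite_Suc_0 inner_add_left mult_ac)
    also have "\<dots> = (LINT \<omega>|M. Vs n \<omega> \<bullet> (f (X k \<omega>) *\<^sub>R h)) + (k \<bullet> h) * (LINT \<omega>|M. Ws n \<omega> * f' (X k \<omega>))"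
      using Bochner_Integration.integral_add[OF L2_inner_integrable[OF L(2)[of n] fh]
          integrable_mult_right[OF L2_mult_integrable[OF L(1)[of n] f'L], of "k \<bullet> h"]] by simp
    finally show ?thesis by simp
  qed
  moreover have "(\<lambda>n. LINT \<omega>|M. Vs n \<omega> \<bullet> (f (X k \<omega>) *\<^sub>R h)) \<longlonglongrightarrow> (LINT \<omega>|M. V \<omega> \<bullet> (f (X k \<omega>) *\<^sub>R h))"
    by (rule L2_inner_tendsto[OF L(2) VL fh lim(2)])
  moreover have "(\<lambda>n. (LINT \<omega>|M. Ws n \<omega> \<bullet> (f (X k \<omega>) * X h \<omega>)) - (k \<bullet> h) * (LINT \<omega>|M. Ws n \<omega> \<bullet> f' (X k \<omega>)))
     \<longlonglongrightarrow> (LINT \<omega>|M. W \<omega> \<bullet> (f (X k \<omega>) * X h \<omega>)) - (k \<bullet> h) * (LINT \<omega>|M. W \<omega> \<bullet> f' (X k \<omega>))"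
    by (intro tendsto_intros L2_inner_tendsto[OF L(1) WL fX lim(1)] L2_inner_tendsto[OF L(1) WL f'L lim(1)])
  ultimately have "(LINT \<omega>|M. V \<omega> \<bullet> (f (X k \<omega>) *\<^sub>R h))
     = (LINT \<omega>|M. W \<omega> \<bullet> (f (X k \<omega>) * X h \<omega>)) - (k \<bullet> h) * (LINT \<omega>|M. W \<omega> \<bullet> f' (X k \<omega>))"
    by (simp add: LIMSEQ_unique)
  then show ?thesis by simp
qed

text \<open>Closability of the derivative in weak form: the inner product of the difference of two
  derivatives with \<open>h\<close> is orthogonal to all exponentials of the process.\<close>

lemma malliavin_deriv_unique_inner:
  assumes V: "has_malliavin_deriv M X 2 W V" "has_malliavin_deriv M X 2 W V'"
  shows "AE \<omega> in M. V \<omega> \<bullet> h = V' \<omega> \<bullet> h"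
proof -
  have VL: "V \<in> Lp_fun M 2" "V' \<in> Lp_fun M 2" using V unfolding has_malliavin_deriv_L2_iff by auto
  have unit: "AE \<omega> in M. (V \<omega> - V' \<omega>) \<bullet> h = 0" if h: "norm h = 1" for h
  proof (rule orthogonal_exponentials_zero)
    have i: "integrable M (\<lambda>\<omega>. Q \<omega> \<bullet> h)" if "Q \<in> Lp_fun M 2" for Q
      by (rule L2_inner_integrable[OF that L2_const])
    then show ih: "integrable M (\<lambda>\<omega>. (V \<omega> - V' \<omega>) \<bullet> h)" using L2_diff[OF VL] by simp
    fix k
    have z: "(LINT \<omega>|M. f (X k \<omega>) * ((V \<omega> - V' \<omega>) \<bullet> h)) = 0"
      if f: "\<And>x. (f has_real_derivative f' x) (at x)" "continuous_on UNIV f'"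
        and bound: "\<And>x. \<bar>f x\<bar> \<le> B" "\<And>x. \<bar>f' x\<bar> \<le> B'" for f f' B B'
    proof -
      have cf: "continuous_on UNIV f" using f(1) by (auto intro!: continuous_at_imp_continuous_on DERIV_isCont)
      then have [measurable]: "f \<in> borel_measurable borel" by (rule borel_measurable_continuous_onI)
      have j: "integrable M (\<lambda>\<omega>. f (X k \<omega>) * (Q \<omega> \<bullet> h))" if Q: "Q \<in> Lp_fun M 2" for Q
        using L2_inner_integrable[OF L2_bounded_mult[OF Q, of "\<lambda>\<omega>. f (X k \<omega>)" B] L2_const[of h]] bound(1) by simp
      have "(LINT \<omega>|M. f (X k \<omega>) * ((V \<omega> - V' \<omega>) \<bullet> h))
         = (LINT \<omega>|M. f (X k \<omega>) * (V \<omega> \<bullet> h)) - (LINT \<omega>|M. f (X k \<omega>) * (V' \<omega> \<bullet> h))"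
        unfolding inner_diff_left right_diff_distrib using j VL by simp
      then show ?thesis
        using malliavin_deriv_test[OF V(1) h f bound, of k] malliavin_deriv_test[OF V(2) h f bound, of k] by simp
    qed
    have c: "(LINT \<omega>|M. cos (X k \<omega>) * ((V \<omega> - V' \<omega>) \<bullet> h)) = 0"
      by (rule z[of cos "\<lambda>x. - sin x" 1 1]) (auto intro!: derivative_eq_intros continuous_intros)
    have s: "(LINT \<omega>|M. sin (X k \<omega>) * ((V \<omega> - V' \<omega>) \<bullet> h)) = 0"
      by (rule z[of sin cos 1 1]) (auto intro!: derivative_eq_intros continuous_intros)
    have int: "complex_integrable M (\<lambda>\<omega>. of_real ((V \<omega> - V' \<omega>) \<bullet> h) * iexp (X k \<omega>))"
      by (rule integrable_mult_iexp) (use ih in auto)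
    show "(CLINT \<omega>|M. of_real ((V \<omega> - V' \<omega>) \<bullet> h) * iexp (X k \<omega>)) = 0"
      using c s Bochner_Integration.integral_Re[OF int] Bochner_Integration.integral_Im[OF int]
      by (simp add: complex_eq_iff Re_exp Im_exp mult.commute)
  qed
  show ?thesis
  proof (cases "h = 0")
    case False
    define g where "g = (1 / norm h) *\<^sub>R h"
    have g: "norm g = 1" "h = norm h *\<^sub>R g" using False by (simp_all add: g_def)
    show ?thesis using unit[OF g(1)]
      by eventually_elim (subst (1 2) g(2), simp add: inner_diff_left)
  qed simp
qed

text \<open>Derivatives of cylindrical variables take values in a finite-dimensional space, so finitely
  many directions \<open>h\<close> suffice.\<close>

lemma cyl_inner_malliavin_unique:
  assumes cyl: "cyl \<Phi> D" and V: "has_malliavin_deriv M X 2 W V" "has_malliavin_deriv M X 2 W V'"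
  shows "(LINT \<omega>|M. D \<omega> \<bullet> V \<omega>) = (LINT \<omega>|M. D \<omega> \<bullet> V' \<omega>)"
proof (rule integral_cong_AE)
  have VL: "V \<in> Lp_fun M 2" "V' \<in> Lp_fun M 2" using V unfolding has_malliavin_deriv_L2_iff by auto
  show "(\<lambda>\<omega>. D \<omega> \<bullet> V \<omega>) \<in> borel_measurable M" "(\<lambda>\<omega>. D \<omega> \<bullet> V' \<omega>) \<in> borel_measurable M"
    using L2_inner_integrable[OF cyl_deriv_L2[OF cyl]] VL by auto
  obtain n \<phi> d\<psi> where D: "D = (\<lambda>\<omega>. \<Sum>i<n. d\<psi> i (coord_vec X n \<phi> \<omega>) *\<^sub>R \<phi> i)"
    using cyl unfolding cyl_def by blast
  have "AE \<omega> in M. \<forall>i\<in>{..<n}. V \<omega> \<bullet> \<phi> i = V' \<omega> \<bullet> \<phi> i"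
    by (intro AE_finite_allI malliavin_deriv_unique_inner[OF V]) simp
  then show "AE \<omega> in M. D \<omega> \<bullet> V \<omega> = D \<omega> \<bullet> V' \<omega>"
    unfolding D by eventually_elim (auto intro!: sum.cong simp: inner_sum_left inner_commute[of "\<phi> _"])
qed

lemma has_malliavin_deriv_malliavin_deriv:
  "has_malliavin_deriv M X 2 F U \<Longrightarrow> has_malliavin_deriv M X 2 F (malliavin_deriv M X F)"
  unfolding malliavin_deriv_def using someI[of "has_malliavin_deriv M X 2 F" U] by simp

text \<open>For smooth \<open>F\<close> the composition \<open>f(F)\<close> is cylindrical, and the formula is the duality on the chaos
  expansion of \<open>G\<close>. In the limit, \<open>f(F)\<close> converges in \<open>L\<^sup>2\<close> because \<open>f\<close> is Lipschitz; for the
  right-hand side, the derivatives converge in \<open>L\<^sup>2\<close> and the bounded factor \<open>f'(F)\<close> almost surely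
  along a subsequence.\<close>

lemma malliavin_ibp:
  assumes F: "has_malliavin_deriv M X 2 F U" and G: "G \<in> Lp_fun M 2"
    and f: "\<And>x. (f has_real_derivative f' x) (at x)" "continuous_on UNIV f'"
    and bound: "\<And>x. \<bar>f x\<bar> \<le> B" "\<And>x. \<bar>f' x\<bar> \<le> B'"
  defines "V \<equiv> malliavin_deriv M X (OU_pinv M X G)"
  shows "(LINT \<omega>|M. f (F \<omega>) * (G \<omega> - (LINT \<omega>|M. G \<omega>))) = (LINT \<omega>|M. f' (F \<omega>) * (U \<omega> \<bullet> (- V \<omega>)))"
proof -
  have cf: "continuous_on UNIV f" using f(1) by (auto intro!: continuous_at_imp_continuous_on DERIV_isCont)
  have [measurable]: "f \<in> borel_measurable borel" "f' \<in> borel_measurable borel"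
    using cf f(2) by (auto intro: borel_measurable_continuous_onI)
  obtain V0 where V0: "has_malliavin_deriv M X 2 (OU_pinv M X G) V0"
    and V0_inner: "\<And>\<Phi> D. cyl \<Phi> D \<Longrightarrow> (LINT \<omega>|M. D \<omega> \<bullet> V0 \<omega>) = - (LINT \<omega>|M. \<Phi> \<omega> * (G \<omega> - (LINT \<omega>|M. G \<omega>)))"
    using OU_pinv_malliavin[OF G] by blast
  have V: "has_malliavin_deriv M X 2 (OU_pinv M X G) V"
    unfolding V_def by (rule has_malliavin_deriv_malliavin_deriv[OF V0])
  have V_inner: "(LINT \<omega>|M. D \<omega> \<bullet> V \<omega>) = - (LINT \<omega>|M. \<Phi> \<omega> * (G \<omega> - (LINT \<omega>|M. G \<omega>)))" if "cyl \<Phi> D" for \<Phi> D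
    using cyl_inner_malliavin_unique[OF that V V0] V0_inner[OF that] by simp
  have VL: "V \<in> Lp_fun M 2" using V unfolding has_malliavin_deriv_L2_iff by blast
  obtain Fs Us where FL: "F \<in> Lp_fun M 2" and UL: "U \<in> Lp_fun M 2" and sm: "\<And>n. smooth_rv_deriv X (Fs n) (Us n)"
    and limF: "(\<lambda>n. l2norm M (\<lambda>\<omega>. Fs n \<omega> - F \<omega>)) \<longlonglongrightarrow> 0" and limU: "(\<lambda>n. l2norm M (\<lambda>\<omega>. Us n \<omega> - U \<omega>)) \<longlonglongrightarrow> 0"
    using F unfolding has_malliavin_deriv_L2_iff by blast
  have cyl: "cyl (Fs n) (Us n)" for n by (rule smooth_rv_deriv_cyl[OF sm])
  note FsL = cyl_L2[OF cyl] and UsL = cyl_deriv_L2[OF cyl]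
  have [measurable]: "F \<in> borel_measurable M" "U \<in> borel_measurable M" "V \<in> borel_measurable M"
    "Fs n \<in> borel_measurable M" "Us n \<in> borel_measurable M" for n
    using FL UL VL FsL UsL by (auto intro: L2_measurable)
  define S where "S = (\<lambda>\<omega>. G \<omega> - (LINT \<omega>|M. G \<omega>))"
  have SL: "S \<in> Lp_fun M 2" unfolding S_def by (intro L2_diff G L2_const)
  have fL: "(\<lambda>\<omega>. f (Q \<omega>)) \<in> Lp_fun M 2" if [measurable]: "Q \<in> borel_measurable M" for Q
    by (rule L2_bound[OF L2_const[of B]]) (use bound(1) in \<open>auto intro: order_trans[OF _ abs_ge_self]\<close>)
  have smooth_ibp: "(LINT \<omega>|M. f' (Fs n \<omega>) * (Us n \<omega> \<bullet> V \<omega>)) = - (LINT \<omega>|M. f (Fs n \<omega>) \<bullet> S \<omega>)" for n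
    using V_inner[OF cyl_comp[OF cyl f bound]] by (simp add: S_def)
  have lhs: "(\<lambda>n. LINT \<omega>|M. f (Fs n \<omega>) \<bullet> S \<omega>) \<longlonglongrightarrow> (LINT \<omega>|M. f (F \<omega>) \<bullet> S \<omega>)"
  proof (rule L2_inner_tendsto[OF fL fL SL])
    have B': "0 \<le> B'" using bound(2)[of 0] by simp
    have lip: "\<bar>f x - f y\<bar> \<le> B' * \<bar>x - y\<bar>" for x y
      using field_differentiable_bound[of UNIV f f' B' x y] f(1) bound(2) by simp
    show "(\<lambda>n. l2norm M (\<lambda>\<omega>. f (Fs n \<omega>) - f (F \<omega>))) \<longlonglongrightarrow> 0"
    proof (rule Lim_null_comparison)
      show "(\<lambda>n. B' * l2norm M (\<lambda>\<omega>. Fs n \<omega> - F \<omega>)) \<longlonglongrightarrow> 0" using limF by (rule tendsto_mult_right_zero)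
      have "l2norm M (\<lambda>\<omega>. f (Fs n \<omega>) - f (F \<omega>)) \<le> B' * l2norm M (\<lambda>\<omega>. Fs n \<omega> - F \<omega>)" for n
      proof -
        have d: "(\<lambda>\<omega>. B' *\<^sub>R (Fs n \<omega> - F \<omega>)) \<in> Lp_fun M 2" by (intro L2_scaleR L2_diff FsL FL)
        have "(LINT \<omega>|M. (norm (f (Fs n \<omega>) - f (F \<omega>)))\<^sup>2) \<le> (LINT \<omega>|M. (norm (B' *\<^sub>R (Fs n \<omega> - F \<omega>)))\<^sup>2)"
        proof (rule integral_mono)
          show "integrable M (\<lambda>\<omega>. (norm (f (Fs n \<omega>) - f (F \<omega>)))\<^sup>2)"
            using L2_diff[OF fL[of "Fs n"] fL[of F]] by (simp add: L2_iff)
          show "integrable M (\<lambda>\<omega>. (norm (B' *\<^sub>R (Fs n \<omega> - F \<omega>)))\<^sup>2)" using d by (simp add: L2_iff)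
          show "(norm (f (Fs n \<omega>) - f (F \<omega>)))\<^sup>2 \<le> (norm (B' *\<^sub>R (Fs n \<omega> - F \<omega>)))\<^sup>2" for \<omega>
            using lip[of "Fs n \<omega>" "F \<omega>"] B' by (intro power_mono) (auto simp: abs_mult)
        qed
        then have "l2norm M (\<lambda>\<omega>. f (Fs n \<omega>) - f (F \<omega>)) \<le> l2norm M (\<lambda>\<omega>. B' *\<^sub>R (Fs n \<omega> - F \<omega>))"
          unfolding l2norm_def by (rule real_sqrt_le_mono)
        then show ?thesis using B' by (simp only: l2norm_scaleR abs_of_nonneg)
      qed
      then show "\<forall>\<^sub>F n in sequentially. norm (l2norm M (\<lambda>\<omega>. f (Fs n \<omega>) - f (F \<omega>))) \<le> B' * l2norm M (\<lambda>\<omega>. Fs n \<omega> - F \<omega>)"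
        by simp
    qed
  qed measurable
  have "\<exists>r. strict_mono r \<and> (AE \<omega> in M. (\<lambda>n. Fs (r n) \<omega> - F \<omega>) \<longlonglongrightarrow> 0)"
  proof (rule tendsto_L1_AE_subseq)
    show "integrable M (\<lambda>\<omega>. Fs n \<omega> - F \<omega>)" for n by (rule L2_integrable[OF L2_diff[OF FsL FL]])
    show "(\<lambda>n. LINT \<omega>|M. norm (Fs n \<omega> - F \<omega>)) \<longlonglongrightarrow> 0"
      by (rule Lim_null_comparison[OF always_eventually limF]) (use L1_le_l2norm[OF L2_diff[OF FsL FL]] in auto)
  qed
  then obtain r where r: "strict_mono r" and ae: "AE \<omega> in M. (\<lambda>n. Fs (r n) \<omega> - F \<omega>) \<longlonglongrightarrow> 0" by blast
  have main: "(\<lambda>n. LINT \<omega>|M. f' (Fs (r n) \<omega>) * (U \<omega> \<bullet> V \<omega>)) \<longlonglongrightarrow> (LINT \<omega>|M. f' (F \<omega>) * (U \<omega> \<bullet> V \<omega>))"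
  proof (rule integral_dominated_convergence)
    show "integrable M (\<lambda>\<omega>. B' * norm (U \<omega> \<bullet> V \<omega>))"
      using L2_inner_integrable[OF UL VL] by simp
    show "AE \<omega> in M. (\<lambda>n. f' (Fs (r n) \<omega>) * (U \<omega> \<bullet> V \<omega>)) \<longlonglongrightarrow> f' (F \<omega>) * (U \<omega> \<bullet> V \<omega>)"
      using ae
    proof eventually_elim
      case (elim \<omega>)
      then have "(\<lambda>n. Fs (r n) \<omega>) \<longlonglongrightarrow> F \<omega>" by (rule LIM_zero_cancel)
      then have "(\<lambda>n. f' (Fs (r n) \<omega>)) \<longlonglongrightarrow> f' (F \<omega>)"
        using f(2) by (intro continuous_on_tendsto_compose[OF f(2)]) auto
      then show ?case by (rule tendsto_mult_right)
    qed
    show "AE \<omega> in M. norm (f' (Fs (r n) \<omega>) * (U \<omega> \<bullet> V \<omega>)) \<le> B' * norm (U \<omega> \<bullet> V \<omega>)" for n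
      using bound(2) by (auto simp: abs_mult intro!: mult_right_mono)
  qed measurable
  have err: "(\<lambda>n. LINT \<omega>|M. f' (Fs (r n) \<omega>) * ((Us (r n) \<omega> - U \<omega>) \<bullet> V \<omega>)) \<longlonglongrightarrow> 0"
  proof (rule Lim_null_comparison)
    show "(\<lambda>n. B' * (l2norm M (\<lambda>\<omega>. Us (r n) \<omega> - U \<omega>) * l2norm M V)) \<longlonglongrightarrow> 0"
      using LIMSEQ_subseq_LIMSEQ[OF limU r] by (intro tendsto_mult_right_zero tendsto_mult_left_zero) (simp add: comp_def)
    have "norm (LINT \<omega>|M. f' (Fs n \<omega>) * ((Us n \<omega> - U \<omega>) \<bullet> V \<omega>)) \<le> B' * (l2norm M (\<lambda>\<omega>. Us n \<omega> - U \<omega>) * l2norm M V)" for n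
    proof -
      have d: "(\<lambda>\<omega>. Us n \<omega> - U \<omega>) \<in> Lp_fun M 2" by (rule L2_diff[OF UsL UL])
      have B': "0 \<le> B'" using bound(2)[of 0] by simp
      have i: "integrable M (\<lambda>\<omega>. B' * (norm (Us n \<omega> - U \<omega>) * norm (V \<omega>)))"
        by (intro integrable_mult_right L2_norm_mult_integrable[OF d VL])
      have le: "norm (f' (Fs n \<omega>) * ((Us n \<omega> - U \<omega>) \<bullet> V \<omega>)) \<le> B' * (norm (Us n \<omega> - U \<omega>) * norm (V \<omega>))" for \<omega>
        unfolding norm_mult using bound(2)[of "Fs n \<omega>"] Cauchy_Schwarz_ineq2[of "Us n \<omega> - U \<omega>" "V \<omega>"] B'
        by (intro mult_mono) auto
      have "norm (LINT \<omega>|M. f' (Fs n \<omega>) * ((Us n \<omega> - U \<omega>) \<bullet> V \<omega>))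
         \<le> (LINT \<omega>|M. B' * (norm (Us n \<omega> - U \<omega>) * norm (V \<omega>)))"
      proof (rule order_trans[OF Bochner_Integration.integral_norm_bound], rule integral_mono[OF _ i le])
        show "integrable M (\<lambda>\<omega>. norm (f' (Fs n \<omega>) * ((Us n \<omega> - U \<omega>) \<bullet> V \<omega>)))"
        proof (rule Bochner_Integration.integrable_bound[OF i])
          show "AE \<omega> in M. norm (norm (f' (Fs n \<omega>) * ((Us n \<omega> - U \<omega>) \<bullet> V \<omega>)))
              \<le> norm (B' * (norm (Us n \<omega> - U \<omega>) * norm (V \<omega>)))"
            using order_trans[OF le abs_ge_self] by (simp only: norm_ge_zero real_norm_def abs_idempotent) simp
        qed measurable
      qed
      also have "\<dots> \<le> B' * (l2norm M (\<lambda>\<omega>. Us n \<omega> - U \<omega>) * l2norm M V)"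
        using L2_norm_mult_CS[OF d VL] B' by (simp add: mult_left_mono)
      finally show ?thesis .
    qed
    then show "\<forall>\<^sub>F n in sequentially. norm (LINT \<omega>|M. f' (Fs (r n) \<omega>) * ((Us (r n) \<omega> - U \<omega>) \<bullet> V \<omega>))
       \<le> B' * (l2norm M (\<lambda>\<omega>. Us (r n) \<omega> - U \<omega>) * l2norm M V)" by simp
  qed
  have split: "(LINT \<omega>|M. f' (Fs n \<omega>) * (U \<omega> \<bullet> V \<omega>)) + (LINT \<omega>|M. f' (Fs n \<omega>) * ((Us n \<omega> - U \<omega>) \<bullet> V \<omega>))
      = - (LINT \<omega>|M. f (Fs n \<omega>) \<bullet> S \<omega>)" for n
  proof -
    have j: "integrable M (\<lambda>\<omega>. f' (Fs n \<omega>) * (Q \<omega> \<bullet> V \<omega>))" if "Q \<in> Lp_fun M 2" for Q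
      using L2_inner_integrable[OF L2_bounded_mult[OF that, of "\<lambda>\<omega>. f' (Fs n \<omega>)" B'] VL] bound(2) by simp
    show ?thesis unfolding smooth_ibp[symmetric] inner_diff_left right_diff_distrib
      using j[OF UsL[of n]] j[OF UL] by simp
  qed
  have "(LINT \<omega>|M. f' (F \<omega>) * (U \<omega> \<bullet> V \<omega>)) + 0 = - (LINT \<omega>|M. f (F \<omega>) \<bullet> S \<omega>)"
  proof (rule LIMSEQ_unique)
    show "(\<lambda>n. - (LINT \<omega>|M. f (Fs (r n) \<omega>) \<bullet> S \<omega>)) \<longlonglongrightarrow> (LINT \<omega>|M. f' (F \<omega>) * (U \<omega> \<bullet> V \<omega>)) + 0"
      unfolding split[symmetric] by (rule tendsto_add[OF main err])
    show "(\<lambda>n. - (LINT \<omega>|M. f (Fs (r n) \<omega>) \<bullet> S \<omega>)) \<longlonglongrightarrow> - (LINT \<omega>|M. f (F \<omega>) \<bullet> S \<omega>)"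
      using tendsto_minus[OF LIMSEQ_subseq_LIMSEQ[OF lhs r]] by (simp add: comp_def)
  qed
  then show ?thesis by (simp add: S_def)
qed

text \<open>Real and imaginary part are the cases \<open>f(x) = cos (t x)\<close> and \<open>f(x) = sin (t x)\<close>.\<close>

lemma malliavin_ibp_iexp:
  assumes F: "has_malliavin_deriv M X 2 F U" and G: "G \<in> Lp_fun M 2"
  defines "V \<equiv> malliavin_deriv M X (OU_pinv M X G)"
  shows "integrable M (\<lambda>\<omega>. U \<omega> \<bullet> (- V \<omega>))"
    and "(CLINT \<omega>|M. of_real (G \<omega>) * iexp (t * F \<omega>)) = of_real (LINT \<omega>|M. G \<omega>) * (CLINT \<omega>|M. iexp (t * F \<omega>))
      + \<i> * t * (CLINT \<omega>|M. of_real (U \<omega> \<bullet> (- V \<omega>)) * iexp (t * F \<omega>))"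
proof -
  have FUL: "F \<in> Lp_fun M 2" "U \<in> Lp_fun M 2" using F unfolding has_malliavin_deriv_L2_iff by auto
  then have [measurable]: "F \<in> borel_measurable M" by (simp add: L2_iff)
  have VL: "V \<in> Lp_fun M 2"
    using OU_pinv_malliavin[OF G] has_malliavin_deriv_malliavin_deriv unfolding V_def has_malliavin_deriv_L2_iff by blast
  show int: "integrable M (\<lambda>\<omega>. U \<omega> \<bullet> (- V \<omega>))"
    by (rule L2_inner_integrable[OF FUL(2) L2_uminus[OF VL]])
  define \<mu> where "\<mu> = (LINT \<omega>|M. G \<omega>)"
  define \<Gamma> where "\<Gamma> = (\<lambda>\<omega>. U \<omega> \<bullet> (- V \<omega>))"
  have gi: "integrable M \<Gamma>" using int by (simp add: \<Gamma>_def)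
  have b: "\<bar>t * sin (t * x)\<bar> \<le> \<bar>t\<bar>" "\<bar>t * cos (t * x)\<bar> \<le> \<bar>t\<bar>" for x
    using mult_left_mono[OF abs_sin_le_one, of "\<bar>t\<bar>" "t * x"] mult_left_mono[OF abs_cos_le_one, of "\<bar>t\<bar>" "t * x"]
    by (auto simp: abs_mult)
  have c: "(LINT \<omega>|M. cos (t * F \<omega>) * (G \<omega> - \<mu>)) = (LINT \<omega>|M. (- t * sin (t * F \<omega>)) * \<Gamma> \<omega>)"
    unfolding \<mu>_def \<Gamma>_def V_def
    by (rule malliavin_ibp[OF F G, of "\<lambda>x. cos (t * x)" "\<lambda>x. - t * sin (t * x)" 1 "\<bar>t\<bar>"])
      (use b in \<open>auto intro!: derivative_eq_intros continuous_intros\<close>)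
  have s: "(LINT \<omega>|M. sin (t * F \<omega>) * (G \<omega> - \<mu>)) = (LINT \<omega>|M. (t * cos (t * F \<omega>)) * \<Gamma> \<omega>)"
    unfolding \<mu>_def \<Gamma>_def V_def
    by (rule malliavin_ibp[OF F G, of "\<lambda>x. sin (t * x)" "\<lambda>x. t * cos (t * x)" 1 "\<bar>t\<bar>"])
      (use b in \<open>auto intro!: derivative_eq_intros continuous_intros\<close>)
  have i1: "complex_integrable M (\<lambda>\<omega>. of_real (G \<omega> - \<mu>) * iexp (t * F \<omega>))"
    by (rule integrable_mult_iexp) (use L2_integrable[OF G] in auto)
  have i2: "complex_integrable M (\<lambda>\<omega>. \<i> * of_real t * (of_real (\<Gamma> \<omega>) * iexp (t * F \<omega>)))"
    by (intro integrable_mult_right integrable_mult_iexp) (use gi in auto)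
  have "(CLINT \<omega>|M. of_real (G \<omega> - \<mu>) * iexp (t * F \<omega>)) = (CLINT \<omega>|M. \<i> * of_real t * (of_real (\<Gamma> \<omega>) * iexp (t * F \<omega>)))"
  proof (rule complex_eqI)
    show "Re (CLINT \<omega>|M. of_real (G \<omega> - \<mu>) * iexp (t * F \<omega>)) = Re (CLINT \<omega>|M. \<i> * of_real t * (of_real (\<Gamma> \<omega>) * iexp (t * F \<omega>)))"
      unfolding Bochner_Integration.integral_Re[OF i1, symmetric] Bochner_Integration.integral_Re[OF i2, symmetric]
      using c by (simp add: Re_exp Im_exp mult_ac)
    show "Im (CLINT \<omega>|M. of_real (G \<omega> - \<mu>) * iexp (t * F \<omega>)) = Im (CLINT \<omega>|M. \<i> * of_real t * (of_real (\<Gamma> \<omega>) * iexp (t * F \<omega>)))"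
      unfolding Bochner_Integration.integral_Im[OF i1, symmetric] Bochner_Integration.integral_Im[OF i2, symmetric]
      using s by (simp add: Re_exp Im_exp mult_ac)
  qed
  also have "\<dots> = \<i> * t * (CLINT \<omega>|M. of_real (\<Gamma> \<omega>) * iexp (t * F \<omega>))" by simp
  also have "(CLINT \<omega>|M. of_real (G \<omega> - \<mu>) * iexp (t * F \<omega>))
     = (CLINT \<omega>|M. of_real (G \<omega>) * iexp (t * F \<omega>)) - of_real \<mu> * (CLINT \<omega>|M. iexp (t * F \<omega>))"
  proof -
    have j1: "complex_integrable M (\<lambda>\<omega>. of_real (G \<omega>) * iexp (t * F \<omega>))"
      by (rule integrable_mult_iexp) (use L2_integrable[OF G] in auto)
    have j2: "complex_integrable M (\<lambda>\<omega>. of_real \<mu> * iexp (t * F \<omega>))"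
      by (rule integrable_mult_iexp) auto
    show ?thesis using j1 j2 by (simp add: left_diff_distrib)
  qed
  finally show "(CLINT \<omega>|M. of_real (G \<omega>) * iexp (t * F \<omega>)) = of_real (LINT \<omega>|M. G \<omega>) * (CLINT \<omega>|M. iexp (t * F \<omega>))
      + \<i> * t * (CLINT \<omega>|M. of_real (U \<omega> \<bullet> (- V \<omega>)) * iexp (t * F \<omega>))"
    by (simp add: \<mu>_def \<Gamma>_def algebra_simps)
qed

lemma exp_growth_coord_square_L2:
  assumes "continuous_on UNIV \<psi>" "exp_growth n \<psi>"
  shows "(\<lambda>\<omega>. (\<psi> (coord_vec X n \<phi> \<omega>))\<^sup>2) \<in> Lp_fun M 2"
  unfolding power2_eq_square
  using exp_growth_coord_L2[OF continuous_on_mult[OF assms(1,1)] exp_growth_mult[OF assms(2,2)]] .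

lemma cyl_L4:
  assumes "cyl \<Phi> U"
  shows "\<Phi> \<in> Lp_fun M 4" "U \<in> Lp_fun M 4"
proof -
  obtain n \<phi> \<psi> d\<psi> where C1: "C1_fun n \<psi> d\<psi>" and \<Phi>: "\<Phi> = (\<lambda>\<omega>. \<psi> (coord_vec X n \<phi> \<omega>))"
    and U: "U = (\<lambda>\<omega>. \<Sum>i<n. d\<psi> i (coord_vec X n \<phi> \<omega>) *\<^sub>R \<phi> i)" using assms unfolding cyl_def by blast
  have "(\<lambda>\<omega>. (\<psi> (coord_vec X n \<phi> \<omega>))\<^sup>2) \<in> Lp_fun M 2"
    using C1 unfolding C1_fun_def by (intro exp_growth_coord_square_L2) auto
  then show "\<Phi> \<in> Lp_fun M 4"
    using L2_measurable[OF cyl_L2[OF assms]] by (simp add: L4_iff \<Phi>)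
  have "(\<lambda>\<omega>. d\<psi> i (coord_vec X n \<phi> \<omega>) *\<^sub>R \<phi> i) \<in> Lp_fun M 4" if i: "i < n" for i
  proof -
    have c: "continuous_on UNIV (d\<psi> i)" "exp_growth n (d\<psi> i)" using C1 i unfolding C1_fun_def by auto
    have "(\<lambda>\<omega>. (norm (\<phi> i))\<^sup>2 * (d\<psi> i (coord_vec X n \<phi> \<omega>))\<^sup>2) \<in> Lp_fun M 2"
      by (intro L2_mult_const exp_growth_coord_square_L2 c)
    moreover have "(\<lambda>\<omega>. d\<psi> i (coord_vec X n \<phi> \<omega>) *\<^sub>R \<phi> i) \<in> borel_measurable M"
      using L2_measurable[OF exp_growth_coord_L2[OF c, of \<phi>]] by simp
    ultimately show ?thesis by (simp add: L4_iff power_mult_distrib mult.commute)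
  qed
  then have "(\<lambda>\<omega>. \<Sum>i\<in>I. d\<psi> i (coord_vec X n \<phi> \<omega>) *\<^sub>R \<phi> i) \<in> Lp_fun M 4" if "I \<subseteq> {..<n}" for I
    using that
  proof (induction I rule: infinite_finite_induct)
    case (insert i I) then show ?case by (auto intro!: L4_add)
  qed (simp_all add: L4_iff L2_zero)
  then show "U \<in> Lp_fun M 4" unfolding U by blast
qed

text \<open>The derivative used in the recursion for \<open>\<Gamma>\<^sub>j(F)\<close> is the one on \<open>\<D>\<^bsup>1,2\<^esup>\<close>. Smooth variables and
  their derivatives have fourth moments, so the differences from the limit lie in \<open>L\<^sup>4\<close>, where the
  \<open>L\<^sup>2\<close> norm is the smaller one.\<close>

lemma has_malliavin_deriv_4_imp_2:
  assumes "has_malliavin_deriv M X 4 F U"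
  shows "has_malliavin_deriv M X 2 F U"
proof -
  obtain Fs Us where FL: "F \<in> Lp_fun M 4" and UL: "U \<in> Lp_fun M 4" and sm: "\<And>n. smooth_rv_deriv X (Fs n) (Us n)"
    and lim: "(\<lambda>n. (LINT \<omega>|M. \<bar>Fs n \<omega> - F \<omega>\<bar> powr 4) + (LINT \<omega>|M. norm (Us n \<omega> - U \<omega>) powr 4)) \<longlonglongrightarrow> 0"
    using assms unfolding has_malliavin_deriv_def by blast
  define a where "a = (\<lambda>n. (LINT \<omega>|M. norm (Fs n \<omega> - F \<omega>) powr 4) + (LINT \<omega>|M. norm (Us n \<omega> - U \<omega>) powr 4))"
  have cyl: "cyl (Fs n) (Us n)" for n by (rule smooth_rv_deriv_cyl[OF sm])
  have "a \<longlonglongrightarrow> 0" using lim by (simp add: a_def)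
  from tendsto_real_root[OF this, of 4] have ra: "(\<lambda>n. root 4 (a n)) \<longlonglongrightarrow> 0" by simp
  have d: "(\<lambda>\<omega>. Fs n \<omega> - F \<omega>) \<in> Lp_fun M 4" "(\<lambda>\<omega>. Us n \<omega> - U \<omega>) \<in> Lp_fun M 4" for n
    using L4_add[OF cyl_L4(1)[OF cyl] L4_uminus[OF FL]] L4_add[OF cyl_L4(2)[OF cyl] L4_uminus[OF UL]] by simp_all
  have "l2norm M (\<lambda>\<omega>. Fs n \<omega> - F \<omega>) \<le> root 4 (a n)" "l2norm M (\<lambda>\<omega>. Us n \<omega> - U \<omega>) \<le> root 4 (a n)" for n
    using l2norm_le_L4[OF d(1)[of n]] l2norm_le_L4[OF d(2)[of n]]
    by (auto simp: a_def elim!: order_trans)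
  then have "(\<lambda>n. l2norm M (\<lambda>\<omega>. Fs n \<omega> - F \<omega>)) \<longlonglongrightarrow> 0" "(\<lambda>n. l2norm M (\<lambda>\<omega>. Us n \<omega> - U \<omega>)) \<longlonglongrightarrow> 0"
    by (auto intro!: Lim_null_comparison[OF always_eventually ra])
  then show ?thesis unfolding has_malliavin_deriv_L2_iff
    using L4_imp_L2[OF FL] L4_imp_L2[OF UL] sm by blast
qed

end

section \<open>Differentiable curves and their expansions at zero\<close>

text \<open>\<open>k\<close> times continuously differentiable on \<open>S\<close>. Derivatives are two-sided, so \<open>S\<close> is
  meant to be open.\<close>

primrec Ck :: "nat \<Rightarrow> real set \<Rightarrow> (real \<Rightarrow> complex) \<Rightarrow> bool"
  where "Ck 0 S f = continuous_on S f"
  | "Ck (Suc k) S f = (\<exists>f'. (\<forall>t\<in>S. (f has_vector_derivative f' t) (at t)) \<and> Ck k S f')"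

lemma Ck_SucD: "Ck (Suc k) S f \<Longrightarrow> Ck k S f"
proof (induction k arbitrary: f)
  case 0
  then obtain f' where "\<forall>t\<in>S. (f has_vector_derivative f' t) (at t)" by auto
  then have "\<forall>t\<in>S. continuous (at t) f" using has_vector_derivative_continuous by blast
  then show ?case by (simp add: continuous_at_imp_continuous_on)
next
  case (Suc k)
  from Suc.prems obtain f' where f': "\<forall>t\<in>S. (f has_vector_derivative f' t) (at t)" "Ck (Suc k) S f'"
    by (subst (asm) Ck.simps(2)) blast
  from f'(1) Suc.IH[OF f'(2)] show ?case by auto
qed

lemma Ck_add: "Ck k S f \<Longrightarrow> Ck k S g \<Longrightarrow> Ck k S (\<lambda>t. f t + g t)"
proof (induction k arbitrary: f g)
  case 0 then show ?case by (auto intro: continuous_intros)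
next
  case (Suc k)
  then obtain f' g' where "\<forall>t\<in>S. (f has_vector_derivative f' t) (at t)" "Ck k S f'"
    "\<forall>t\<in>S. (g has_vector_derivative g' t) (at t)" "Ck k S g'" by auto
  then show ?case using Suc.IH
    by (auto intro!: exI[of _ "\<lambda>t. f' t + g' t"] has_vector_derivative_add)
qed

lemma Ck_mult: "Ck k S f \<Longrightarrow> Ck k S g \<Longrightarrow> Ck k S (\<lambda>t. f t * g t)"
proof (induction k arbitrary: f g)
  case 0 then show ?case by (auto intro: continuous_intros)
next
  case (Suc k)
  from Suc.prems obtain f' g' where *: "\<forall>t\<in>S. (f has_vector_derivative f' t) (at t)" "Ck k S f'"
    "\<forall>t\<in>S. (g has_vector_derivative g' t) (at t)" "Ck k S g'" by auto
  have "Ck k S (\<lambda>t. f t * g' t + f' t * g t)"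
    by (intro Ck_add Suc.IH * Ck_SucD[OF Suc.prems(1)] Ck_SucD[OF Suc.prems(2)])
  then show ?case using * by (auto intro!: exI[of _ "\<lambda>t. f t * g' t + f' t * g t"] has_vector_derivative_mult)
qed

lemma Ck_const: "Ck k S (\<lambda>t. c)"
  by (induction k arbitrary: c) (auto intro!: exI[of _ "\<lambda>_. 0"])

lemma Ck_inverse: "Ck k S f \<Longrightarrow> (\<And>t. t \<in> S \<Longrightarrow> f t \<noteq> 0) \<Longrightarrow> Ck k S (\<lambda>t. inverse (f t))"
proof (induction k arbitrary: f)
  case 0 then show ?case by (auto intro: continuous_intros)
next
  case (Suc k)
  from Suc.prems(1) obtain f' where *: "\<forall>t\<in>S. (f has_vector_derivative f' t) (at t)" "Ck k S f'" by auto
  note inv = Suc.IH[OF Ck_SucD[OF Suc.prems(1)] Suc.prems(2)]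
  have Ck': "Ck k S (\<lambda>t. f' t * ((- 1) * (inverse (f t) * inverse (f t))))"
    by (intro Ck_mult Ck_const inv *)
  have deriv: "((\<lambda>t. inverse (f t)) has_vector_derivative f' t * ((- 1) * (inverse (f t) * inverse (f t)))) (at t)" if "t \<in> S" for t
  proof -
    have "(inverse has_field_derivative - (inverse (f t) ^ Suc (Suc 0))) (at (f t))"
      by (rule DERIV_inverse) (rule Suc.prems(2)[OF that])
    from field_vector_diff_chain_at[where f = f and g = inverse, OF _ this] *(1) that show ?thesis by (simp add: comp_def)
  qed
  show ?case unfolding Ck.simps
    by (rule exI[where x = "\<lambda>t. f' t * ((- 1) * (inverse (f t) * inverse (f t)))"]) (intro conjI ballI deriv Ck')
qed

lemma Ck_chain:
  "Ck k S f \<Longrightarrow> \<exists>d. d 0 = f \<and> (\<forall>j<k. \<forall>t\<in>S. (d j has_vector_derivative d (Suc j) t) (at t)) \<and> continuous_on S (d k)"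
proof (induction k arbitrary: f)
  case 0 then show ?case by (intro exI[of _ "\<lambda>_. f"]) auto
next
  case (Suc k)
  then obtain f' where f': "\<forall>t\<in>S. (f has_vector_derivative f' t) (at t)" "Ck k S f'" by auto
  from Suc.IH[OF f'(2)] obtain d where d: "d 0 = f'"
    "\<forall>j<k. \<forall>t\<in>S. (d j has_vector_derivative d (Suc j) t) (at t)" "continuous_on S (d k)" by blast
  show ?case
  proof (intro exI[of _ "\<lambda>j. case j of 0 \<Rightarrow> f | Suc i \<Rightarrow> d i"] conjI allI impI ballI)
    fix j t assume "j < Suc k" "t \<in> S"
    then show "((case j of 0 \<Rightarrow> f | Suc i \<Rightarrow> d i) has_vector_derivative (case Suc j of 0 \<Rightarrow> f | Suc i \<Rightarrow> d i) t) (at t)"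
      using f' d by (cases j) auto
  qed (use d in auto)
qed

lemma Ck_if_chain:
  assumes "\<And>j t. j < k \<Longrightarrow> (d j has_vector_derivative d (Suc j) t) (at t)" "continuous_on UNIV (d k)"
  shows "i \<le> k \<Longrightarrow> Ck i S (d (k - i))"
proof (induction i)
  case 0 then show ?case using continuous_on_subset[OF assms(2)] by auto
next
  case (Suc i)
  then have "k - i = Suc (k - Suc i)" by simp
  with Suc assms(1)[of "k - Suc i"] show ?case by (auto intro!: exI[of _ "d (k - i)"])
qed

text \<open>Relates a chain of derivatives known on an open set only to the iterated derivative
  operator, which acts on functions on the whole line.\<close>

lemma iterated_vector_derivative:
  fixes d :: "nat \<Rightarrow> real \<Rightarrow> 'b::real_normed_vector"
  assumes "open S" and chain: "\<And>j t. j < k \<Longrightarrow> t \<in> S \<Longrightarrow> (d j has_vector_derivative d (Suc j) t) (at t)"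
  shows "j \<le> k \<Longrightarrow> t \<in> S \<Longrightarrow> ((\<lambda>f t. vector_derivative f (at t)) ^^ j) (d 0) t = d j t"
proof (induction j arbitrary: t)
  case (Suc j)
  then have "(d j has_vector_derivative d (Suc j) t) (at t)" using chain by auto
  then have "(((\<lambda>f t. vector_derivative f (at t)) ^^ j) (d 0) has_vector_derivative d (Suc j) t) (at t)"
    by (rule has_vector_derivative_transform_within_open[OF _ assms(1)]) (use Suc in auto)
  then show ?case by (simp add: vector_derivative_at)
qed simp

text \<open>\<open>f(t) = o(t\<^sup>m)\<close> as \<open>t \<rightarrow> 0\<close>, with the point \<open>t = 0\<close> itself excluded.\<close>

definition small_at_0 :: "nat \<Rightarrow> (real \<Rightarrow> 'b::real_normed_vector) \<Rightarrow> bool"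
  where "small_at_0 m f \<longleftrightarrow> (\<forall>e>0. \<exists>\<delta>>0. \<forall>t. 0 < \<bar>t\<bar> \<and> \<bar>t\<bar> < \<delta> \<longrightarrow> norm (f t) \<le> e * \<bar>t\<bar> ^ m)"

lemma small_at_0E:
  assumes "small_at_0 m f" "e > 0"
  obtains \<delta> where "\<delta> > 0" "\<And>t. 0 < \<bar>t\<bar> \<Longrightarrow> \<bar>t\<bar> < \<delta> \<Longrightarrow> norm (f t) \<le> e * \<bar>t\<bar> ^ m"
  using assms unfolding small_at_0_def by blast

lemma small_at_0_diff:
  assumes "small_at_0 m f" "small_at_0 m g"
  shows "small_at_0 m (\<lambda>t. f t - g t)"
  unfolding small_at_0_def
proof (intro allI impI)
  fix e :: real assume "e > 0"
  then have e: "e / 2 > 0" by simp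
  obtain a where a: "a > 0" "\<And>t. 0 < \<bar>t\<bar> \<Longrightarrow> \<bar>t\<bar> < a \<Longrightarrow> norm (f t) \<le> e/2 * \<bar>t\<bar> ^ m"
    using small_at_0E[OF assms(1) e] by blast
  obtain b where b: "b > 0" "\<And>t. 0 < \<bar>t\<bar> \<Longrightarrow> \<bar>t\<bar> < b \<Longrightarrow> norm (g t) \<le> e/2 * \<bar>t\<bar> ^ m"
    using small_at_0E[OF assms(2) e] by blast
  show "\<exists>\<delta>>0. \<forall>t. 0 < \<bar>t\<bar> \<and> \<bar>t\<bar> < \<delta> \<longrightarrow> norm (f t - g t) \<le> e * \<bar>t\<bar> ^ m"
  proof (intro exI[of _ "min a b"] conjI allI impI)
    fix t assume "0 < \<bar>t\<bar> \<and> \<bar>t\<bar> < min a b"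
    then show "norm (f t - g t) \<le> e * \<bar>t\<bar> ^ m"
      using a(2)[of t] b(2)[of t] norm_triangle_ineq4[of "f t" "g t"] by simp
  qed (use a b in auto)
qed

lemma small_at_0_tendsto:
  assumes "(r \<longlongrightarrow> 0) (at 0)"
  shows "small_at_0 m (\<lambda>t. of_real t ^ m * r t :: complex)"
  unfolding small_at_0_def
proof (intro allI impI)
  fix e :: real assume "e > 0"
  from tendstoD[OF assms this] obtain d where "d > 0" "\<And>t. t \<noteq> 0 \<Longrightarrow> \<bar>t\<bar> < d \<Longrightarrow> norm (r t) < e"
    by (auto simp: eventually_at)
  then show "\<exists>\<delta>>0. \<forall>t. 0 < \<bar>t\<bar> \<and> \<bar>t\<bar> < \<delta> \<longrightarrow> norm (of_real t ^ m * r t) \<le> e * \<bar>t\<bar> ^ m"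
    by (intro exI[of _ d]) (auto simp: norm_mult norm_power mult.commute[of e] intro!: mult_left_mono less_imp_le)
qed

text \<open>Peano's form of Taylor's theorem: the remainder of order \<open>m + 1\<close> has as its derivative the remainder
  of order \<open>m\<close> of the derivative.\<close>

lemma peano_expansion:
  fixes d :: "nat \<Rightarrow> real \<Rightarrow> complex"
  assumes "\<eta> > 0" and "\<And>j t. j < m \<Longrightarrow> \<bar>t\<bar> < \<eta> \<Longrightarrow> (d j has_vector_derivative d (Suc j) t) (at t)"
    and "isCont (d m) 0"
  shows "small_at_0 m (\<lambda>t. d 0 t - (\<Sum>j\<le>m. of_real (t ^ j / fact j) * d j 0))"
  using assms(2,3)
proof (induction m arbitrary: d)
  case 0
  have "(\<lambda>t. d 0 t - d 0 0) \<midarrow>0\<rightarrow> 0" using 0(2) by (simp add: isCont_def LIM_zero)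
  from small_at_0_tendsto[OF this, of 0] show ?case by simp
next
  case (Suc m)
  define e where "e = (\<lambda>t. d 0 t - (\<Sum>j\<le>Suc m. of_real (t ^ j / fact j) * d j 0))"
  define e' where "e' = (\<lambda>t. d (Suc 0) t - (\<Sum>j\<le>m. of_real (t ^ j / fact j) * d (Suc j) 0))"
  have e'_small: "small_at_0 m e'"
    unfolding e'_def by (rule Suc.IH) (use Suc.prems in auto)
  have de: "(e has_vector_derivative e' t) (at t)" if "\<bar>t\<bar> < \<eta>" for t
  proof -
    have t: "((\<lambda>t. of_real (t ^ Suc j / fact (Suc j)) * c) has_vector_derivative of_real (t ^ j / fact j) * c) (at t)"
      for j and c :: complex
    proof -
      have "((\<lambda>t. t ^ Suc j / fact (Suc j)) has_real_derivative (real (Suc j) * t ^ j) / fact (Suc j)) (at t)"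
        using DERIV_cdivide[OF DERIV_pow[of "Suc j" t UNIV], of "fact (Suc j)"] by simp
      moreover have "(real (Suc j) * t ^ j) / fact (Suc j) = t ^ j / fact j"
        by (simp add: fact_Suc del: of_nat_Suc)
      ultimately have "((\<lambda>t. t ^ Suc j / fact (Suc j)) has_real_derivative t ^ j / fact j) (at t)"
        by (simp only:)
      from has_vector_derivative_mult_left[OF has_vector_derivative_of_real[OF this]] show ?thesis .
    qed
    have s: "(\<Sum>j\<le>Suc m. of_real (t ^ j / fact j) * d j 0) = d 0 0 + (\<Sum>j\<le>m. of_real (t ^ Suc j / fact (Suc j)) * d (Suc j) 0)" for t
      by (subst sum.atMost_Suc_shift) simp
    have "((\<lambda>t. d 0 t - (d 0 0 + (\<Sum>j\<le>m. of_real (t ^ Suc j / fact (Suc j)) * d (Suc j) 0)))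
        has_vector_derivative d (Suc 0) t - (0 + (\<Sum>j\<le>m. of_real (t ^ j / fact j) * d (Suc j) 0))) (at t)"
      by (intro has_vector_derivative_diff has_vector_derivative_add has_vector_derivative_const
          has_vector_derivative_sum t Suc.prems(1)) (use that in auto)
    then show ?thesis unfolding e_def e'_def s by simp
  qed
  have e0: "e 0 = 0" by (simp add: e_def sum.atMost_shift)
  have "small_at_0 (Suc m) e"
    unfolding small_at_0_def
  proof (intro allI impI)
    fix \<epsilon> :: real assume eps: "\<epsilon> > 0"
    obtain \<delta> where \<delta>: "\<delta> > 0" "\<And>t. 0 < \<bar>t\<bar> \<Longrightarrow> \<bar>t\<bar> < \<delta> \<Longrightarrow> norm (e' t) \<le> \<epsilon> * \<bar>t\<bar> ^ m"
      using small_at_0E[OF e'_small eps] by blast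
    show "\<exists>\<delta>>0. \<forall>t. 0 < \<bar>t\<bar> \<and> \<bar>t\<bar> < \<delta> \<longrightarrow> norm (e t) \<le> \<epsilon> * \<bar>t\<bar> ^ Suc m"
    proof (intro exI[of _ "min \<delta> \<eta>"] conjI allI impI)
      fix t assume t: "0 < \<bar>t\<bar> \<and> \<bar>t\<bar> < min \<delta> \<eta>"
      have cont: "continuous_on (closed_segment 0 t) e"
        by (intro continuous_at_imp_continuous_on ballI has_vector_derivative_continuous[OF de])
          (use t in \<open>auto simp: closed_segment_eq_real_ivl split: if_splits\<close>)
      have "norm (e t - e 0) \<le> norm (t - 0) * (\<epsilon> * \<bar>t\<bar> ^ m)"
      proof (cases "t > 0")
        case True
        have "\<exists>x\<in>{0<..<t}. norm (e t - e 0) \<le> norm ((t - 0) *\<^sub>R e' x)"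
          by (rule mvt_general[of 0 t e "\<lambda>x h. h *\<^sub>R e' x"])
            (use True t cont in \<open>auto simp: closed_segment_eq_real_ivl intro!: de[unfolded has_vector_derivative_def]\<close>)
        then obtain x where x: "x \<in> {0<..<t}" "norm (e t - e 0) \<le> norm ((t - 0) *\<^sub>R e' x)" by blast
        have "norm (e' x) \<le> \<epsilon> * \<bar>x\<bar> ^ m" using \<delta>(2)[of x] x t by auto
        also have "\<dots> \<le> \<epsilon> * \<bar>t\<bar> ^ m" using eps x by (intro mult_left_mono power_mono) auto
        finally show ?thesis using x(2) mult_left_mono[of "norm (e' x)" "\<epsilon> * \<bar>t\<bar> ^ m" "norm t"] by simp
      next
        case False
        then have neg: "t < 0" using t by auto
        have "\<exists>x\<in>{t<..<0}. norm (e 0 - e t) \<le> norm ((0 - t) *\<^sub>R e' x)"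
          by (rule mvt_general[of t 0 e "\<lambda>x h. h *\<^sub>R e' x"])
            (use neg t cont in \<open>auto simp: closed_segment_eq_real_ivl intro!: de[unfolded has_vector_derivative_def]\<close>)
        then obtain x where x: "x \<in> {t<..<0}" "norm (e 0 - e t) \<le> norm ((0 - t) *\<^sub>R e' x)" by blast
        have "norm (e' x) \<le> \<epsilon> * \<bar>x\<bar> ^ m" using \<delta>(2)[of x] x t by auto
        also have "\<dots> \<le> \<epsilon> * \<bar>t\<bar> ^ m" using eps x by (intro mult_left_mono power_mono) auto
        finally show ?thesis using x(2) mult_left_mono[of "norm (e' x)" "\<epsilon> * \<bar>t\<bar> ^ m" "norm t"]
          by (simp add: norm_minus_commute)
      qed
      then show "norm (e t) \<le> \<epsilon> * \<bar>t\<bar> ^ Suc m" by (simp add: e0 mult_ac)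
    qed (use \<delta> assms(1) in auto)
  qed
  then show ?case by (simp only: e_def)
qed

lemma small_polynomial_zero:
  fixes c :: "nat \<Rightarrow> complex"
  assumes "small_at_0 m (\<lambda>t. \<Sum>j\<le>m. c j * of_real t ^ j)"
  shows "j \<le> m \<Longrightarrow> c j = 0"
  using assms
proof (induction m arbitrary: c j)
  case 0
  have "norm (c 0) \<le> 0 + e" if e: "e > 0" for e
  proof -
    obtain \<delta> where \<delta>: "\<delta> > 0" "\<And>t. 0 < \<bar>t\<bar> \<Longrightarrow> \<bar>t\<bar> < \<delta> \<Longrightarrow> norm (\<Sum>j\<le>0. c j * of_real t ^ j) \<le> e * \<bar>t\<bar> ^ 0"
      using small_at_0E[OF 0(2) e] by blast
    have "norm (\<Sum>j\<le>0. c j * of_real (\<delta> / 2) ^ j) \<le> e * \<bar>\<delta> / 2\<bar> ^ 0"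
      by (rule \<delta>(2)) (use \<delta>(1) in auto)
    then show ?thesis by simp
  qed
  then have "norm (c 0) \<le> 0" by (rule field_le_epsilon)
  then show ?case using 0(1) by simp
next
  case (Suc m)
  have shift: "(\<Sum>j\<le>Suc m. c j * of_real t ^ j) = c 0 + of_real t * (\<Sum>j\<le>m. c (Suc j) * of_real t ^ j)" for t :: real
    by (subst sum.atMost_Suc_shift) (simp add: sum_distrib_left mult_ac)
  have "((\<lambda>t. \<Sum>j\<le>Suc m. c j * of_real t ^ j) \<longlongrightarrow> c 0 + of_real 0 * (\<Sum>j\<le>m. c (Suc j) * of_real 0 ^ j)) (at (0::real))"
    unfolding shift by (intro tendsto_intros)
  then have l1: "((\<lambda>t. \<Sum>j\<le>Suc m. c j * of_real t ^ j) \<longlongrightarrow> c 0) (at (0::real))" by simp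
  have l2: "((\<lambda>t. \<Sum>j\<le>Suc m. c j * of_real t ^ j) \<longlongrightarrow> 0) (at (0::real))"
  proof (rule Lim_null_comparison)
    obtain \<delta> where \<delta>: "\<delta> > 0" "\<And>t. 0 < \<bar>t\<bar> \<Longrightarrow> \<bar>t\<bar> < \<delta> \<Longrightarrow> norm (\<Sum>j\<le>Suc m. c j * of_real t ^ j) \<le> 1 * \<bar>t\<bar> ^ Suc m"
      using small_at_0E[OF Suc.prems(2) zero_less_one] by blast
    show "\<forall>\<^sub>F t in at 0. norm (\<Sum>j\<le>Suc m. c j * of_real t ^ j) \<le> \<bar>t\<bar> ^ Suc m"
      unfolding eventually_at using \<delta> by (intro exI[of _ \<delta>]) auto
    have "((\<lambda>t::real. \<bar>t\<bar> ^ Suc m) \<longlongrightarrow> \<bar>0\<bar> ^ Suc m) (at 0)" by (intro tendsto_intros)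
    then show "((\<lambda>t::real. \<bar>t\<bar> ^ Suc m) \<longlongrightarrow> 0) (at 0)" by simp
  qed
  have c0: "c 0 = 0" by (rule LIM_unique[OF l1 l2])
  have "small_at_0 m (\<lambda>t. \<Sum>j\<le>m. c (Suc j) * of_real t ^ j)"
    unfolding small_at_0_def
  proof (intro allI impI)
    fix e :: real assume e: "e > 0"
    obtain \<delta> where \<delta>: "\<delta> > 0" "\<And>t. 0 < \<bar>t\<bar> \<Longrightarrow> \<bar>t\<bar> < \<delta> \<Longrightarrow> norm (\<Sum>j\<le>Suc m. c j * of_real t ^ j) \<le> e * \<bar>t\<bar> ^ Suc m"
      using small_at_0E[OF Suc.prems(2) e] by blast
    show "\<exists>\<delta>>0. \<forall>t. 0 < \<bar>t\<bar> \<and> \<bar>t\<bar> < \<delta> \<longrightarrow> norm (\<Sum>j\<le>m. c (Suc j) * of_real t ^ j) \<le> e * \<bar>t\<bar> ^ m"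
    proof (intro exI[of _ \<delta>] conjI allI impI)
      fix t assume t: "0 < \<bar>t\<bar> \<and> \<bar>t\<bar> < \<delta>"
      have "\<bar>t\<bar> * norm (\<Sum>j\<le>m. c (Suc j) * of_real t ^ j) \<le> \<bar>t\<bar> * (e * \<bar>t\<bar> ^ m)"
        using \<delta>(2)[of t] t unfolding shift c0 by (simp add: norm_mult mult_ac)
      then show "norm (\<Sum>j\<le>m. c (Suc j) * of_real t ^ j) \<le> e * \<bar>t\<bar> ^ m"
        using t by (simp add: mult_le_cancel_left)
    qed (use \<delta> in auto)
  qed
  from Suc.IH[OF _ this] c0 Suc.prems(1) show ?case by (cases j) auto
qed

text \<open>Uniqueness of the coefficients in Peano's expansion.\<close>

lemma derivatives_from_expansion:
  fixes d :: "nat \<Rightarrow> real \<Rightarrow> complex"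
  assumes "\<eta> > 0" and "\<And>j t. j < m \<Longrightarrow> \<bar>t\<bar> < \<eta> \<Longrightarrow> (d j has_vector_derivative d (Suc j) t) (at t)"
    and "isCont (d m) 0"
    and expansion: "\<And>t. \<bar>t\<bar> < \<eta> \<Longrightarrow> d 0 t = (\<Sum>j\<le>m. p j * of_real t ^ j) + of_real t ^ m * r t"
    and r: "(r \<longlongrightarrow> 0) (at 0)" and j: "j \<le> m"
  shows "d j 0 = fact j * p j"
proof -
  have p: "small_at_0 m (\<lambda>t. d 0 t - (\<Sum>j\<le>m. p j * of_real t ^ j))"
    unfolding small_at_0_def
  proof (intro allI impI)
    fix e :: real assume e: "e > 0"
    obtain \<delta> where \<delta>: "\<delta> > 0" "\<And>t. 0 < \<bar>t\<bar> \<Longrightarrow> \<bar>t\<bar> < \<delta> \<Longrightarrow> norm (of_real t ^ m * r t) \<le> e * \<bar>t\<bar> ^ m"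
      using small_at_0E[OF small_at_0_tendsto[OF r, of m] e] by blast
    show "\<exists>\<delta>>0. \<forall>t. 0 < \<bar>t\<bar> \<and> \<bar>t\<bar> < \<delta> \<longrightarrow> norm (d 0 t - (\<Sum>j\<le>m. p j * of_real t ^ j)) \<le> e * \<bar>t\<bar> ^ m"
      using \<delta> assms(1) expansion by (intro exI[of _ "min \<delta> \<eta>"]) auto
  qed
  have "small_at_0 m (\<lambda>t. (d 0 t - (\<Sum>j\<le>m. p j * of_real t ^ j)) - (d 0 t - (\<Sum>j\<le>m. of_real (t ^ j / fact j) * d j 0)))"
    by (rule small_at_0_diff[OF p peano_expansion[OF assms(1-3)]])
  also have "(\<lambda>t. (d 0 t - (\<Sum>j\<le>m. p j * of_real t ^ j)) - (d 0 t - (\<Sum>j\<le>m. of_real (t ^ j / fact j) * d j 0)))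
     = (\<lambda>t. \<Sum>j\<le>m. (d j 0 / fact j - p j) * of_real t ^ j)"
    by (simp add: fun_eq_iff sum_subtractf algebra_simps)
  finally have "d j 0 / fact j - p j = 0" by (rule small_polynomial_zero[OF _ j, rotated]) 
  then show ?thesis by (simp add: field_simps)
qed

section \<open>Characteristic functions and cumulants\<close>

context prob_space
begin

lemma fourier_continuous:
  fixes R :: "'a \<Rightarrow> complex"
  assumes R: "integrable M R" and [measurable]: "Y \<in> borel_measurable M"
  shows "continuous_on UNIV (\<lambda>t. CLINT \<omega>|M. R \<omega> * iexp (t * Y \<omega>))"
proof -
  have [measurable]: "R \<in> borel_measurable M" using R by simp
  have "isCont (\<lambda>t. CLINT \<omega>|M. R \<omega> * iexp (t * Y \<omega>)) t" for t
    unfolding isCont_def LIMSEQ_SEQ_conv[symmetric]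
  proof (intro allI impI)
    fix s assume "(\<forall>n. s n \<noteq> t) \<and> s \<longlonglongrightarrow> t"
    then have s: "s \<longlonglongrightarrow> t" by simp
    show "(\<lambda>n. CLINT \<omega>|M. R \<omega> * iexp (s n * Y \<omega>)) \<longlonglongrightarrow> (CLINT \<omega>|M. R \<omega> * iexp (t * Y \<omega>))"
    proof (rule integral_dominated_convergence)
      show "integrable M (\<lambda>\<omega>. norm (R \<omega>))" using R by simp
      show "AE \<omega> in M. (\<lambda>n. R \<omega> * iexp (s n * Y \<omega>)) \<longlonglongrightarrow> R \<omega> * iexp (t * Y \<omega>)"
        by (intro AE_I2 tendsto_intros s)
      show "AE \<omega> in M. norm (R \<omega> * iexp (s n * Y \<omega>)) \<le> norm (R \<omega>)" for n by (simp add: norm_mult)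
    qed measurable
  qed
  then show ?thesis by (simp add: continuous_at_imp_continuous_on)
qed

text \<open>The difference quotients are dominated by a multiple of \<open>|R Y|\<close>, since
  \<open>|exp(ix) - 1 - ix| \<le> 2|x|\<close>; the quadratic bound on the same quantity makes the error vanish pointwise.\<close>

lemma fourier_has_derivative:
  fixes R :: "'a \<Rightarrow> complex"
  assumes R: "integrable M R" and [measurable]: "Y \<in> borel_measurable M"
    and RY: "integrable M (\<lambda>\<omega>. R \<omega> * Y \<omega>)"
  shows "((\<lambda>t. CLINT \<omega>|M. R \<omega> * iexp (t * Y \<omega>)) has_vector_derivative
     (CLINT \<omega>|M. (\<i> * Y \<omega> * R \<omega>) * iexp (t * Y \<omega>))) (at t)"
proof -
  have [measurable]: "R \<in> borel_measurable M" using R by simp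
  have i: "integrable M (\<lambda>\<omega>. R \<omega> * iexp (t * Y \<omega>))" for t by (rule integrable_mult_iexp[OF R]) measurable
  have RY': "integrable M (\<lambda>\<omega>. \<i> * Y \<omega> * R \<omega>)"
    using integrable_mult_right[OF RY, of \<i>] by (simp add: mult_ac)
  have i': "integrable M (\<lambda>\<omega>. (\<i> * Y \<omega> * R \<omega>) * iexp (t * Y \<omega>))" for t
    by (rule integrable_mult_iexp[OF RY']) measurable
  let ?f = "\<lambda>t. CLINT \<omega>|M. R \<omega> * iexp (t * Y \<omega>)" and ?D = "CLINT \<omega>|M. (\<i> * Y \<omega> * R \<omega>) * iexp (t * Y \<omega>)"
  define k where "k = (\<lambda>h \<omega>. R \<omega> * iexp (t * Y \<omega>) * ((iexp (h * Y \<omega>) - (1 + \<i> * (h * Y \<omega>))) /\<^sub>R h))"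
  have "(\<lambda>h. norm (?f (t + h) - ?f t - h *\<^sub>R ?D) / norm h) \<midarrow>0\<rightarrow> 0"
    unfolding LIMSEQ_SEQ_conv[symmetric]
  proof (intro allI impI)
    fix s :: "nat \<Rightarrow> real" assume s: "(\<forall>n. s n \<noteq> 0) \<and> s \<longlonglongrightarrow> 0"
    have eq: "norm (?f (t + h) - ?f t - h *\<^sub>R ?D) / norm h = norm (CLINT \<omega>|M. k h \<omega>)" if h: "h \<noteq> 0" for h
    proof -
      have "?f (t + h) - ?f t - h *\<^sub>R ?D
         = (CLINT \<omega>|M. R \<omega> * iexp ((t + h) * Y \<omega>) - R \<omega> * iexp (t * Y \<omega>) - h *\<^sub>R ((\<i> * Y \<omega> * R \<omega>) * iexp (t * Y \<omega>)))"
        by (simp only: Bochner_Integration.integral_diff Bochner_Integration.integrable_diff integral_scaleR_right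
            integrable_scaleR_right i i')
      also have "\<dots> = (CLINT \<omega>|M. h *\<^sub>R k h \<omega>)"
      proof (rule Bochner_Integration.integral_cong[OF refl])
        fix \<omega>
        have iexp_th: "iexp ((t + h) * Y \<omega>) = iexp (t * Y \<omega>) * iexp (h * Y \<omega>)"
          by (simp only: distrib_right iexp_add)
        show "R \<omega> * iexp ((t + h) * Y \<omega>) - R \<omega> * iexp (t * Y \<omega>) - h *\<^sub>R ((\<i> * Y \<omega> * R \<omega>) * iexp (t * Y \<omega>)) = h *\<^sub>R k h \<omega>"
        proof -
          have "h *\<^sub>R k h \<omega> = R \<omega> * iexp (t * Y \<omega>) * (iexp (h * Y \<omega>) - (1 + \<i> * (h * Y \<omega>)))"
            unfolding k_def using h by simp
          moreover have "r * (T * E) - r * T - x * (\<i> * y * r * T) = r * T * (E - (1 + \<i> * (x * y)))"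
            for r T E x y :: complex by (simp add: algebra_simps)
          ultimately show ?thesis
            unfolding iexp_th by (simp only: scaleR_conv_of_real of_real_mult)
        qed
      qed
      also have "\<dots> = h *\<^sub>R (CLINT \<omega>|M. k h \<omega>)" by simp
      finally show ?thesis using h by simp
    qed
    have "(\<lambda>n. CLINT \<omega>|M. k (s n) \<omega>) \<longlonglongrightarrow> (CLINT \<omega>|M. 0)"
    proof (rule integral_dominated_convergence)
      show "integrable M (\<lambda>\<omega>. 2 * norm (R \<omega> * Y \<omega>))" using RY by simp
      show "AE \<omega> in M. (\<lambda>n. k (s n) \<omega>) \<longlonglongrightarrow> 0"
      proof (rule AE_I2, rule Lim_null_comparison)
        fix \<omega>
        have "norm (k h \<omega>) \<le> norm (R \<omega>) * (\<bar>h\<bar> * (Y \<omega>)\<^sup>2)" if h: "h \<noteq> 0" for h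
        proof -
          have "cmod (iexp (h * Y \<omega>) - (1 + \<i> * (h * Y \<omega>))) \<le> \<bar>h * Y \<omega>\<bar>\<^sup>2 / 2"
            using iexp_approx1[of "h * Y \<omega>" 1] by (simp add: power2_eq_square)
          also have "\<dots> \<le> \<bar>h * Y \<omega>\<bar>\<^sup>2" by simp
          finally have "cmod (iexp (h * Y \<omega>) - (1 + \<i> * (h * Y \<omega>))) \<le> \<bar>h * Y \<omega>\<bar>\<^sup>2" .
          then have "\<bar>inverse h\<bar> * cmod (iexp (h * Y \<omega>) - (1 + \<i> * (h * Y \<omega>))) \<le> \<bar>inverse h\<bar> * \<bar>h * Y \<omega>\<bar>\<^sup>2"
            by (intro mult_left_mono) auto
          also have "\<dots> = \<bar>h\<bar> * (Y \<omega>)\<^sup>2" using h by (simp add: abs_mult power_mult_distrib field_simps power2_eq_square)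
          finally have "norm (R \<omega>) * (\<bar>inverse h\<bar> * cmod (iexp (h * Y \<omega>) - (1 + \<i> * (h * Y \<omega>)))) \<le> norm (R \<omega>) * (\<bar>h\<bar> * (Y \<omega>)\<^sup>2)"
            by (intro mult_left_mono) auto
          then show ?thesis unfolding k_def by (simp add: norm_mult mult_ac)
        qed
        then show "\<forall>\<^sub>F n in sequentially. norm (k (s n) \<omega>) \<le> norm (R \<omega>) * (\<bar>s n\<bar> * (Y \<omega>)\<^sup>2)" using s by simp
        have "(\<lambda>n. norm (R \<omega>) * (\<bar>s n\<bar> * (Y \<omega>)\<^sup>2)) \<longlonglongrightarrow> norm (R \<omega>) * (\<bar>0\<bar> * (Y \<omega>)\<^sup>2)"
          using s by (intro tendsto_intros) auto
        then show "(\<lambda>n. norm (R \<omega>) * (\<bar>s n\<bar> * (Y \<omega>)\<^sup>2)) \<longlonglongrightarrow> 0" by simp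
      qed
      show "AE \<omega> in M. norm (k (s n) \<omega>) \<le> 2 * norm (R \<omega> * Y \<omega>)" for n
      proof (intro AE_I2)
        fix \<omega>
        have "cmod (iexp (s n * Y \<omega>) - (1 + \<i> * (s n * Y \<omega>))) \<le> 2 * \<bar>s n * Y \<omega>\<bar>"
          using iexp_approx2[of "s n * Y \<omega>" 1] by simp
        then have "\<bar>inverse (s n)\<bar> * cmod (iexp (s n * Y \<omega>) - (1 + \<i> * (s n * Y \<omega>))) \<le> \<bar>inverse (s n)\<bar> * (2 * \<bar>s n * Y \<omega>\<bar>)"
          by (intro mult_left_mono) auto
        also have "\<dots> = 2 * \<bar>Y \<omega>\<bar>" using s by (simp add: abs_mult)
        finally have "norm (R \<omega>) * (\<bar>inverse (s n)\<bar> * cmod (iexp (s n * Y \<omega>) - (1 + \<i> * (s n * Y \<omega>)))) \<le> norm (R \<omega>) * (2 * \<bar>Y \<omega>\<bar>)"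
          by (intro mult_left_mono) auto
        then show "norm (k (s n) \<omega>) \<le> 2 * norm (R \<omega> * Y \<omega>)"
          unfolding k_def by (simp add: norm_mult mult_ac)
      qed
      show "k (s n) \<in> borel_measurable M" for n unfolding k_def by measurable
    qed simp
    then have "(\<lambda>n. CLINT \<omega>|M. k (s n) \<omega>) \<longlonglongrightarrow> 0" by simp
    then have "(\<lambda>n. norm (CLINT \<omega>|M. k (s n) \<omega>)) \<longlonglongrightarrow> 0" by (rule tendsto_norm_zero)
    then show "(\<lambda>n. norm (?f (t + s n) - ?f t - s n *\<^sub>R ?D) / norm (s n)) \<longlonglongrightarrow> 0"
    proof -
      have sn: "s n \<noteq> 0" for n using s by blast
      show ?thesis unfolding eq[OF sn] by fact
    qed
  qed
  then show ?thesis
    unfolding has_vector_derivative_def has_derivative_at by (simp add: bounded_linear_scaleR_left)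
qed

text \<open>After division by the characteristic function \<open>\<phi>\<close>, the hypothesis is an expansion of order
  \<open>m\<close> of \<open>\<phi>' / \<phi> = (log \<phi>)'\<close> at zero. The moments make this function \<open>m\<close> times continuously
  differentiable near zero, so the expansion determines its derivatives there.\<close>

lemma cumulant_from_expansion:
  assumes [measurable]: "Y \<in> borel_measurable M"
    and moments: "\<And>k. k \<le> Suc m \<Longrightarrow> integrable M (\<lambda>\<omega>. Y \<omega> ^ k)"
    and expansion: "\<And>t. (CLINT \<omega>|M. of_real (Y \<omega>) * iexp (t * Y \<omega>))
        = (\<Sum>j<m. p j * of_real t ^ j) * (CLINT \<omega>|M. iexp (t * Y \<omega>)) + of_real t ^ m * \<rho> t"
    and \<rho>: "isCont \<rho> 0" and s: "s \<le> m" and pm: "p m = \<rho> 0"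
  shows "cumulant M (s + 1) Y = (- \<i>) ^ s * (fact s * p s)"
proof -
  define \<phi> where "\<phi> = (\<lambda>k t. CLINT \<omega>|M. (\<i> * Y \<omega>) ^ k * iexp (t * Y \<omega>))"
  have int: "complex_integrable M (\<lambda>\<omega>. (\<i> * Y \<omega>) ^ k)" if "k \<le> Suc m" for k
  proof -
    have "complex_integrable M (\<lambda>\<omega>. \<i> ^ k * of_real (Y \<omega> ^ k))"
      using moments[OF that] by (intro integrable_mult_right integrable_of_real)
    then show ?thesis by (simp add: power_mult_distrib)
  qed
  have d\<phi>: "(\<phi> k has_vector_derivative \<phi> (Suc k) t) (at t)" if "k < Suc m" for k t
  proof -
    have "complex_integrable M (\<lambda>\<omega>. (- \<i>) * (\<i> * Y \<omega>) ^ Suc k)"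
      by (intro integrable_mult_right int) (use that in simp)
    also have "(\<lambda>\<omega>. (- \<i>) * (\<i> * Y \<omega>) ^ Suc k) = (\<lambda>\<omega>. (\<i> * Y \<omega>) ^ k * Y \<omega>)" by (simp add: fun_eq_iff mult_ac)
    finally have "complex_integrable M (\<lambda>\<omega>. (\<i> * Y \<omega>) ^ k * Y \<omega>)" .
    from fourier_has_derivative[OF int _ this, of t] that show ?thesis by (simp add: \<phi>_def)
  qed
  have c\<phi>: "continuous_on UNIV (\<phi> k)" if "k \<le> Suc m" for k
    unfolding \<phi>_def by (rule fourier_continuous[OF int[OF that]]) measurable
  have \<phi>00: "\<phi> 0 0 = 1" by (simp add: \<phi>_def prob_space)
  have "isCont (\<phi> 0) 0" using c\<phi>[of 0] by (simp add: continuous_on_eq_continuous_at)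
  then have "(\<phi> 0 \<longlongrightarrow> 1) (at 0)" by (simp add: isCont_def \<phi>00)
  from tendstoD[OF this, of 1] obtain \<eta> where \<eta>: "\<eta> > 0" "\<And>t. t \<noteq> 0 \<Longrightarrow> \<bar>t\<bar> < \<eta> \<Longrightarrow> dist (\<phi> 0 t) 1 < 1"
    by (auto simp: eventually_at)
  have Re_pos: "Re (\<phi> 0 t) > 0" if "\<bar>t\<bar> < \<eta>" for t
  proof (cases "t = 0")
    case False
    then have "cmod (\<phi> 0 t - 1) < 1" using \<eta>(2) that by (simp add: dist_norm)
    then have "\<bar>Re (\<phi> 0 t - 1)\<bar> < 1" using abs_Re_le_cmod le_less_trans by blast
    then show ?thesis by simp
  qed (simp add: \<phi>00)
  have nz: "\<phi> 0 t \<noteq> 0" if "\<bar>t\<bar> < \<eta>" for t using Re_pos[OF that] by auto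
  \<comment> \<open>on this interval \<open>\<phi>\<close> stays in the right half plane, where \<open>Ln\<close> is smooth\<close>
  define S where "S = {-\<eta><..<\<eta>}"
  have S: "open S" "0 \<in> S" "\<And>t. t \<in> S \<longleftrightarrow> \<bar>t\<bar> < \<eta>" using \<eta>(1) by (auto simp: S_def)
  have C0: "Ck (Suc m) S (\<phi> 0)"
    using Ck_if_chain[of "Suc m" \<phi> "Suc m" S, OF d\<phi> c\<phi>] by (simp del: Ck.simps)
  have C1: "Ck m S (\<phi> (Suc 0))"
    using Ck_if_chain[of "Suc m" \<phi> m S, OF d\<phi> c\<phi>] by (simp add: Suc_diff_le del: Ck.simps)
  have "Ck m S (\<lambda>t. \<phi> (Suc 0) t * inverse (\<phi> 0 t))"
    by (rule Ck_mult[OF C1 Ck_inverse[OF Ck_SucD[OF C0]]]) (use nz S(3) in auto)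
  from Ck_chain[OF this] obtain d where d0: "d 0 = (\<lambda>t. \<phi> (Suc 0) t * inverse (\<phi> 0 t))"
    and d: "\<And>j t. j < m \<Longrightarrow> t \<in> S \<Longrightarrow> (d j has_vector_derivative d (Suc j) t) (at t)"
    and dm: "continuous_on S (d m)" by blast
  have "isCont (d m) 0" using dm S continuous_on_eq_continuous_at by blast
  define r where "r = (\<lambda>t. \<i> * (\<rho> t * inverse (\<phi> 0 t) - p m))"
  have "isCont r 0"
    unfolding r_def using \<rho> \<open>isCont (\<phi> 0) 0\<close> \<phi>00 by (intro continuous_intros) auto
  then have r: "(r \<longlongrightarrow> 0) (at 0)" by (simp add: isCont_def r_def \<phi>00 pm)
  have "d s 0 = fact s * (\<i> * p s)"
  proof (rule derivatives_from_expansion[where d = d and p = "\<lambda>j. \<i> * p j" and m = m and r = r,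
        OF \<eta>(1) _ \<open>isCont (d m) 0\<close> _ r s])
    show "(d j has_vector_derivative d (Suc j) t) (at t)" if "j < m" "\<bar>t\<bar> < \<eta>" for j t
      using d that S(3) by blast
    fix t :: real assume t: "\<bar>t\<bar> < \<eta>"
    have "\<phi> (Suc 0) t = \<i> * (CLINT \<omega>|M. of_real (Y \<omega>) * iexp (t * Y \<omega>))"
      by (simp add: \<phi>_def mult.assoc)
    also have "\<dots> = \<i> * ((\<Sum>j<m. p j * of_real t ^ j) * \<phi> 0 t + of_real t ^ m * \<rho> t)"
      unfolding expansion by (simp add: \<phi>_def)
    finally have "d 0 t = \<i> * ((\<Sum>j<m. p j * of_real t ^ j) + of_real t ^ m * (\<rho> t * inverse (\<phi> 0 t)))"
      unfolding d0 using nz[OF t] by (simp add: field_simps)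
    also have "\<dots> = (\<Sum>j\<le>m. \<i> * p j * of_real t ^ j) + of_real t ^ m * r t"
      by (simp add: r_def lessThan_Suc_atMost[symmetric] sum_distrib_left algebra_simps)
    finally show "d 0 t = (\<Sum>j\<le>m. \<i> * p j * of_real t ^ j) + of_real t ^ m * r t" .
  qed
  define u where "u = (\<lambda>j. case j of 0 \<Rightarrow> (\<lambda>t. Ln (\<phi> 0 t)) | Suc i \<Rightarrow> d i)"
  have char: "char (distr M borel Y) = \<phi> 0"
    by (simp add: fun_eq_iff char_def \<phi>_def integral_distr)
  have "((\<lambda>f t. vector_derivative f (at t)) ^^ (s + 1)) (u 0) 0 = u (s + 1) 0"
  proof (rule iterated_vector_derivative[OF S(1), of "Suc m"])
    fix j t assume j: "j < Suc m" and t: "t \<in> S"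
    show "(u j has_vector_derivative u (Suc j) t) (at t)"
    proof (cases j)
      case 0
      have "\<phi> 0 t \<notin> \<real>\<^sub>\<le>\<^sub>0" using Re_pos[of t] t S(3) by (auto simp: complex_nonpos_Reals_iff)
      then have "(Ln has_field_derivative inverse (\<phi> 0 t)) (at (\<phi> 0 t))" by (rule has_field_derivative_Ln)
      from field_vector_diff_chain_at[OF d\<phi>[of 0 t] this] show ?thesis by (simp add: 0 u_def d0 comp_def)
    next
      case (Suc i) then show ?thesis using d[of i t] j t by (simp add: u_def)
    qed
  qed (use s S in auto)
  then have "cumulant M (s + 1) Y = (- \<i>) ^ (s + 1) * d s 0"
    unfolding cumulant_def char by (simp add: u_def)
  also have "\<dots> = (- \<i>) ^ s * (fact s * p s)" unfolding \<open>d s 0 = fact s * (\<i> * p s)\<close> by (simp add: mult_ac)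
  finally show ?thesis .
qed

end

text \<open>Iterated integration by parts: \<open>E[F exp(itF)]\<close> as a polynomial in \<open>it\<close> times the
  characteristic function, plus a remainder carrying \<open>\<Gamma>\<^sub>n(F)\<close>.\<close>

lemma (in isonormal_process) Gamma_expansion:
  assumes F: "has_malliavin_deriv M X 2 F U"
    and \<Gamma>: "\<And>j. j < n \<Longrightarrow> Gamma_rv M X F j \<in> Lp_fun M 2"
  shows "(CLINT \<omega>|M. of_real (F \<omega>) * iexp (t * F \<omega>))
     = (\<Sum>j<n. (\<i> ^ j * of_real (LINT \<omega>|M. Gamma_rv M X F j \<omega>)) * of_real t ^ j) * (CLINT \<omega>|M. iexp (t * F \<omega>))
       + of_real t ^ n * (\<i> ^ n * (CLINT \<omega>|M. of_real (Gamma_rv M X F n \<omega>) * iexp (t * F \<omega>)))"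
  using \<Gamma>
proof (induction n)
  case (Suc n)
  have D: "has_malliavin_deriv M X 2 F (malliavin_deriv M X F)"
    by (rule has_malliavin_deriv_malliavin_deriv[OF F])
  have step: "(CLINT \<omega>|M. of_real (Gamma_rv M X F n \<omega>) * iexp (t * F \<omega>))
      = of_real (LINT \<omega>|M. Gamma_rv M X F n \<omega>) * (CLINT \<omega>|M. iexp (t * F \<omega>))
        + \<i> * t * (CLINT \<omega>|M. of_real (Gamma_rv M X F (Suc n) \<omega>) * iexp (t * F \<omega>))"
    using malliavin_ibp_iexp(2)[OF D Suc.prems[of n], of t] by simp
  have IH: "(CLINT \<omega>|M. of_real (F \<omega>) * iexp (t * F \<omega>))
     = (\<Sum>j<n. (\<i> ^ j * of_real (LINT \<omega>|M. Gamma_rv M X F j \<omega>)) * of_real t ^ j) * (CLINT \<omega>|M. iexp (t * F \<omega>))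
       + of_real t ^ n * (\<i> ^ n * (CLINT \<omega>|M. of_real (Gamma_rv M X F n \<omega>) * iexp (t * F \<omega>)))"
    using Suc by simp
  have "S * \<phi> + T * (I * (\<mu> * \<phi> + \<i> * t * g)) = (S + (I * \<mu>) * T) * \<phi> + (t * T) * ((\<i> * I) * g)"
    for S \<phi> T I \<mu> g :: complex by (simp add: algebra_simps)
  then show ?case unfolding IH step sum.lessThan_Suc power_Suc .
qed simp

theorem theorem4p3:
  fixes M :: "'a measure"
    and X :: "'h::{real_inner, banach, second_countable_topology} \<Rightarrow> 'a \<Rightarrow> real"
    and F :: "'a \<Rightarrow> real"
    and m :: nat
  assumes "isonormal M X"
    and "m \<ge> 2"
    and "F \<in> Lp_fun M (real (4 * m - 4)) \<inter> malliavin_space M X 4"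
    and "\<And>j. j \<le> m - 1 \<Longrightarrow> Gamma_rv M X F j \<in> Lp_fun M 2"
  shows "\<forall>s\<le>m. cumulant M (s + 1) F = complex_of_real (fact s * (LINT \<omega>|M. Gamma_rv M X F s \<omega>))"
proof (intro allI impI)
  fix s assume s: "s \<le> m"
  have "prob_space M" using assms(1) unfolding isonormal_def by blast
  then interpret isonormal_process M X
    using assms(1) by (intro isonormal_process.intro isonormal_process_axioms.intro)
  obtain U where "has_malliavin_deriv M X 4 F U" using assms(3) by (auto simp: malliavin_space_def)
  then have F: "has_malliavin_deriv M X 2 F U" by (rule has_malliavin_deriv_4_imp_2)
  then have F': "has_malliavin_deriv M X 2 F (malliavin_deriv M X F)"
    by (rule has_malliavin_deriv_malliavin_deriv)
  have FL: "F \<in> Lp_fun M (real (4 * m - 4))" using assms(3) by blast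
  then have [measurable]: "F \<in> borel_measurable M" by (simp add: Lp_fun_def)
  have moments: "integrable M (\<lambda>\<omega>. F \<omega> ^ k)" if k: "k \<le> Suc m" for k
  proof (rule Bochner_Integration.integrable_bound)
    show "integrable M (\<lambda>\<omega>. 1 + norm (F \<omega>) powr real (4 * m - 4))" using FL by (simp add: Lp_fun_def)
    \<comment> \<open>\<open>m + 1 \<le> 4 m - 4\<close> for \<open>m \<ge> 2\<close>\<close>
    have "k \<le> 4 * m - 4" using k assms(2) by simp
    have "\<bar>x\<bar> ^ k \<le> 1 + \<bar>x\<bar> powr real (4 * m - 4)" for x :: real
    proof (cases "\<bar>x\<bar> \<le> 1")
      case True
      then have "\<bar>x\<bar> ^ k \<le> 1" by (simp add: power_le_one)
      then show ?thesis by (simp add: add_increasing2)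
    next
      case False
      then have "\<bar>x\<bar> ^ k \<le> \<bar>x\<bar> ^ (4 * m - 4)" using \<open>k \<le> 4 * m - 4\<close> by (intro power_increasing) auto
      also have "\<dots> = \<bar>x\<bar> powr real (4 * m - 4)" using False by (intro powr_realpow[symmetric]) auto
      finally show ?thesis by simp
    qed
    then show "AE \<omega> in M. norm (F \<omega> ^ k) \<le> norm (1 + norm (F \<omega>) powr real (4 * m - 4))"
      by (simp add: power_abs)
  qed measurable
  define p where "p = (\<lambda>j. \<i> ^ j * complex_of_real (LINT \<omega>|M. Gamma_rv M X F j \<omega>))"
  define \<rho> where "\<rho> = (\<lambda>t. \<i> ^ m * (CLINT \<omega>|M. of_real (Gamma_rv M X F m \<omega>) * iexp (t * F \<omega>)))"
  obtain m' where m': "m = Suc m'" using assms(2) by (cases m) auto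
  have "integrable M (Gamma_rv M X F m)"
    unfolding m' using malliavin_ibp_iexp(1)[OF F' assms(4)[of m']] m' by simp
  then have "continuous_on UNIV (\<lambda>t. CLINT \<omega>|M. of_real (Gamma_rv M X F m \<omega>) * iexp (t * F \<omega>))"
    by (intro fourier_continuous) auto
  then have \<rho>: "isCont \<rho> 0"
    unfolding \<rho>_def by (intro continuous_intros) (simp add: continuous_on_eq_continuous_at)
  have "cumulant M (s + 1) F = (- \<i>) ^ s * (fact s * p s)"
  proof (rule cumulant_from_expansion[OF _ moments _ \<rho> s])
    show "p m = \<rho> 0" by (simp add: p_def \<rho>_def)
    show "(CLINT \<omega>|M. of_real (F \<omega>) * iexp (t * F \<omega>))
        = (\<Sum>j<m. p j * of_real t ^ j) * (CLINT \<omega>|M. iexp (t * F \<omega>)) + of_real t ^ m * \<rho> t" for t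
      unfolding p_def \<rho>_def by (rule Gamma_expansion[OF F]) (use assms(4) in auto)
  qed auto
  also have "\<dots> = ((- \<i>) ^ s * \<i> ^ s) * complex_of_real (fact s * (LINT \<omega>|M. Gamma_rv M X F s \<omega>))"
    by (simp add: p_def)
  also have "(- \<i>) ^ s * \<i> ^ s = 1" by (simp flip: power_mult_distrib)
  finally show "cumulant M (s + 1) F = complex_of_real (fact s * (LINT \<omega>|M. Gamma_rv M X F s \<omega>))" by simp
qed

end
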